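(* Let $p\ge1$, let $\boldsymbol{X}$ be a non-degenerate random vector in $\mathbb{R}^p$ with $E[\|\boldsymbol{X}\|^4]<+\infty$, and let $Y$ be a real random variable such that $\boldsymbol{X}$ and $Y$ are independent. Let $DDC_n(\boldsymbol{X},Y)$ be computed from $n$ independent copies $(\boldsymbol{X}_1,Y_1),\dots,(\boldsymbol{X}_n,Y_n)$ of $(\boldsymbol{X},Y)$. Then, as $n\to\infty$, $$\sqrt{n}\,DDC_n(\boldsymbol{X},Y)\xrightarrow{D}N\left(0,\frac{(dVar(\boldsymbol{X}))^2}{\Delta^2}\right),$$ where $\Delta=E[\|\boldsymbol{X}_1-\boldsymbol{X}_2\|]$ and $dVar(\boldsymbol{X})$ is the distance variance of $\boldsymbol{X}$, which, since the second moment of $\boldsymbol{X}$ exists, can be expressed as $$(dVar(\boldsymbol{X}))^2=E[\|\boldsymbol{X}_1-\boldsymbol{X}_2\|^2]-2E[\|\boldsymbol{X}_1-\boldsymbol{X}_2\|\,\|\boldsymbol{X}_1-\boldsymbol{X}_3\|]+\big(E[\|\boldsymbol{X}_1-\boldsymbol{X}_2\|]\big)^2,$$ with $\boldsymbol{X}_1,\boldsymbol{X}_2,\boldsymbol{X}_3$ independent copies of $\boldsymbol{X}$.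
   Context: $\|\cdot\|$ is the Euclidean norm; non-degenerate means not almost surely equal to a constant vector; $\xrightarrow{D}$ is convergence in distribution. Sample coefficient: for independent samples $(\boldsymbol{X}_i,Y_i)$, $i=1,\dots,n$ ($n\ge2$), from $(\boldsymbol{X},Y)$, rearrange the pairs as $(\boldsymbol{X}_{(i)},Y_{(i)})$, $i=1,\dots,n$, satisfying $Y_{(1)}\le\cdots\le Y_{(n)}$, and set $$DDC_n(\boldsymbol{X},Y)=1-\frac{n\sum_{i=1}^{n-1}\|\boldsymbol{X}_{(i)}-\boldsymbol{X}_{(i+1)}\|}{\sum_{i,j=1}^n\|\boldsymbol{X}_i-\boldsymbol{X}_j\|},$$ with $DDC_n(\boldsymbol{X},Y)=0$ if all $\boldsymbol{X}_i$ are equal to the same constant vector. Distance variance (Székely, Rizzo and Bakirov, 2007): $dVar(\boldsymbol{X})\ge0$ is defined by $$(dVar(\boldsymbol{X}))^2=\frac{1}{c_p^2}\int_{\mathbb{R}^p}\int_{\mathbb{R}^p}\frac{|\phi(\boldsymbol{t}+\boldsymbol{s})-\phi(\boldsymbol{t})\phi(\boldsymbol{s})|^2}{\|\boldsymbol{t}\|^{p+1}\|\boldsymbol{s}\|^{p+1}}\,d\boldsymbol{t}\,d\boldsymbol{s},$$ where $\phi(\boldsymbol{t})=E[e^{i\langle\boldsymbol{t},\boldsymbol{X}\rangle}]$ and $c_p=\pi^{(1+p)/2}/\Gamma((1+p)/2)$. *)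

theory Defs
  imports "HOL-Probability.Probability"
begin

(* prob_space.indep_var requires both random variables to have the same codomain type;
   this is its characterisation indep_var_eq for two different codomains (the two families
   of preimages are already sigma-algebras). *)
definition indep_rv ::
  "'a measure \<Rightarrow> 'b measure \<Rightarrow> ('a \<Rightarrow> 'b) \<Rightarrow> 'c measure \<Rightarrow> ('a \<Rightarrow> 'c) \<Rightarrow> bool" where
  "indep_rv M S X T Y \<longleftrightarrow>
     X \<in> measurable M S \<and> Y \<in> measurable M T \<and>
     prob_space.indep_set M {X -` A \<inter> space M |A. A \<in> sets S} {Y -` B \<inter> space M |B. B \<in> sets T}"

definition nondegenerate :: "'a measure \<Rightarrow> ('a \<Rightarrow> 'v) \<Rightarrow> bool" where
  "nondegenerate M X \<longleftrightarrow> \<not> (\<exists>c. AE \<omega> in M. X \<omega> = c)"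

(* Samples of size n are indexed by {..<n}; the s i-th observation comes i-th (counted from 0)
   in the rearranged sample. *)
definition sorting_perm :: "nat \<Rightarrow> (nat \<Rightarrow> real) \<Rightarrow> (nat \<Rightarrow> nat) \<Rightarrow> bool" where
  "sorting_perm n y s \<longleftrightarrow>
     s permutes {..<n} \<and> (\<forall>i j. i \<le> j \<longrightarrow> j < n \<longrightarrow> y (s i) \<le> y (s j))"

(* If there are ties among the y-values, the sorting permutation is not unique. A sorting rule
   picks one from the y-values y 0, ..., y (n - 1) and possibly an external randomisation u
   with values in the measurable space N. This covers, among others, keeping tied observations
   in their original order (ignore u) and breaking ties uniformly at random. What is excluded is
   looking at the x-values: for a constant Y, say, one could otherwise sort the sample by X. *)
definition sorting_rule ::
  "'u measure \<Rightarrow> (nat \<Rightarrow> (nat \<Rightarrow> real) \<Rightarrow> 'u \<Rightarrow> nat \<Rightarrow> nat) \<Rightarrow> bool" where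
  "sorting_rule N \<tau> \<longleftrightarrow>
     (\<forall>n. (\<lambda>(y, u). \<tau> n y u)
            \<in> measurable ((\<Pi>\<^sub>M i\<in>{..<n}. borel) \<Otimes>\<^sub>M N) (count_space UNIV) \<and>
          (\<forall>y\<in>space (\<Pi>\<^sub>M i\<in>{..<n}. borel). \<forall>u\<in>space N. sorting_perm n y (\<tau> n y u)))"

(* The coefficient of the x-sample x 0, ..., x (n - 1) rearranged by s, a permutation sorting
   the corresponding y-sample. *)
definition DDC :: "nat \<Rightarrow> (nat \<Rightarrow> 'v::euclidean_space) \<Rightarrow> (nat \<Rightarrow> nat) \<Rightarrow> real" where
  "DDC n x s =
     (if \<exists>c. \<forall>i<n. x i = c then 0
      else 1 - real n * (\<Sum>i<n - 1. norm (x (s i) - x (s (i + 1))))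
                 / (\<Sum>i<n. \<Sum>j<n. norm (x i - x j)))"

definition char_fun :: "'a measure \<Rightarrow> ('a \<Rightarrow> 'v::euclidean_space) \<Rightarrow> 'v \<Rightarrow> complex" where
  "char_fun M X t = (CLINT \<omega>|M. iexp (t \<bullet> X \<omega>))"

definition dist_const :: "nat \<Rightarrow> real" where
  "dist_const p = pi powr ((1 + real p) / 2) / Gamma ((1 + real p) / 2)"

(* The integrand is nonnegative, so the double integral is taken in ennreal; it is finite
   whenever X has a finite first moment. *)
definition dVar :: "'a measure \<Rightarrow> ('a \<Rightarrow> 'v::euclidean_space) \<Rightarrow> real" where
  "dVar M X = sqrt (1 / (dist_const DIM('v))\<^sup>2 *
     enn2real (\<integral>\<^sup>+ t. \<integral>\<^sup>+ s.
       ennreal ((cmod (char_fun M X (t + s) - char_fun M X t * char_fun M X s))\<^sup>2 /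
                (norm t ^ (DIM('v) + 1) * norm s ^ (DIM('v) + 1)))
       \<partial>lborel \<partial>lborel))"

end

theory Submission
  imports Defs "HOL-Real_Asymp.Real_Asymp"
begin

text \<open>
  Let \<open>a x = E (norm (x - X))\<close>, \<open>\<Delta> = E (a X)\<close> and
  \<open>k x y = norm (x - y) - a x - a y + \<Delta>\<close>, so that \<open>E (k x X) = 0\<close> for every \<open>x\<close>.

  The identity \<open>\<integral> (1 - cos (t \<bullet> x)) / norm t ^ (p + 1) dt = c\<^sub>p * norm x\<close> turns the double
  integral in the definition of the distance variance into \<open>E (k X\<^sub>1 X\<^sub>2)\<^sup>2\<close>: the squared modulus of
  \<open>\<phi> (t + s) - \<phi> t * \<phi> s\<close> is the expectation of a product of a function of \<open>t\<close> and the same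
  function of \<open>s\<close>, whose integral is \<open>- c\<^sub>p * k X\<^sub>1 X\<^sub>2\<close>.

  The sorting permutation is independent of the exchangeable \<open>X\<close>-sample and may be replaced
  by the identity. Inserting \<open>k\<close> in the coefficient, the linear parts cancel, and
  \<open>sqrt n * DDC\<^sub>n\<close> equals \<open>- (\<Sum>i. k X\<^sub>i X\<^sub>i\<^sub>+\<^sub>1) / (sqrt n * \<Delta>)\<close> up to terms that vanish in
  probability. The summands are 1-dependent and uncorrelated; cutting them into long blocks
  separated by single dropped summands reduces to the classical central limit theorem.
\<close>

text \<open>The kernel is what remains of \<open>norm (x - y)\<close> after Hoeffding's projection
  onto constants and functions of one variable. In the full double sum each variable carries linear
  weight about \<open>2 * n\<close>, in the consecutive sum weight 2 except at the two ends; after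
  multiplication by \<open>n\<close> the weights agree, which is why only the kernel is left. The
  kernel part of the full double sum has standard deviation of order \<open>n\<close>, against
  \<open>n powr (3 / 2)\<close> for \<open>n\<close> times the consecutive sum, so it is lost in the
  limit. The obstacle to the classical theorem is that neighbouring summands share a variable. The
  block length \<open>m\<close> is held fixed while \<open>n\<close> tends to infinity and grows
  only afterwards; the fraction of variance given up is \<open>1 / (m + 1)\<close>. Errors are
  measured in mean absolute value, which orthogonality bounds through second moments, and pass to
  characteristic functions because \<open>iexp\<close> is Lipschitz.\<close>

section \<open>Fourier integral of the Euclidean norm\<close>

lemma nn_integral_powr_exp_scaled:
  fixes z a :: real
  assumes z: "z > 0" and a: "a > 0"
  shows "(\<integral>\<^sup>+u. ennreal (indicator {0<..} u * u powr (z - 1) * exp (- (a * u))) \<partial>lborel)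
    = ennreal (Gamma z / a powr z)"
proof -
  define f :: "real \<Rightarrow> real" where "f u = indicator {0<..} u * u powr (z - 1) * exp (- u)" for u
  have [measurable]: "f \<in> borel_measurable borel"
    unfolding f_def by measurable
  have "((\<lambda>t. if t \<in> {0..} then t powr (z - 1) / exp t else 0) has_integral Gamma z) UNIV"
    using Gamma_integral_real[OF z] by (subst has_integral_restrict_UNIV)
  also have "(\<lambda>t. if t \<in> {0..} then t powr (z - 1) / exp t else 0) = f"
    by (auto simp: f_def fun_eq_iff exp_minus field_simps indicator_def)
  finally have "(\<integral>\<^sup>+u. ennreal (f u) \<partial>lborel) = ennreal (Gamma z)"
    by (intro nn_integral_has_integral_lborel) (auto simp: f_def)
  then have "ennreal (Gamma z) = ennreal a * (\<integral>\<^sup>+u. ennreal (f (0 + a * u)) \<partial>lborel)"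
    using a by (subst (asm) nn_integral_real_affine[where c = a and t = 0]) auto
  also have "(\<integral>\<^sup>+u. ennreal (f (0 + a * u)) \<partial>lborel)
      = (\<integral>\<^sup>+u. ennreal (a powr (z - 1)) * ennreal (indicator {0<..} u * u powr (z - 1) * exp (- (a * u))) \<partial>lborel)"
    using a by (intro nn_integral_cong)
      (auto simp: f_def indicator_def powr_mult zero_less_mult_iff mult.assoc simp flip: ennreal_mult)
  also have "\<dots> = ennreal (a powr (z - 1)) *
      (\<integral>\<^sup>+u. ennreal (indicator {0<..} u * u powr (z - 1) * exp (- (a * u))) \<partial>lborel)"
    by (intro nn_integral_cmult) measurable
  also have "ennreal a * \<dots> = ennreal (a powr z) *
      (\<integral>\<^sup>+u. ennreal (indicator {0<..} u * u powr (z - 1) * exp (- (a * u))) \<partial>lborel)"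
    using a by (simp add: powr_diff ennreal_mult[symmetric] mult.assoc[symmetric])
  finally have "ennreal (1 / a powr z) * ennreal (Gamma z) = ennreal (1 / a powr z) * (ennreal (a powr z) *
      (\<integral>\<^sup>+u. ennreal (indicator {0<..} u * u powr (z - 1) * exp (- (a * u))) \<partial>lborel))"
    by simp
  moreover have "ennreal (1 / a powr z) * ennreal (a powr z) = 1"
    using a by (simp flip: ennreal_mult)
  ultimately show ?thesis
    using a z Gamma_real_pos[of z] by (simp flip: mult.assoc ennreal_mult)
qed

text \<open>The characteristic function of the standard normal law, rescaled: with
  \<open>c = sqrt (2 * u)\<close> one has \<open>u * t\<^sup>2 = (c * t)\<^sup>2 / 2\<close>, and
  \<open>sqrt (2 * pi)\<close> removes the normalising factor of the density.\<close>

lemma has_bochner_integral_gaussian_iexp: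
  fixes u y :: real
  assumes u: "u > 0"
  shows "has_bochner_integral lborel (\<lambda>t. iexp (y * t) * of_real (exp (- (u * t\<^sup>2))))
    (of_real (sqrt (pi / u) * exp (- (y\<^sup>2 / (4 * u)))))"
proof -
  define c where "c = sqrt (2 * u)"
  have c: "c > 0" "c\<^sup>2 = 2 * u" using u by (auto simp: c_def)
  define f :: "real \<Rightarrow> complex" where
    "f s = iexp (y / c * s) * of_real (std_normal_density s)" for s
  interpret N: real_distribution std_normal_distribution
    by (rule real_dist_normal_dist)
  have "integrable std_normal_distribution (\<lambda>s. iexp (y / c * s))"
    by (intro N.integrable_iexp) auto
  then have int: "integrable lborel f"
    by (subst (asm) integrable_density) (auto simp: f_def[abs_def] scaleR_conv_of_real mult.commute)
  have "char std_normal_distribution (y / c) = integral\<^sup>L lborel f"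
    unfolding char_def by (subst integral_density) (auto simp: f_def[abs_def] scaleR_conv_of_real mult.commute)
  then have "integral\<^sup>L lborel f = of_real (exp (- ((y / c)\<^sup>2 / 2)))"
    by (simp add: char_std_normal_distribution)
  then have "has_bochner_integral lborel f (of_real (exp (- ((y / c)\<^sup>2 / 2))))"
    using int by (simp add: has_bochner_integral_iff)
  then have "has_bochner_integral lborel (\<lambda>t. f (0 + c * t))
      (of_real (exp (- ((y / c)\<^sup>2 / 2))) /\<^sub>R \<bar>c\<bar>)"
    using c by (subst (asm) lborel_has_bochner_integral_real_affine_iff[where c = c and t = 0]) auto
  then have "has_bochner_integral lborel (\<lambda>t. of_real (sqrt (2 * pi)) * f (0 + c * t))
      (of_real (sqrt (2 * pi)) * (of_real (exp (- ((y / c)\<^sup>2 / 2))) /\<^sub>R \<bar>c\<bar>))"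
    by (intro has_bochner_integral_mult_right)
  also have "(\<lambda>t. of_real (sqrt (2 * pi)) * f (0 + c * t)) = (\<lambda>t. iexp (y * t) * of_real (exp (- (u * t\<^sup>2))))"
    using c by (auto simp: f_def fun_eq_iff std_normal_density_def power_mult_distrib field_simps)
  also have "complex_of_real (sqrt (2 * pi)) * (of_real (exp (- ((y / c)\<^sup>2 / 2))) /\<^sub>R \<bar>c\<bar>)
      = of_real (sqrt (2 * pi) / c * exp (- ((y / c)\<^sup>2 / 2)))"
    using c by (simp add: scaleR_conv_of_real field_simps)
  also have "sqrt (2 * pi) / c = sqrt (pi / u)"
    by (simp add: c_def real_sqrt_mult real_sqrt_divide)
  also have "(y / c)\<^sup>2 / 2 = y\<^sup>2 / (4 * u)"
    by (simp add: power_divide c)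
  finally show ?thesis .
qed

lemma norm_power2_eq_sum_Basis:
  fixes t :: "'v::euclidean_space"
  shows "(norm t)\<^sup>2 = (\<Sum>b\<in>Basis. (t \<bullet> b)\<^sup>2)"
  unfolding power2_norm_eq_inner by (subst euclidean_inner) (simp add: power2_eq_square)

text \<open>Integrand and Lebesgue measure both factor over the coordinates in \<open>Basis\<close>,
  so the integral is a product of one-dimensional ones.\<close>

lemma has_bochner_integral_gaussian_iexp_inner:
  fixes x :: "'v::euclidean_space" and u :: real
  assumes u: "u > 0"
  shows "has_bochner_integral lborel (\<lambda>t. iexp (t \<bullet> x) * of_real (exp (- (u * (norm t)\<^sup>2))))
    (of_real (sqrt (pi / u) ^ DIM('v) * exp (- ((norm x)\<^sup>2 / (4 * u)))))"
proof -
  define f :: "'v \<Rightarrow> real \<Rightarrow> complex" where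
    "f b s = iexp ((x \<bullet> b) * s) * of_real (exp (- (u * s\<^sup>2)))" for b s
  have f: "integrable lborel (f b)"
      "integral\<^sup>L lborel (f b) = of_real (sqrt (pi / u) * exp (- ((x \<bullet> b)\<^sup>2 / (4 * u))))" for b
    using has_bochner_integral_gaussian_iexp[OF u, of "x \<bullet> b"]
    unfolding f_def[abs_def] has_bochner_integral_iff by blast+
  interpret product_sigma_finite "\<lambda>_::'v. lborel :: real measure" ..
  define F :: "'v \<Rightarrow> complex" where "F t = iexp (t \<bullet> x) * of_real (exp (- (u * (norm t)\<^sup>2)))" for t
  have [measurable]: "F \<in> borel_measurable borel" unfolding F_def by measurable
  have F: "F t = (\<Prod>b\<in>Basis. f b (t \<bullet> b))" for t
  proof -
    have "(\<Prod>b\<in>Basis. f b (t \<bullet> b)) = exp (\<Sum>b\<in>Basis. \<i> * of_real ((x \<bullet> b) * (t \<bullet> b)) - of_real (u * (t \<bullet> b)\<^sup>2))"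
      by (simp add: f_def exp_sum exp_diff exp_minus of_real_exp field_simps exp_of_real)
    also have "(\<Sum>b\<in>Basis. \<i> * of_real ((x \<bullet> b) * (t \<bullet> b)) - complex_of_real (u * (t \<bullet> b)\<^sup>2))
        = \<i> * of_real (t \<bullet> x) - of_real (u * (norm t)\<^sup>2)"
      by (simp add: norm_power2_eq_sum_Basis euclidean_inner[of t x] sum_subtractf sum_distrib_left mult.commute)
    finally show ?thesis by (simp add: F_def exp_diff exp_minus of_real_exp field_simps)
  qed
  have *: "F (\<Sum>b\<in>Basis. g b *\<^sub>R b) = (\<Prod>b\<in>Basis. f b (g b))" for g
    unfolding F by (intro prod.cong) (auto simp: inner_sum_left inner_Basis if_distrib cong: if_cong)
  have "integrable (\<Pi>\<^sub>M b\<in>Basis. lborel) (\<lambda>g. \<Prod>b\<in>(Basis::'v set). f b (g b))"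
    using f by (intro product_integrable_prod) auto
  then have "integrable lborel F"
    by (subst lborel_eq, subst integrable_distr_eq) (auto simp: *)
  moreover have "integral\<^sup>L lborel F = (\<Prod>b\<in>(Basis::'v set). integral\<^sup>L lborel (f b))"
    by (subst lborel_eq, subst integral_distr) (auto simp: * f(1) intro!: product_integral_prod)
  moreover have "(\<Prod>b\<in>(Basis::'v set). integral\<^sup>L lborel (f b))
      = of_real (sqrt (pi / u) ^ DIM('v) * exp (- ((norm x)\<^sup>2 / (4 * u))))"
    by (simp add: f prod.distrib norm_power2_eq_sum_Basis sum_divide_distrib sum_negf[symmetric] exp_sum
        del: of_real_mult of_real_exp flip: of_real_prod)
  ultimately show ?thesis by (simp add: has_bochner_integral_iff F_def[abs_def])
qed

lemma has_bochner_integral_gaussian_cos: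
  fixes x :: "'v::euclidean_space" and u :: real
  assumes u: "u > 0"
  shows "has_bochner_integral lborel (\<lambda>t. cos (t \<bullet> x) * exp (- (u * (norm t)\<^sup>2)))
    (sqrt (pi / u) ^ DIM('v) * exp (- ((norm x)\<^sup>2 / (4 * u))))"
proof -
  have "has_bochner_integral lborel (\<lambda>t. Re (iexp (t \<bullet> x) * of_real (exp (- (u * (norm t)\<^sup>2)))))
    (Re (of_real (sqrt (pi / u) ^ DIM('v) * exp (- ((norm x)\<^sup>2 / (4 * u))))))"
    using has_bochner_integral_gaussian_iexp_inner[OF u] by (rule has_bochner_integral_Re)
  then show ?thesis by (simp add: Re_exp)
qed

lemma nn_integral_gaussian_one_minus_cos:
  fixes x :: "'v::euclidean_space" and u :: real
  assumes u: "u > 0"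
  shows "(\<integral>\<^sup>+t. ennreal ((1 - cos (t \<bullet> x)) * exp (- (u * (norm t)\<^sup>2))) \<partial>lborel)
    = ennreal (sqrt (pi / u) ^ DIM('v) * (1 - exp (- ((norm x)\<^sup>2 / (4 * u)))))"
proof (rule nn_integral_eq_integral[THEN trans])
  have "has_bochner_integral lborel (\<lambda>t. (1 - cos (t \<bullet> x)) * exp (- (u * (norm t)\<^sup>2)))
     (sqrt (pi / u) ^ DIM('v) - sqrt (pi / u) ^ DIM('v) * exp (- ((norm x)\<^sup>2 / (4 * u))))"
    using has_bochner_integral_diff[OF has_bochner_integral_gaussian_cos[OF u, of 0]
       has_bochner_integral_gaussian_cos[OF u, of x]]
    by (simp add: algebra_simps)
  then show "integrable lborel (\<lambda>t. (1 - cos (t \<bullet> x)) * exp (- (u * (norm t)\<^sup>2)))"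
    "ennreal (integral\<^sup>L lborel (\<lambda>t. (1 - cos (t \<bullet> x)) * exp (- (u * (norm t)\<^sup>2)))) =
    ennreal (sqrt (pi / u) ^ DIM('v) * (1 - exp (- ((norm x)\<^sup>2 / (4 * u)))))"
    unfolding has_bochner_integral_iff by (simp_all add: right_diff_distrib)
qed auto

text \<open>Writing \<open>1 - exp (- (r\<^sup>2 / (4 * u)))\<close> as the integral of
  \<open>s / 2 * exp (- (s\<^sup>2 / 4))\<close> over \<open>0 \<le> s \<le> r / sqrt u\<close>
  turns the left side into an integral over a planar region. Integrating in \<open>u\<close> first
  gives \<open>2 * r / s\<close>, which cancels the factor \<open>s / 2\<close>, and half a Gaussian
  integral is left.\<close>

lemma nn_integral_one_minus_exp_powr:
  fixes r :: real
  assumes r: "r > 0"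
  shows "(\<integral>\<^sup>+u. ennreal (indicator {0<..} u * (u powr (- 1 / 2) * (1 - exp (- (r\<^sup>2 / (4 * u)))))) \<partial>lborel)
    = ennreal (sqrt pi * r)"
proof -
  \<comment> \<open>The region \<open>s \<le> r / sqrt u\<close> is encoded as
    \<open>u \<le> r\<^sup>2 / s\<^sup>2\<close>, the form suited to the inner integral over
    \<open>u\<close>.\<close>
  define g where "g s u = ennreal (indicator {0<..} s * indicator {0<..r\<^sup>2 / s\<^sup>2} u * (u powr (- 1 / 2) * (s / 2 * exp (- (s\<^sup>2 / 4)))))"
    for s u :: real
  have [measurable]: "case_prod g \<in> borel_measurable (lborel \<Otimes>\<^sub>M lborel)"
    unfolding g_def indicator_def greaterThanAtMost_iff by measurable
  have inner_s: "ennreal (indicator {0<..} u * (u powr (- 1 / 2) * (1 - exp (- (r\<^sup>2 / (4 * u))))))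
    = (\<integral>\<^sup>+s. g s u \<partial>lborel)" for u
  proof (cases "u > 0")
    case u: True
    have "(\<integral>\<^sup>+s. ennreal (s / 2 * exp (- (s\<^sup>2 / 4))) * indicator {0..r / sqrt u} s \<partial>lborel)
        = ennreal (- exp (- ((r / sqrt u)\<^sup>2 / 4)) - (- exp (- (0\<^sup>2 / 4))))"
      using r u by (intro nn_integral_FTC_Icc) (auto intro!: derivative_eq_intros)
    also have "\<dots> = ennreal (1 - exp (- (r\<^sup>2 / (4 * u))))"
      using u by (simp add: power_divide mult.commute)
    finally have *: "ennreal (1 - exp (- (r\<^sup>2 / (4 * u)))) =
        (\<integral>\<^sup>+s. ennreal (s / 2 * exp (- (s\<^sup>2 / 4))) * indicator {0..r / sqrt u} s \<partial>lborel)" ..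
    have iff: "u \<le> r\<^sup>2 / s\<^sup>2 \<longleftrightarrow> s \<le> r / sqrt u" if "s > 0" for s
    proof -
      have "u \<le> r\<^sup>2 / s\<^sup>2 \<longleftrightarrow> (s * sqrt u)\<^sup>2 \<le> r\<^sup>2"
        using u that by (simp add: field_simps power_mult_distrib)
      also have "\<dots> \<longleftrightarrow> s * sqrt u \<le> r"
        using u r that by (subst power_mono_iff) auto
      finally show ?thesis using u by (simp add: field_simps)
    qed
    have "ennreal (indicator {0<..} u * (u powr (- 1 / 2) * (1 - exp (- (r\<^sup>2 / (4 * u))))))
      = ennreal (u powr (- 1 / 2)) * ennreal (1 - exp (- (r\<^sup>2 / (4 * u))))"
      using u r by (simp add: ennreal_mult)
    also have "\<dots> = (\<integral>\<^sup>+s. ennreal (u powr (- 1 / 2)) * (ennreal (s / 2 * exp (- (s\<^sup>2 / 4))) * indicator {0..r / sqrt u} s) \<partial>lborel)"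
      unfolding * by (subst nn_integral_cmult) auto
    also have "\<dots> = (\<integral>\<^sup>+s. g s u \<partial>lborel)"
    proof (intro nn_integral_cong)
      fix s :: real
      consider "s < 0" | "s = 0" | "s > 0" by linarith
      then show "ennreal (u powr (- 1 / 2)) * (ennreal (s / 2 * exp (- (s\<^sup>2 / 4))) * indicator {0..r / sqrt u} s) = g s u"
        using u iff[of s] by cases (auto simp: g_def indicator_def ennreal_mult[symmetric])
    qed
    finally show ?thesis .
  qed (auto simp: g_def)
  have inner_u: "(\<integral>\<^sup>+u. g s u \<partial>lborel) = ennreal r * ennreal (indicator {0<..} s * exp (- (s\<^sup>2 / 4)))" for s
  proof (cases "s > 0")
    case s: True
    define b where "b = r\<^sup>2 / s\<^sup>2"
    have b: "b > 0" "b powr (1 / 2) = r / s"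
      using r s by (auto simp: b_def powr_half_sqrt real_sqrt_divide)
    have "((\<lambda>x. x powr (- 1 / 2)) has_integral (b powr (- 1 / 2 + 1) / (- 1 / 2 + 1))) {0..b}"
      using b by (intro has_integral_powr_from_0) auto
    then have "((\<lambda>x. if x \<in> {0..b} then x powr (- 1 / 2) else 0) has_integral 2 * (r / s)) UNIV"
      by (subst has_integral_restrict_UNIV) (use b in \<open>simp add: mult.commute\<close>)
    also have "(\<lambda>x. if x \<in> {0..b} then x powr (- 1 / 2) else 0) = (\<lambda>x. indicator {0<..b} x * x powr (- 1 / 2))"
      by (auto simp: fun_eq_iff indicator_def)
    finally have *: "(\<integral>\<^sup>+u. ennreal (indicator {0<..b} u * u powr (- 1 / 2)) \<partial>lborel) = ennreal (2 * (r / s))"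
      by (intro nn_integral_has_integral_lborel) auto
    have "(\<integral>\<^sup>+u. g s u \<partial>lborel) =
        (\<integral>\<^sup>+u. ennreal (s / 2 * exp (- (s\<^sup>2 / 4))) * ennreal (indicator {0<..b} u * u powr (- 1 / 2)) \<partial>lborel)"
      using s by (intro nn_integral_cong) (auto simp: g_def b_def ennreal_mult[symmetric] ac_simps)
    also have "\<dots> = ennreal (s / 2 * exp (- (s\<^sup>2 / 4))) * ennreal (2 * (r / s))"
      unfolding *[symmetric] by (rule nn_integral_cmult) auto
    also have "\<dots> = ennreal (s / 2 * exp (- (s\<^sup>2 / 4)) * (2 * (r / s)))"
      using r s by (intro ennreal_mult[symmetric]) auto
    also have "s / 2 * exp (- (s\<^sup>2 / 4)) * (2 * (r / s)) = r * (indicator {0<..} s * exp (- (s\<^sup>2 / 4)))"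
      using s by simp
    finally show ?thesis using r by (simp add: ennreal_mult)
  qed (auto simp: g_def)
  have gauss: "(\<integral>\<^sup>+s. ennreal (indicator {0<..} s * exp (- (s\<^sup>2 / 4))) \<partial>lborel) = ennreal (sqrt pi)"
  proof -
    have "has_bochner_integral lborel (\<lambda>x::real. indicator {0..} (0 + (1/2) * x) *\<^sub>R exp (- (0 + (1/2) * x)\<^sup>2)) ((sqrt pi / 2) /\<^sub>R \<bar>1/2\<bar>)"
      using gaussian_moment_0 by (subst (asm) lborel_has_bochner_integral_real_affine_iff[where c = "1/2" and t = 0]) auto
    then have "has_bochner_integral lborel (\<lambda>s::real. indicator {0..} s * exp (- (s\<^sup>2 / 4))) (sqrt pi)"
      by (rule has_bochner_integral_cong[THEN iffD1, rotated -1]) (auto simp: indicator_def power_mult_distrib power2_eq_square)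
    then have "(\<integral>\<^sup>+s. ennreal (indicator {0..} s * exp (- (s\<^sup>2 / 4))) \<partial>lborel) = ennreal (sqrt pi)"
      by (subst nn_integral_eq_integral) (auto simp: has_bochner_integral_iff)
    also have "(\<integral>\<^sup>+s. ennreal (indicator {0..} s * exp (- (s\<^sup>2 / 4))) \<partial>lborel) = (\<integral>\<^sup>+s. ennreal (indicator {0<..} s * exp (- (s\<^sup>2 / 4))) \<partial>lborel)"
      using AE_lborel_singleton[of "0::real"] by (intro nn_integral_cong_AE) (auto elim!: eventually_mono simp: indicator_def)
    finally show ?thesis .
  qed
  have "(\<integral>\<^sup>+u. ennreal (indicator {0<..} u * (u powr (- 1 / 2) * (1 - exp (- (r\<^sup>2 / (4 * u)))))) \<partial>lborel)
    = (\<integral>\<^sup>+u. \<integral>\<^sup>+s. g s u \<partial>lborel \<partial>lborel)"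
    by (intro nn_integral_cong inner_s)
  also have "\<dots> = (\<integral>\<^sup>+s. \<integral>\<^sup>+u. g s u \<partial>lborel \<partial>lborel)"
    by (rule lborel_pair.Fubini') measurable
  also have "\<dots> = ennreal r * ennreal (sqrt pi)"
    unfolding inner_u gauss[symmetric] by (rule nn_integral_cmult) auto
  finally show ?thesis using r by (simp add: ennreal_mult[symmetric] mult.commute)
qed

text \<open>The factor \<open>1 / norm t ^ (p + 1)\<close> is written as a Gamma integral of Gaussians, whose Fourier
  transforms are explicit.\<close>
lemma nn_integral_one_minus_cos:
  fixes x :: "'v::euclidean_space"
  shows "(\<integral>\<^sup>+t. ennreal ((1 - cos (t \<bullet> x)) / norm t ^ (DIM('v) + 1)) \<partial>lborel)
    = ennreal (dist_const DIM('v) * norm x)"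
proof (cases "x = 0")
  case False
  define p where "p = DIM('v)"
  define z where "z = (1 + real p) / 2"
  have z: "z > 0" by (simp add: z_def)
  have Gz: "Gamma z > 0" using z by (rule Gamma_real_pos)
  define g where "g t u = ennreal ((1 - cos (t \<bullet> x)) * (indicator {0<..} u * u powr (z - 1) * exp (- ((norm t)\<^sup>2 * u))))"
    for t :: 'v and u :: real
  have [measurable]: "case_prod g \<in> borel_measurable (lborel \<Otimes>\<^sub>M lborel)"
    unfolding g_def by measurable
  have inner_u: "(\<integral>\<^sup>+u. g t u \<partial>lborel) = ennreal (Gamma z) * ennreal ((1 - cos (t \<bullet> x)) / norm t ^ (p + 1))" for t
  proof (cases "t = 0")
    case False
    have "(\<integral>\<^sup>+u. g t u \<partial>lborel) = ennreal (1 - cos (t \<bullet> x)) * ennreal (Gamma z / (norm t)\<^sup>2 powr z)"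
      unfolding g_def using False z
      by (subst nn_integral_powr_exp_scaled[symmetric])
         (auto simp: ennreal_mult nn_integral_cmult[symmetric] intro!: nn_integral_cong)
    also have "(norm t)\<^sup>2 powr z = norm t ^ (p + 1)"
      using False by (simp add: z_def powr_powr powr_realpow[symmetric] add_divide_distrib del: powr_numeral power_Suc flip: powr_numeral)
    finally show ?thesis
      using Gz by (simp add: ennreal_mult[symmetric] mult.commute)
  qed (simp add: g_def)
  \<comment> \<open>Here the dimension leaves the exponent: \<open>u powr (z - 1)\<close> times the
    \<open>u powr (- p / 2)\<close> of the Gaussian integral is \<open>u powr (- 1 / 2)\<close>, so
    one and the same integral over \<open>u\<close> serves every dimension.\<close>
  have inner_t: "(\<integral>\<^sup>+t. g t u \<partial>lborel) = ennreal (pi powr (real p / 2)) *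
      ennreal (indicator {0<..} u * (u powr (- 1 / 2) * (1 - exp (- ((norm x)\<^sup>2 / (4 * u))))))" for u
  proof (cases "u > 0")
    case u: True
    have "(\<integral>\<^sup>+t. g t u \<partial>lborel) = (\<integral>\<^sup>+t. ennreal (u powr (z - 1)) * ennreal ((1 - cos (t \<bullet> x)) * exp (- (u * (norm t)\<^sup>2))) \<partial>lborel)"
      using u by (intro nn_integral_cong) (auto simp: g_def ennreal_mult[symmetric] ac_simps)
    also have "\<dots> = ennreal (u powr (z - 1)) * ennreal (sqrt (pi / u) ^ p * (1 - exp (- ((norm x)\<^sup>2 / (4 * u)))))"
      unfolding p_def nn_integral_gaussian_one_minus_cos[OF u, symmetric] by (rule nn_integral_cmult) auto
    also have "sqrt (pi / u) ^ p = pi powr (real p / 2) * u powr (- (real p / 2))"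
      using u by (simp add: powr_half_sqrt[symmetric] powr_realpow[symmetric] powr_powr powr_divide powr_minus field_simps)
    also have "ennreal (u powr (z - 1)) * ennreal (pi powr (real p / 2) * u powr (- (real p / 2)) * (1 - exp (- ((norm x)\<^sup>2 / (4 * u)))))
       = ennreal (pi powr (real p / 2) * ((u powr (z - 1) * u powr (- (real p / 2))) * (1 - exp (- ((norm x)\<^sup>2 / (4 * u))))))"
      using u by (simp add: ennreal_mult[symmetric] ac_simps)
    also have "u powr (z - 1) * u powr (- (real p / 2)) = u powr (- 1 / 2)"
      by (simp add: powr_add[symmetric] z_def field_simps)
    finally show ?thesis
      using u by (simp add: ennreal_mult)
  qed (simp add: g_def)
  have "ennreal (Gamma z) * (\<integral>\<^sup>+t. ennreal ((1 - cos (t \<bullet> x)) / norm t ^ (p + 1)) \<partial>lborel)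
      = (\<integral>\<^sup>+t. \<integral>\<^sup>+u. g t u \<partial>lborel \<partial>lborel)"
    unfolding inner_u by (rule nn_integral_cmult[symmetric]) auto
  also have "\<dots> = (\<integral>\<^sup>+u. \<integral>\<^sup>+t. g t u \<partial>lborel \<partial>lborel)"
    by (rule lborel_pair.Fubini'[symmetric]) measurable
  also have "\<dots> = ennreal (pi powr (real p / 2)) * ennreal (sqrt pi * norm x)"
    unfolding inner_t nn_integral_one_minus_exp_powr[symmetric, of "norm x", unfolded zero_less_norm_iff, OF False]
    by (rule nn_integral_cmult) auto
  also have "\<dots> = ennreal (pi powr z * norm x)"
    by (simp add: ennreal_mult[symmetric] z_def add_divide_distrib powr_add powr_half_sqrt)
  finally have "ennreal (1 / Gamma z) * (ennreal (Gamma z) * (\<integral>\<^sup>+t. ennreal ((1 - cos (t \<bullet> x)) / norm t ^ (p + 1)) \<partial>lborel))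
      = ennreal (1 / Gamma z) * ennreal (pi powr z * norm x)"
    by simp
  moreover have "ennreal (1 / Gamma z) * ennreal (Gamma z) = 1"
    using Gz by (simp flip: ennreal_mult)
  ultimately show ?thesis
    using Gz by (simp flip: mult.assoc ennreal_mult add: p_def z_def dist_const_def)
qed simp

subsection \<open>The degenerate kernel of a square-integrable law\<close>

lemma integrable_mult_of_sq:
  fixes f g :: "'a \<Rightarrow> real"
  assumes [measurable]: "f \<in> borel_measurable M" "g \<in> borel_measurable M"
    and "integrable M (\<lambda>x. (f x)\<^sup>2)" "integrable M (\<lambda>x. (g x)\<^sup>2)"
  shows "integrable M (\<lambda>x. f x * g x)"
proof (rule Bochner_Integration.integrable_bound)
  show "integrable M (\<lambda>x. (f x)\<^sup>2 + (g x)\<^sup>2)" using assms by auto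
  have "\<bar>u * v\<bar> \<le> u\<^sup>2 + v\<^sup>2" for u v :: real
    using sum_squares_bound[of "\<bar>u\<bar>" "\<bar>v\<bar>"] mult_nonneg_nonneg[OF abs_ge_zero[of u] abs_ge_zero[of v]]
    unfolding abs_mult power2_abs by linarith
  then show "AE x in M. norm (f x * g x) \<le> norm ((f x)\<^sup>2 + (g x)\<^sup>2)" by auto
qed auto

lemma (in pair_sigma_finite) integrable_pair_mult:
  fixes f :: "'a \<Rightarrow> real" and g :: "'b \<Rightarrow> real"
  assumes f: "integrable M1 f" and g: "integrable M2 g"
  shows "integrable (M1 \<Otimes>\<^sub>M M2) (\<lambda>z. f (fst z) * g (snd z))"
proof -
  have [measurable]: "f \<in> borel_measurable M1" "g \<in> borel_measurable M2"
    using f g by auto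
  show ?thesis
  proof (rule Fubini_integrable)
    have "integrable M1 (\<lambda>x. norm (f x) * (LINT y|M2. norm (g y)))"
      using f by (intro integrable_mult_left integrable_norm)
    then show "integrable M1 (\<lambda>x. LINT y|M2. norm (f (fst (x, y)) * g (snd (x, y))))"
      by (simp add: abs_mult)
  qed (use g in auto)
qed

text \<open>Nonnegativity makes a finite iterated integral enough for Fubini. It serves to average
  the integral of \<open>1 - cos (t \<bullet> x)\<close> over \<open>x\<close>, once against a
  Gaussian and later against the law itself.\<close>

lemma (in pair_sigma_finite) has_bochner_integral_Tonelli:
  fixes f :: "'a \<Rightarrow> 'b \<Rightarrow> real"
  assumes meas: "case_prod f \<in> borel_measurable (M1 \<Otimes>\<^sub>M M2)"
    and nonneg: "\<And>x y. f x y \<ge> 0"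
    and f: "\<And>x. has_bochner_integral M2 (f x) (F x)" and F: "integrable M1 F"
  shows "has_bochner_integral M2 (\<lambda>y. LINT x|M1. f x y) (integral\<^sup>L M1 F)"
proof -
  have f': "integrable M2 (f x)" "integral\<^sup>L M2 (f x) = F x" for x
    using f[of x] by (auto simp: has_bochner_integral_iff)
  have int: "integrable (M1 \<Otimes>\<^sub>M M2) (case_prod f)"
  proof (rule Fubini_integrable)
    show "integrable M1 (\<lambda>x. LINT y|M2. norm (case_prod f (x, y)))"
      using F nonneg f' by simp
  qed (use meas f' in auto)
  show ?thesis
    using integrable_snd[OF int] integral_snd[OF int] integral_fst[OF int] f'
    by (simp add: has_bochner_integral_iff)
qed

locale square_integrable_law = prob_space \<mu> for \<mu> :: "'v::euclidean_space measure" +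
  assumes sets_law [simp, measurable_cong]: "sets \<mu> = sets borel"
    and integrable_norm_sq: "integrable \<mu> (\<lambda>x. (norm x)\<^sup>2)"
begin

sublocale pair: pair_prob_space \<mu> \<mu>
  by unfold_locales

lemma space_law [simp]: "space \<mu> = UNIV"
  using sets_eq_imp_space_eq[OF sets_law] by simp

lemma prob_UNIV [simp]: "prob UNIV = 1"
  using prob_space by simp

lemma integrable_norm: "integrable \<mu> norm"
proof (rule Bochner_Integration.integrable_bound)
  show "integrable \<mu> (\<lambda>x. 1 + (norm x)\<^sup>2)" using integrable_norm_sq by auto
  have "norm x \<le> 1 + (norm x)\<^sup>2" for x :: 'v
    using zero_le_power2[of "norm x - 1 / 2"] by (simp add: power2_eq_square algebra_simps)
  then show "AE x in \<mu>. norm (norm x) \<le> norm (1 + (norm x)\<^sup>2)" by auto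
qed auto

lemma integrable_dist: "integrable \<mu> (\<lambda>y. norm (x - y))"
proof (rule Bochner_Integration.integrable_bound)
  show "integrable \<mu> (\<lambda>y. norm x + norm y)" using integrable_norm by auto
qed (auto intro!: AE_I2 norm_triangle_ineq4)

definition mean_dist :: "'v \<Rightarrow> real" where "mean_dist x = (LINT y|\<mu>. norm (x - y))"

definition gini :: real where "gini = (LINT x|\<mu>. mean_dist x)"

text \<open>The doubly centred distance, that is, the degenerate second-order term in the Hoeffding
  decomposition of \<open>norm (x - y)\<close>; \<open>mean_dist\<close> and \<open>gini\<close> are
  the \<open>a\<close> and \<open>\<Delta>\<close> of the overview.\<close>

definition kern :: "'v \<Rightarrow> 'v \<Rightarrow> real" where
  "kern x y = norm (x - y) - mean_dist x - mean_dist y + gini"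

definition kern_var :: real where
  "kern_var = (LINT z|(\<mu> \<Otimes>\<^sub>M \<mu>). (kern (fst z) (snd z))\<^sup>2)"

lemma measurable_mean_dist [measurable]: "mean_dist \<in> borel_measurable borel"
proof -
  have "(\<lambda>x. LINT y|\<mu>. norm (x - y)) \<in> borel_measurable borel"
    by measurable
  then show ?thesis by (simp add: mean_dist_def[abs_def])
qed

lemma measurable_kern [measurable]: "(\<lambda>z. kern (fst z) (snd z)) \<in> borel_measurable (borel \<Otimes>\<^sub>M borel)"
  unfolding kern_def by measurable

lemma mean_dist_nonneg: "mean_dist x \<ge> 0"
  unfolding mean_dist_def by (rule Bochner_Integration.integral_nonneg) auto

lemma mean_dist_le: "mean_dist x \<le> norm x + expectation norm"
proof -
  have "mean_dist x \<le> (LINT y|\<mu>. norm x + norm y)"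
    unfolding mean_dist_def using integrable_norm integrable_dist
    by (intro integral_mono) (auto intro: norm_triangle_ineq4)
  also have "\<dots> = norm x + expectation norm"
    using integrable_norm by (simp add: prob_space)
  finally show ?thesis .
qed

lemma integrable_mean_dist_sq: "integrable \<mu> (\<lambda>x. (mean_dist x)\<^sup>2)"
proof (rule Bochner_Integration.integrable_bound)
  let ?m = "expectation norm"
  show "integrable \<mu> (\<lambda>x. 2 * (norm x)\<^sup>2 + 2 * ?m\<^sup>2)" using integrable_norm_sq by auto
  have "(mean_dist x)\<^sup>2 \<le> 2 * (norm x)\<^sup>2 + 2 * ?m\<^sup>2" for x
  proof -
    have "(mean_dist x)\<^sup>2 \<le> (norm x + ?m)\<^sup>2"
      by (intro power_mono mean_dist_le mean_dist_nonneg)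
    also have "\<dots> \<le> 2 * (norm x)\<^sup>2 + 2 * ?m\<^sup>2"
      using zero_le_power2[of "norm x - ?m"] by (simp add: power2_eq_square algebra_simps)
    finally show ?thesis .
  qed
  then show "AE x in \<mu>. norm ((mean_dist x)\<^sup>2) \<le> norm (2 * (norm x)\<^sup>2 + 2 * ?m\<^sup>2)" by auto
qed auto

lemma integrable_mean_dist: "integrable \<mu> mean_dist"
proof (rule Bochner_Integration.integrable_bound)
  show "integrable \<mu> (\<lambda>x. norm x + expectation norm)" using integrable_norm by auto
  have "norm (mean_dist x) \<le> norm (norm x + expectation norm)" for x
    using mean_dist_le[of x] mean_dist_nonneg[of x] by auto
  then show "AE x in \<mu>. norm (mean_dist x) \<le> norm (norm x + expectation norm)" by auto
qed auto

lemma gini_nonneg: "gini \<ge> 0"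
  unfolding gini_def by (rule Bochner_Integration.integral_nonneg) (auto simp: mean_dist_nonneg)

lemma kern_commute: "kern x y = kern y x"
  by (simp add: kern_def norm_minus_commute)

text \<open>Degeneracy: this is what makes the sums over the kernel uncorrelated.\<close>
lemma integral_kern [simp]: "(LINT y|\<mu>. kern x y) = 0" "(LINT y|\<mu>. kern y x) = 0"
proof -
  show *: "(LINT y|\<mu>. kern x y) = 0" for x
    unfolding kern_def using integrable_dist integrable_mean_dist
    by (simp add: prob_space mean_dist_def[symmetric] gini_def[symmetric])
  show "(LINT y|\<mu>. kern y x) = 0"
    using *[of x] by (simp add: kern_commute)
qed

lemma integrable_pair_dist_sq: "integrable (\<mu> \<Otimes>\<^sub>M \<mu>) (\<lambda>z. (norm (fst z - snd z))\<^sup>2)"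
proof (rule Bochner_Integration.integrable_bound)
  show "integrable (\<mu> \<Otimes>\<^sub>M \<mu>) (\<lambda>z. 2 * ((norm (fst z))\<^sup>2 * 1) + 2 * (1 * (norm (snd z))\<^sup>2))"
    using integrable_norm_sq
    by (intro Bochner_Integration.integrable_add integrable_mult_right pair.integrable_pair_mult) auto
  have "(norm (x - y))\<^sup>2 \<le> 2 * (norm x)\<^sup>2 + 2 * (norm y)\<^sup>2" for x y :: 'v
  proof -
    have "(norm (x - y))\<^sup>2 \<le> (norm x + norm y)\<^sup>2"
      by (intro power_mono norm_triangle_ineq4) auto
    also have "\<dots> \<le> 2 * (norm x)\<^sup>2 + 2 * (norm y)\<^sup>2"
      using zero_le_power2[of "norm x - norm y"] by (simp add: power2_eq_square algebra_simps)
    finally show ?thesis .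
  qed
  then show "AE z in \<mu> \<Otimes>\<^sub>M \<mu>. norm ((norm (fst z - snd z))\<^sup>2)
      \<le> norm (2 * ((norm (fst z))\<^sup>2 * 1) + 2 * (1 * (norm (snd z))\<^sup>2))" by auto
qed auto

lemma integrable_pair_mean_dist_sq:
  "integrable (\<mu> \<Otimes>\<^sub>M \<mu>) (\<lambda>z. (mean_dist (fst z))\<^sup>2)" "integrable (\<mu> \<Otimes>\<^sub>M \<mu>) (\<lambda>z. (mean_dist (snd z))\<^sup>2)"
  using pair.integrable_pair_mult[OF integrable_mean_dist_sq integrable_const[of 1]]
    pair.integrable_pair_mult[OF integrable_const[of 1] integrable_mean_dist_sq] by simp_all

lemma integrable_kern_sq: "integrable (\<mu> \<Otimes>\<^sub>M \<mu>) (\<lambda>z. (kern (fst z) (snd z))\<^sup>2)"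
proof (rule Bochner_Integration.integrable_bound)
  show "integrable (\<mu> \<Otimes>\<^sub>M \<mu>) (\<lambda>z. 4 * ((norm (fst z - snd z))\<^sup>2 + (mean_dist (fst z))\<^sup>2 + (mean_dist (snd z))\<^sup>2 + gini\<^sup>2))"
    using integrable_pair_dist_sq integrable_pair_mean_dist_sq by auto
  have "(a - b - c + d)\<^sup>2 \<le> 4 * (a\<^sup>2 + b\<^sup>2 + c\<^sup>2 + d\<^sup>2)" for a b c d :: real
  proof -
    \<comment> \<open>The six squares add up to exactly the right side minus the left side of the
      claimed bound.\<close>
    have "0 \<le> (a + b)\<^sup>2 + (a + c)\<^sup>2 + (a - d)\<^sup>2 + (b - c)\<^sup>2 + (b + d)\<^sup>2 + (c + d)\<^sup>2"
      by simp
    then show ?thesis by (simp add: power2_eq_square algebra_simps)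
  qed
  then show "AE z in \<mu> \<Otimes>\<^sub>M \<mu>. norm ((kern (fst z) (snd z))\<^sup>2) \<le>
      norm (4 * ((norm (fst z - snd z))\<^sup>2 + (mean_dist (fst z))\<^sup>2 + (mean_dist (snd z))\<^sup>2 + gini\<^sup>2))"
    by (auto simp: kern_def)
qed auto

lemma kern_var_nonneg: "kern_var \<ge> 0"
  unfolding kern_var_def by (rule Bochner_Integration.integral_nonneg) auto

text \<open>The kernel is orthogonal to constants and to functions of one variable alone. Expanding
  one factor of its square therefore leaves only the kernel times the distance; expanding the other
  factor and integrating out one variable turns the mixed terms into moments of
  \<open>mean_dist\<close>.\<close>

lemma kern_var_eq:
  "kern_var = (LINT z|(\<mu> \<Otimes>\<^sub>M \<mu>). (norm (fst z - snd z))\<^sup>2) - 2 * (LINT x|\<mu>. (mean_dist x)\<^sup>2) + gini\<^sup>2"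
proof -
  let ?M = "\<mu> \<Otimes>\<^sub>M \<mu>" and ?k = "\<lambda>z. kern (fst z) (snd z)" and ?d = "\<lambda>z. norm (fst z - snd z)"
  let ?a1 = "\<lambda>z. mean_dist (fst z)" and ?a2 = "\<lambda>z. mean_dist (snd z)"
  note sq = integrable_pair_dist_sq integrable_pair_mean_dist_sq integrable_kern_sq
  have kd: "integrable ?M (\<lambda>z. ?k z * ?d z)" and ka1: "integrable ?M (\<lambda>z. ?k z * ?a1 z)"
    and ka2: "integrable ?M (\<lambda>z. ?k z * ?a2 z)" and dd: "integrable ?M (\<lambda>z. ?d z * ?d z)"
    and da1: "integrable ?M (\<lambda>z. ?d z * ?a1 z)" and da2: "integrable ?M (\<lambda>z. ?d z * ?a2 z)"
    by (rule integrable_mult_of_sq; (rule sq | measurable))+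
  have k: "integrable ?M ?k" and d: "integrable ?M ?d"
    using integrable_mult_of_sq[of ?k ?M "\<lambda>_. 1"] integrable_mult_of_sq[of ?d ?M "\<lambda>_. 1"] sq by auto
  have "(LINT z|?M. ?k z * ?a1 z) = 0" "(LINT z|?M. ?k z * ?a2 z) = 0" "(LINT z|?M. ?k z) = 0"
    using pair.integral_fst'[OF ka1] pair.integral_snd[of "\<lambda>x y. kern x y * mean_dist y"] ka2
      pair.integral_fst'[OF k]
    by (simp_all add: split_def)
  moreover have "(LINT z|?M. ?d z * ?a1 z) = (LINT x|\<mu>. (mean_dist x)\<^sup>2)"
    using pair.integral_fst'[OF da1] by (simp add: mean_dist_def[symmetric] power2_eq_square)
  moreover have "(LINT z|?M. ?d z * ?a2 z) = (LINT x|\<mu>. (mean_dist x)\<^sup>2)"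
    using pair.integral_snd[of "\<lambda>x y. norm (x - y) * mean_dist y"] da2
    by (simp add: split_def norm_minus_commute mean_dist_def[symmetric] power2_eq_square)
  moreover have "(LINT z|?M. ?d z) = gini"
    using pair.integral_fst'[OF d] by (simp add: mean_dist_def[symmetric] gini_def)
  moreover have "(LINT z|?M. (?k z)\<^sup>2) = (LINT z|?M. ?k z * ?d z - ?k z * ?a1 z - ?k z * ?a2 z + gini * ?k z)"
    by (intro Bochner_Integration.integral_cong) (auto simp: kern_def power2_eq_square algebra_simps)
  moreover have "(LINT z|?M. ?k z * ?d z) = (LINT z|?M. ?d z * ?d z - ?d z * ?a1 z - ?d z * ?a2 z + gini * ?d z)"
    by (intro Bochner_Integration.integral_cong) (auto simp: kern_def algebra_simps)
  ultimately show ?thesis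
    using kd ka1 ka2 dd da1 da2 k d by (simp add: kern_var_def power2_eq_square)
qed

text \<open>If the mean vanished, \<open>mean_dist x\<close> would be 0 for some \<open>x\<close>,
  and all mass would sit at that \<open>x\<close>.\<close>

lemma gini_pos:
  assumes nondeg: "\<not> (\<exists>c. AE x in \<mu>. x = c)"
  shows "gini > 0"
proof (rule ccontr)
  assume "\<not> gini > 0"
  then have g: "gini = 0" using gini_nonneg by simp
  have a: "AE x in \<mu>. mean_dist x = 0"
    using integrable_mean_dist mean_dist_nonneg g[unfolded gini_def]
    by (subst integral_nonneg_eq_0_iff_AE[symmetric]) auto
  then obtain x where "mean_dist x = 0"
    using eventually_happens'[OF ae_filter_bot a] by blast
  then have "AE y in \<mu>. norm (x - y) = 0"
    unfolding mean_dist_def using integrable_dist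
    by (subst integral_nonneg_eq_0_iff_AE[symmetric]) auto
  then have "AE y in \<mu>. y = x" by (auto elim: eventually_mono)
  then show False using nondeg by blast
qed

text \<open>If the kernel vanishes almost everywhere, letting \<open>y\<close> tend to \<open>x\<close> inside the support
  gives \<open>mean_dist x \<le> gini / 2\<close> almost surely, hence \<open>gini = 0\<close>.\<close>
lemma kern_var_pos:
  assumes nondeg: "\<not> (\<exists>c. AE x in \<mu>. x = c)"
  shows "kern_var > 0"
proof (rule ccontr)
  assume "\<not> kern_var > 0"
  then have "kern_var = 0" using kern_var_nonneg by simp
  then have "AE z in \<mu> \<Otimes>\<^sub>M \<mu>. (kern (fst z) (snd z))\<^sup>2 = 0"
    unfolding kern_var_def using integrable_kern_sq
    by (subst integral_nonneg_eq_0_iff_AE[symmetric]) auto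
  then have "AE z in \<mu> \<Otimes>\<^sub>M \<mu>. kern (fst z) (snd z) = 0" by simp
  then have kern0: "AE x in \<mu>. AE y in \<mu>. kern x y = 0"
    using pair.AE_pair[of "\<lambda>z. kern (fst z) (snd z) = 0"] by simp
  obtain \<B> :: "'v set set" where \<B>: "countable \<B>" "topological_basis \<B>"
    using ex_countable_basis by blast
  \<comment> \<open>Almost every point lies in the support, having no null basic neighbourhood.
    Countability of the base lets the quantifier over \<open>B\<close> be moved out of the
    almost-everywhere statement.\<close>
  have "AE x in \<mu>. \<forall>B\<in>\<B>. x \<in> B \<longrightarrow> emeasure \<mu> B \<noteq> 0"
  proof (subst AE_ball_countable[OF \<B>(1)], intro ballI)
    fix B assume B: "B \<in> \<B>"
    have [measurable]: "B \<in> sets borel" using topological_basis_open[OF \<B>(2) B] by auto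
    show "AE x in \<mu>. x \<in> B \<longrightarrow> emeasure \<mu> B \<noteq> 0"
    proof (cases "emeasure \<mu> B = 0")
      case True
      then have "AE x in \<mu>. x \<notin> B" by (intro AE_not_in) (auto simp: null_sets_def)
      then show ?thesis by (rule AE_mp) auto
    qed auto
  qed
  with kern0 have "AE x in \<mu>. mean_dist x \<le> gini / 2"
  proof eventually_elim
    case (elim x)
    show ?case
    proof (rule field_le_epsilon)
      fix e :: real assume e: "e > 0"
      obtain B where B: "B \<in> \<B>" "x \<in> B" "B \<subseteq> ball x e"
        using topological_basisE[OF \<B>(2) open_ball centre_in_ball[THEN iffD2, OF e]] by metis
      have [measurable]: "B \<in> sets borel" using topological_basis_open[OF \<B>(2) B(1)] by auto
      \<comment> \<open>A neighbourhood of positive measure cannot avoid the set of full measure on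
        which \<open>kern x y = 0\<close>.\<close>
      have "\<exists>y\<in>B. kern x y = 0"
      proof (rule ccontr)
        assume "\<not> (\<exists>y\<in>B. kern x y = 0)"
        then have "AE y in \<mu>. y \<notin> B" using elim(1) by (auto elim: eventually_mono)
        then have "emeasure \<mu> B = 0"
          by (subst (asm) AE_iff_null_sets[symmetric]) auto
        then show False using elim(2) B by auto
      qed
      then obtain y where y: "y \<in> B" "kern x y = 0" by blast
      then have yx: "norm (x - y) < e" using B by (auto simp: dist_norm)
      have "mean_dist x \<le> (LINT w|\<mu>. norm (x - y) + norm (y - w))"
        unfolding mean_dist_def using integrable_dist
        by (intro integral_mono) (auto intro: norm_triangle_ineq[of "x - y" "y - _", simplified])
      also have "\<dots> = norm (x - y) + mean_dist y"
        using integrable_dist by (simp add: mean_dist_def)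
      \<comment> \<open>Substituting \<open>mean_dist y = norm (x - y) - mean_dist x + gini\<close>
        into the triangle inequality gives
        \<open>2 * mean_dist x \<le> 2 * norm (x - y) + gini\<close>.\<close>
      finally show "mean_dist x \<le> gini / 2 + e"
        using y yx by (simp add: kern_def)
    qed
  qed
  then have "(LINT x|\<mu>. mean_dist x) \<le> (LINT x|\<mu>. gini / 2)"
    using integrable_mean_dist by (intro integral_mono_AE) auto
  \<comment> \<open>Integration has given \<open>gini \<le> gini / 2\<close>.\<close>
  then have "gini = 0" using gini_nonneg by (simp add: gini_def[symmetric])
  then show False using gini_pos[OF nondeg] by simp
qed

end

subsection \<open>The distance variance in terms of the kernel\<close>

lemma cmod_iexp_minus_1_le: "cmod (iexp x - 1) \<le> \<bar>x\<bar>"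
  using iexp_approx1[of x 0] by simp

text \<open>The bound \<open>1 + x \<le> exp x\<close> reduces the claim to
  \<open>min 1 r \<le> 5 * r / (4 + r)\<close>; the constant 5 makes the quotient equal to 1 at
  \<open>r = 1\<close>.\<close>

lemma min_le_one_minus_exp: "r \<ge> 0 \<Longrightarrow> min 1 r \<le> 5 * (1 - exp (- (r / 4)))" for r :: real
proof -
  assume r: "r \<ge> 0"
  have "exp (- (r / 4)) \<le> 1 / (1 + r / 4)"
    using exp_ge_add_one_self[of "r / 4"] r by (simp add: exp_minus field_simps)
  then have "5 * (1 - exp (- (r / 4))) \<ge> 5 * (1 - 1 / (1 + r / 4))" by simp
  also have "5 * (1 - 1 / (1 + r / 4)) = 5 * r / (4 + r)"
    using r by (simp add: field_simps)
  finally have "5 * r / (4 + r) \<le> 5 * (1 - exp (- (r / 4)))" .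
  moreover have "min 1 r \<le> 5 * r / (4 + r)"
  proof (cases "r \<le> 1")
    case True
    then have "r * (4 + r) \<le> r * 5" using r by (intro mult_left_mono) auto
    then show ?thesis using True r by (simp add: field_simps)
  qed (use r in \<open>simp add: field_simps\<close>)
  ultimately show ?thesis by linarith
qed

lemma has_bochner_integral_nn:
  fixes f :: "'a \<Rightarrow> real"
  assumes "f \<in> borel_measurable M" "\<And>x. f x \<ge> 0" "c \<ge> 0" "(\<integral>\<^sup>+x. ennreal (f x) \<partial>M) = ennreal c"
  shows "has_bochner_integral M f c"
  using assms by (intro has_bochner_integral_nn_integral) auto

lemma measurable_cnj [measurable]: "cnj \<in> borel_measurable borel"
  by (intro borel_measurable_continuous_onI continuous_intros)

lemma dist_const_pos: "dist_const n > 0"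
  by (auto simp: dist_const_def intro!: divide_pos_pos Gamma_real_pos)

text \<open>The weight is not integrable near the origin, so integrands have to vanish there fast
  enough; a bound by a multiple of \<open>min 1 ((norm t)\<^sup>2)\<close> ensures this. At the
  origin itself the value is \<open>1 / 0 = 0\<close>.\<close>

definition riesz_weight :: "'v::euclidean_space \<Rightarrow> real" where
  "riesz_weight t = 1 / norm t ^ (DIM('v) + 1)"

lemma riesz_weight_nonneg: "riesz_weight t \<ge> 0"
  by (simp add: riesz_weight_def)

lemma riesz_weight_uminus [simp]: "riesz_weight (- t) = riesz_weight t"
  by (simp add: riesz_weight_def)

lemma measurable_riesz_weight [measurable]: "riesz_weight \<in> borel_measurable borel"
  unfolding riesz_weight_def by measurable

lemma has_bochner_integral_one_minus_cos:
  fixes x :: "'v::euclidean_space"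
  shows "has_bochner_integral lborel (\<lambda>t. (1 - cos (t \<bullet> x)) * riesz_weight t)
    (dist_const DIM('v) * norm x)"
  using nn_integral_one_minus_cos[of x] dist_const_pos[of "DIM('v)"]
  by (intro has_bochner_integral_nn)
    (auto simp: riesz_weight_def intro!: mult_nonneg_nonneg divide_nonneg_nonneg)

lemma integrable_gaussian_norm:
  "integrable lborel (\<lambda>x::'v::euclidean_space. norm x * exp (- (norm x)\<^sup>2))"
proof (rule Bochner_Integration.integrable_bound)
  show "integrable lborel (\<lambda>x::'v. exp (- (1 / 2 * (norm x)\<^sup>2)))"
    using has_bochner_integral_gaussian_cos[of "1 / 2" "0::'v"] by (simp add: has_bochner_integral_iff)
  have "r * exp (- r\<^sup>2) \<le> exp (- (1 / 2 * r\<^sup>2))" for r :: real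
  proof -
    have "r \<le> 1 + r\<^sup>2 / 2"
      using zero_le_power2[of "r - 1"] by (simp add: power2_eq_square algebra_simps)
    also have "\<dots> \<le> exp (r\<^sup>2 / 2)" by (rule exp_ge_add_one_self)
    finally have "r * exp (- r\<^sup>2) \<le> exp (r\<^sup>2 / 2) * exp (- r\<^sup>2)" by simp
    then show ?thesis by (simp add: exp_add[symmetric])
  qed
  then show "AE x::'v in lborel. norm (norm x * exp (- (norm x)\<^sup>2)) \<le> norm (exp (- (1 / 2 * (norm x)\<^sup>2)))"
    by (simp add: abs_mult)
qed auto

text \<open>The integral of \<open>1 - exp (- (norm t)\<^sup>2 / 4)\<close> against the weight is finite, because this function is
  a Gaussian average of \<open>1 - cos (t \<bullet> x)\<close>.\<close>
lemma integrable_min_riesz_weight: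
  "integrable lborel (\<lambda>t::'v::euclidean_space. min 1 ((norm t)\<^sup>2) * riesz_weight t)"
proof (rule Bochner_Integration.integrable_bound)
  define f :: "'v \<Rightarrow> 'v \<Rightarrow> real" where
    "f x t = exp (- (norm x)\<^sup>2) * ((1 - cos (t \<bullet> x)) * riesz_weight t)" for x t
  have "has_bochner_integral lborel (\<lambda>t. LINT x|lborel. f x t)
     (LINT x::'v|lborel. dist_const DIM('v) * (norm x * exp (- (norm x)\<^sup>2)))"
  proof (rule lborel_pair.has_bochner_integral_Tonelli)
    show "case_prod f \<in> borel_measurable (lborel \<Otimes>\<^sub>M lborel)"
      unfolding f_def by measurable
    show "f x t \<ge> 0" for x t
      by (auto simp: f_def riesz_weight_nonneg intro!: mult_nonneg_nonneg)
    show "has_bochner_integral lborel (f x) (dist_const DIM('v) * (norm x * exp (- (norm x)\<^sup>2)))" for x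
      using has_bochner_integral_mult_right[OF has_bochner_integral_one_minus_cos[of x], of "exp (- (norm x)\<^sup>2)"]
      by (simp add: f_def[abs_def] ac_simps)
    show "integrable lborel (\<lambda>x::'v. dist_const DIM('v) * (norm x * exp (- (norm x)\<^sup>2)))"
      by (intro integrable_mult_right integrable_gaussian_norm)
  qed
  then have "integrable lborel (\<lambda>t. LINT x|lborel. f x t)" by (simp add: has_bochner_integral_iff)
  also have "(\<lambda>t. LINT x|lborel. f x t) =
      (\<lambda>t. sqrt pi ^ DIM('v) * (1 - exp (- ((norm t)\<^sup>2 / 4))) * riesz_weight t)"
  proof
    fix t :: 'v
    have "has_bochner_integral lborel (\<lambda>x. (exp (- (norm x)\<^sup>2) - cos (x \<bullet> t) * exp (- (norm x)\<^sup>2)) * riesz_weight t)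
       ((sqrt pi ^ DIM('v) - sqrt pi ^ DIM('v) * exp (- ((norm t)\<^sup>2 / 4))) * riesz_weight t)"
      using has_bochner_integral_gaussian_cos[of 1 "0::'v"] has_bochner_integral_gaussian_cos[of 1 t]
      by (intro has_bochner_integral_mult_left has_bochner_integral_diff) auto
    also have "(\<lambda>x. (exp (- (norm x)\<^sup>2) - cos (x \<bullet> t) * exp (- (norm x)\<^sup>2)) * riesz_weight t) = (\<lambda>x. f x t)"
      by (simp add: f_def fun_eq_iff algebra_simps inner_commute)
    finally show "(LINT x|lborel. f x t) = sqrt pi ^ DIM('v) * (1 - exp (- ((norm t)\<^sup>2 / 4))) * riesz_weight t"
      by (simp add: has_bochner_integral_iff algebra_simps)
  qed
  finally show "integrable lborel (\<lambda>t::'v. 5 / sqrt pi ^ DIM('v) * (sqrt pi ^ DIM('v) * (1 - exp (- ((norm t)\<^sup>2 / 4))) * riesz_weight t))"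
    by (rule integrable_mult_right)
  have "norm (min 1 ((norm t)\<^sup>2) * riesz_weight t) \<le>
      norm (5 / sqrt pi ^ DIM('v) * (sqrt pi ^ DIM('v) * (1 - exp (- ((norm t)\<^sup>2 / 4))) * riesz_weight t))" for t :: 'v
  proof -
    have "norm (min 1 ((norm t)\<^sup>2) * riesz_weight t) = min 1 ((norm t)\<^sup>2) * riesz_weight t"
      using riesz_weight_nonneg[of t] by simp
    also have "\<dots> \<le> 5 * (1 - exp (- ((norm t)\<^sup>2 / 4))) * riesz_weight t"
      by (intro mult_right_mono min_le_one_minus_exp riesz_weight_nonneg) auto
    also have "\<dots> = 5 / sqrt pi ^ DIM('v) * (sqrt pi ^ DIM('v) * (1 - exp (- ((norm t)\<^sup>2 / 4))) * riesz_weight t)"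
      by simp
    also have "\<dots> \<le> norm \<dots>"
      unfolding real_norm_def by (rule abs_ge_self)
    finally show ?thesis .
  qed
  then show "AE t in lborel. norm (min 1 ((norm t)\<^sup>2) * riesz_weight (t::'v)) \<le>
      norm (5 / sqrt pi ^ DIM('v) * (sqrt pi ^ DIM('v) * (1 - exp (- ((norm t)\<^sup>2 / 4))) * riesz_weight t))"
    by simp
qed auto

lemma lborel_integral_uminus:
  fixes f :: "'v::euclidean_space \<Rightarrow> 'b::{banach, second_countable_topology}"
  assumes [measurable]: "f \<in> borel_measurable borel"
  shows "(LINT t|lborel. f (- t)) = (LINT t|lborel. f t)"
proof -
  have "lborel = distr lborel borel (uminus :: 'v \<Rightarrow> 'v)"
    using lborel_affine[of "-1" "0 :: 'v"] by (simp add: density_1 one_ennreal_def[symmetric])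
  then have "(LINT t|lborel. f t) = (LINT t|distr lborel borel uminus. f t)" by simp
  also have "\<dots> = (LINT t|lborel. f (- t))" by (subst integral_distr) auto
  finally show ?thesis ..
qed

section \<open>Centred characters and their covariance\<close>

context square_integrable_law
begin

definition phi :: "'v \<Rightarrow> complex" where "phi t = (CLINT x|\<mu>. iexp (t \<bullet> x))"

definition centered_iexp :: "'v \<Rightarrow> 'v \<Rightarrow> complex" where "centered_iexp x t = iexp (t \<bullet> x) - phi t"

text \<open>One factor for each of two independent copies, the second conjugated. Averaging products
  of these over the copies produces a squared modulus, integrating over \<open>t\<close> produces
  the kernel.\<close>

definition cross_iexp :: "'v \<times> 'v \<Rightarrow> 'v \<Rightarrow> complex" where
  "cross_iexp z t = centered_iexp (fst z) t * cnj (centered_iexp (snd z) t)"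

lemma integrable_iexp_inner: "integrable \<mu> (\<lambda>x. iexp (t \<bullet> x))"
  by (intro integrable_iexp) auto

lemma measurable_phi [measurable]: "phi \<in> borel_measurable borel"
proof -
  have "(\<lambda>t. CLINT x|\<mu>. iexp (t \<bullet> x)) \<in> borel_measurable borel" by measurable
  then show ?thesis by (simp add: phi_def[abs_def])
qed

lemma cmod_phi_le: "cmod (phi t) \<le> 1"
proof -
  have "cmod (phi t) \<le> (LINT x|\<mu>. cmod (iexp (t \<bullet> x)))"
    unfolding phi_def by (rule integral_norm_bound)
  also have "\<dots> = 1" by simp
  finally show ?thesis .
qed

lemma phi_uminus: "phi (- t) = cnj (phi t)"
  unfolding phi_def Bochner_Integration.integral_cnj[symmetric]
  by (intro Bochner_Integration.integral_cong) (auto simp: exp_cnj)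

lemma cmod_centered_iexp_le_2: "cmod (centered_iexp x t) \<le> 2"
  using norm_triangle_ineq4[of "iexp (t \<bullet> x)" "phi t"] cmod_phi_le[of t] by (simp add: centered_iexp_def)

lemma cmod_centered_iexp_le: "cmod (centered_iexp x t) \<le> norm t * (norm x + expectation norm)"
proof -
  have "cmod (phi t - 1) = cmod (CLINT x|\<mu>. iexp (t \<bullet> x) - 1)"
    using integrable_iexp_inner by (simp add: phi_def)
  also have "\<dots> \<le> (LINT x|\<mu>. cmod (iexp (t \<bullet> x) - 1))"
    by (rule integral_norm_bound)
  also have "\<dots> \<le> (LINT x|\<mu>. norm t * norm x)"
  proof (rule integral_mono)
    show "integrable \<mu> (\<lambda>x. cmod (iexp (t \<bullet> x) - 1))"
      using integrable_iexp_inner by auto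
    show "integrable \<mu> (\<lambda>x. norm t * norm x)" using integrable_norm by auto
    show "cmod (iexp (t \<bullet> x) - 1) \<le> norm t * norm x" for x
      using cmod_iexp_minus_1_le Cauchy_Schwarz_ineq2 by (rule order_trans)
  qed
  finally have *: "cmod (phi t - 1) \<le> norm t * expectation norm" by simp
  have "cmod (centered_iexp x t) \<le> cmod (iexp (t \<bullet> x) - 1) + cmod (phi t - 1)"
    using norm_triangle_ineq4[of "iexp (t \<bullet> x) - 1" "phi t - 1"] by (simp add: centered_iexp_def)
  also have "cmod (iexp (t \<bullet> x) - 1) \<le> norm t * norm x"
    using cmod_iexp_minus_1_le Cauchy_Schwarz_ineq2 by (rule order_trans)
  finally show ?thesis using * by (simp add: algebra_simps)
qed

definition cross_bound :: "'v \<times> 'v \<Rightarrow> real" where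
  "cross_bound z = 4 + (norm (fst z) + expectation norm) * (norm (snd z) + expectation norm)"

lemma measurable_cross_bound [measurable]: "cross_bound \<in> borel_measurable (borel \<Otimes>\<^sub>M borel)"
  unfolding cross_bound_def by measurable

text \<open>Each factor is at most 2 and also at most linear in \<open>norm t\<close>. The first
  bound gives the 4 in \<open>cross_bound\<close> and controls large \<open>t\<close>, the second
  gives the quadratic decay at the origin. The bound grows only linearly in the norm of each point,
  so its square is integrable under a second moment.\<close>

lemma cmod_cross_iexp_le: "cmod (cross_iexp z t) \<le> cross_bound z * min 1 ((norm t)\<^sup>2)"
proof -
  let ?m = "expectation norm"
  have m: "?m \<ge> 0" by (rule Bochner_Integration.integral_nonneg) auto
  let ?b = "(norm (fst z) + ?m) * (norm (snd z) + ?m)"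
  have b: "?b \<ge> 0" using m by simp
  have "cmod (cross_iexp z t) = cmod (centered_iexp (fst z) t) * cmod (centered_iexp (snd z) t)"
    by (simp add: cross_iexp_def norm_mult)
  also have "\<dots> \<le> 2 * 2" by (intro mult_mono cmod_centered_iexp_le_2) auto
  finally have 1: "cmod (cross_iexp z t) \<le> 4" by simp
  have "cmod (cross_iexp z t) = cmod (centered_iexp (fst z) t) * cmod (centered_iexp (snd z) t)"
    by (simp add: cross_iexp_def norm_mult)
  also have "\<dots> \<le> (norm t * (norm (fst z) + ?m)) * (norm t * (norm (snd z) + ?m))"
    using m by (intro mult_mono cmod_centered_iexp_le) auto
  also have "\<dots> = ?b * (norm t)\<^sup>2" by (simp add: power2_eq_square algebra_simps)
  finally have 2: "cmod (cross_iexp z t) \<le> ?b * (norm t)\<^sup>2" .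
  show ?thesis
  proof (cases "(norm t)\<^sup>2 \<le> 1")
    case True
    have "?b * (norm t)\<^sup>2 \<le> cross_bound z * (norm t)\<^sup>2"
      by (intro mult_right_mono) (auto simp: cross_bound_def)
    then show ?thesis using 2 True by (simp add: min_def)
  next
    case False
    have "cross_bound z \<ge> 4" using b by (simp only: cross_bound_def)
    then show ?thesis using 1 False by (simp add: min_def)
  qed
qed

lemma integrable_cross_bound_sq: "integrable (\<mu> \<Otimes>\<^sub>M \<mu>) (\<lambda>z. (cross_bound z)\<^sup>2)"
proof -
  let ?m = "expectation norm"
  let ?n = "\<lambda>x::'v. norm x + ?m"
  have n: "integrable \<mu> ?n" "integrable \<mu> (\<lambda>x. (?n x)\<^sup>2)"
    using integrable_norm integrable_norm_sq by (auto simp: power2_sum)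
  have "(cross_bound z)\<^sup>2 = 16 + 8 * (?n (fst z) * ?n (snd z)) + (?n (fst z))\<^sup>2 * (?n (snd z))\<^sup>2" for z
    by (simp add: cross_bound_def power2_eq_square algebra_simps)
  then show ?thesis
    using pair.integrable_pair_mult[OF n(1) n(1)] pair.integrable_pair_mult[OF n(2) n(2)] by simp
qed

lemma integrable_cross_iexp: "integrable lborel (\<lambda>t. cross_iexp z t * of_real (riesz_weight t))"
proof (rule Bochner_Integration.integrable_bound)
  show "integrable lborel (\<lambda>t::'v. cross_bound z * (min 1 ((norm t)\<^sup>2) * riesz_weight t))"
    by (intro integrable_mult_right integrable_min_riesz_weight)
  have "norm (cross_iexp z t * of_real (riesz_weight t)) \<le> norm (cross_bound z * (min 1 ((norm t)\<^sup>2) * riesz_weight t))" for t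
  proof -
    have "norm (cross_iexp z t * of_real (riesz_weight t)) = cmod (cross_iexp z t) * riesz_weight t"
      using riesz_weight_nonneg[of t] by (simp add: norm_mult)
    also have "\<dots> \<le> cross_bound z * min 1 ((norm t)\<^sup>2) * riesz_weight t"
      by (intro mult_right_mono cmod_cross_iexp_le riesz_weight_nonneg)
    finally show ?thesis by (simp add: mult.assoc)
  qed
  then show "AE t in lborel. norm (cross_iexp z t * of_real (riesz_weight t)) \<le>
      norm (cross_bound z * (min 1 ((norm t)\<^sup>2) * riesz_weight t))" by simp
qed (unfold cross_iexp_def centered_iexp_def, measurable)

text \<open>The real part of a character times a conjugate character is the cosine of a difference.
  The four inserted constants cancel, two having either sign; with them every single term can be
  integrated against the weight.\<close>

lemma Re_cross_iexp:
  "Re (cross_iexp (x, y) t) =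
     - (1 - cos (t \<bullet> (x - y))) + (LINT u|\<mu>. 1 - cos (t \<bullet> (x - u))) + (LINT u|\<mu>. 1 - cos (t \<bullet> (y - u)))
     - (LINT w|\<mu>. LINT u|\<mu>. 1 - cos (t \<bullet> (w - u)))"
proof -
  have int: "integrable \<mu> (\<lambda>u. iexp (t \<bullet> x) * cnj (iexp (t \<bullet> u)))" for x
    using integrable_iexp_inner by (intro integrable_mult_right integrable_cnj)
  have cos_eq: "cos (t \<bullet> (x - u)) = Re (iexp (t \<bullet> x) * cnj (iexp (t \<bullet> u)))" for x u
    by (simp add: Re_exp Im_exp inner_diff_right cos_diff)
  have one: "(LINT u|\<mu>. 1 - cos (t \<bullet> (x - u))) = 1 - Re (iexp (t \<bullet> x) * cnj (phi t))" for x
  proof -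
    have "(LINT u|\<mu>. Re (iexp (t \<bullet> x) * cnj (iexp (t \<bullet> u)))) = Re (CLINT u|\<mu>. iexp (t \<bullet> x) * cnj (iexp (t \<bullet> u)))"
      by (rule integral_Re[OF int])
    also have "(CLINT u|\<mu>. iexp (t \<bullet> x) * cnj (iexp (t \<bullet> u))) = iexp (t \<bullet> x) * cnj (phi t)"
      unfolding phi_def Bochner_Integration.integral_cnj[symmetric] by (rule integral_mult_right_zero)
    finally show ?thesis
      unfolding cos_eq using integrable_Re[OF int[of x]] by simp
  qed
  have two: "(LINT w|\<mu>. LINT u|\<mu>. 1 - cos (t \<bullet> (w - u))) = 1 - Re (phi t * cnj (phi t))"
  proof -
    have int': "integrable \<mu> (\<lambda>w. iexp (t \<bullet> w) * cnj (phi t))"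
      using integrable_iexp_inner by (intro integrable_mult_left)
    have "(LINT w|\<mu>. Re (iexp (t \<bullet> w) * cnj (phi t))) = Re (CLINT w|\<mu>. iexp (t \<bullet> w) * cnj (phi t))"
      by (rule integral_Re[OF int'])
    also have "(CLINT w|\<mu>. iexp (t \<bullet> w) * cnj (phi t)) = phi t * cnj (phi t)"
      unfolding phi_def by (rule integral_mult_left_zero)
    finally show ?thesis
      unfolding one using integrable_Re[OF int'] by simp
  qed
  have "Re (cross_iexp (x, y) t) = Re (iexp (t \<bullet> x) * cnj (iexp (t \<bullet> y))) - Re (iexp (t \<bullet> x) * cnj (phi t))
      - Re (iexp (t \<bullet> y) * cnj (phi t)) + Re (phi t * cnj (phi t))"
    by (simp add: cross_iexp_def centered_iexp_def algebra_simps)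
  then show ?thesis
    using one[of x] one[of y] two cos_eq[of x y] by linarith
qed

text \<open>The signs in the expansion of the real part are opposite to those in
  \<open>kern\<close>, and each \<open>1 - cos\<close> integrates to \<open>dist_const\<close> times
  a distance, averaged over the law where needed; hence the negative kernel.\<close>

lemma integral_cross_iexp:
  "(CLINT t|lborel. cross_iexp (x, y) t * of_real (riesz_weight t)) = of_real (- (dist_const DIM('v) * kern x y))"
proof (rule complex_eqI)
  let ?w = "riesz_weight :: 'v \<Rightarrow> real" and ?c = "dist_const DIM('v)"
  let ?I = "CLINT t|lborel. cross_iexp (x, y) t * of_real (?w t)"
  have one: "has_bochner_integral lborel (\<lambda>t. LINT u|\<mu>. (1 - cos (t \<bullet> (x - u))) * ?w t) (LINT u|\<mu>. ?c * norm (x - u))" for x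
  proof -
    interpret P: pair_sigma_finite \<mu> "lborel :: 'v measure" by unfold_locales
    show ?thesis
      using integrable_dist
      by (intro P.has_bochner_integral_Tonelli has_bochner_integral_one_minus_cos)
        (auto intro!: mult_nonneg_nonneg riesz_weight_nonneg)
  qed
  have two: "has_bochner_integral lborel (\<lambda>t. LINT w|\<mu>. LINT u|\<mu>. (1 - cos (t \<bullet> (w - u))) * ?w t)
      (LINT w|\<mu>. LINT u|\<mu>. ?c * norm (w - u))"
  proof -
    interpret P: pair_sigma_finite \<mu> "lborel :: 'v measure" by unfold_locales
    show ?thesis
    proof (rule P.has_bochner_integral_Tonelli[OF _ _ one])
      show "integrable \<mu> (\<lambda>w. LINT u|\<mu>. ?c * norm (w - u))"
        using integrable_mean_dist by (simp add: mean_dist_def[symmetric])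
      show "(LINT u|\<mu>. (1 - cos (t \<bullet> (w - u))) * ?w t) \<ge> 0" for w t
        by (intro Bochner_Integration.integral_nonneg mult_nonneg_nonneg riesz_weight_nonneg) auto
    qed measurable
  qed
  have "has_bochner_integral lborel
     (\<lambda>t. - ((1 - cos (t \<bullet> (x - y))) * ?w t) + (LINT u|\<mu>. (1 - cos (t \<bullet> (x - u))) * ?w t)
       + (LINT u|\<mu>. (1 - cos (t \<bullet> (y - u))) * ?w t)
       - (LINT w|\<mu>. LINT u|\<mu>. (1 - cos (t \<bullet> (w - u))) * ?w t))
     (- (?c * norm (x - y)) + (LINT u|\<mu>. ?c * norm (x - u)) + (LINT u|\<mu>. ?c * norm (y - u))
       - (LINT w|\<mu>. LINT u|\<mu>. ?c * norm (w - u)))"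
    by (intro has_bochner_integral_add has_bochner_integral_diff has_bochner_integral_minus one two
        has_bochner_integral_one_minus_cos)
  also have "(\<lambda>t. - ((1 - cos (t \<bullet> (x - y))) * ?w t) + (LINT u|\<mu>. (1 - cos (t \<bullet> (x - u))) * ?w t)
       + (LINT u|\<mu>. (1 - cos (t \<bullet> (y - u))) * ?w t)
       - (LINT w|\<mu>. LINT u|\<mu>. (1 - cos (t \<bullet> (w - u))) * ?w t))
     = (\<lambda>t. Re (cross_iexp (x, y) t * of_real (?w t)))"
    unfolding integral_mult_left_zero by (rule ext) (simp add: Re_cross_iexp algebra_simps)
  also have "- (?c * norm (x - y)) + (LINT u|\<mu>. ?c * norm (x - u)) + (LINT u|\<mu>. ?c * norm (y - u))
       - (LINT w|\<mu>. LINT u|\<mu>. ?c * norm (w - u)) = - (?c * kern x y)"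
    by (simp add: mean_dist_def[symmetric] gini_def[symmetric] kern_def algebra_simps)
  finally show "Re ?I = Re (of_real (- (?c * kern x y)))"
    using integral_Re[OF integrable_cross_iexp[of "(x, y)"]] by (simp add: has_bochner_integral_iff)
  \<comment> \<open>Replacing \<open>t\<close> by \<open>- t\<close> conjugates the integrand and
    preserves weight and Lebesgue measure, so the integral equals its own conjugate.\<close>
  have "?I = (CLINT t|lborel. cross_iexp (x, y) (- t) * of_real (?w (- t)))"
    by (rule lborel_integral_uminus[symmetric]) (unfold cross_iexp_def centered_iexp_def, measurable)
  also have "\<dots> = (CLINT t|lborel. cnj (cross_iexp (x, y) t * of_real (?w t)))"
    by (intro Bochner_Integration.integral_cong)
      (auto simp: cross_iexp_def centered_iexp_def phi_uminus exp_cnj)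
  also have "\<dots> = cnj ?I" by (rule Bochner_Integration.integral_cnj)
  finally have "?I = cnj ?I" .
  then have "Im ?I = Im (cnj ?I)" by (rule arg_cong)
  then show "Im ?I = Im (of_real (- (?c * kern x y)))" by simp
qed

lemma covariance_eq:
  "phi (t + s) - phi t * phi s = (CLINT x|\<mu>. centered_iexp x t * centered_iexp x s)"
proof -
  have "(CLINT x|\<mu>. centered_iexp x t * centered_iexp x s)
      = (CLINT x|\<mu>. iexp ((t + s) \<bullet> x) - phi s * iexp (t \<bullet> x) - phi t * iexp (s \<bullet> x) + phi t * phi s)"
    by (intro Bochner_Integration.integral_cong)
      (auto simp: centered_iexp_def inner_add_left exp_add[symmetric] algebra_simps)
  also have "\<dots> = phi (t + s) - phi s * phi t - phi t * phi s + phi t * phi s"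
    using integrable_iexp_inner by (simp add: phi_def)
  finally show ?thesis by simp
qed

text \<open>For independent copies \<open>x\<close> and \<open>y\<close>, the squared modulus of the
  expectation of \<open>f\<close> is the expectation of \<open>f x * cnj (f y)\<close>; here
  \<open>f\<close> is the product of the centred characters at \<open>t\<close> and
  \<open>s\<close>, whose expectation is the covariance.\<close>

lemma integral_cross_iexp_product:
  "(CLINT z|(\<mu> \<Otimes>\<^sub>M \<mu>). cross_iexp z t * cross_iexp z s) = of_real ((cmod (phi (t + s) - phi t * phi s))\<^sup>2)"
proof -
  define f where "f x = centered_iexp x t * centered_iexp x s" for x
  have [measurable]: "f \<in> borel_measurable borel"
    unfolding f_def centered_iexp_def by measurable
  have f4: "cmod (f x) \<le> 4" for x
  proof -
    have "cmod (f x) \<le> 2 * 2"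
      unfolding f_def norm_mult by (intro mult_mono cmod_centered_iexp_le_2) auto
    then show ?thesis by simp
  qed
  have int: "integrable (\<mu> \<Otimes>\<^sub>M \<mu>) (\<lambda>z. f (fst z) * cnj (f (snd z)))"
  proof (rule pair.P.integrable_const_bound[where B = "4 * 4"])
    have "norm (f x * cnj (f y)) \<le> 4 * 4" for x y
      unfolding norm_mult complex_mod_cnj by (intro mult_mono f4) auto
    then show "AE z in \<mu> \<Otimes>\<^sub>M \<mu>. norm (f (fst z) * cnj (f (snd z))) \<le> 4 * 4" by simp
  qed measurable
  have "(CLINT z|(\<mu> \<Otimes>\<^sub>M \<mu>). cross_iexp z t * cross_iexp z s) = (CLINT z|(\<mu> \<Otimes>\<^sub>M \<mu>). f (fst z) * cnj (f (snd z)))"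
    by (intro Bochner_Integration.integral_cong) (auto simp: cross_iexp_def f_def)
  also have "\<dots> = (CLINT x|\<mu>. CLINT y|\<mu>. f x * cnj (f y))"
    using pair.integral_fst'[OF int] by simp
  also have "\<dots> = (CLINT x|\<mu>. f x) * cnj (CLINT x|\<mu>. f x)"
    by simp
  also have "\<dots> = of_real ((cmod (CLINT x|\<mu>. f x))\<^sup>2)"
    by (rule complex_norm_square[symmetric])
  finally show ?thesis by (simp add: covariance_eq f_def)
qed

text \<open>Fubini between the frequencies \<open>(t, s)\<close> and the copies
  \<open>(x, y)\<close>. Integrating the copies first gives the integrand of the distance variance;
  integrating the frequencies first, the integrals over \<open>t\<close> and \<open>s\<close>
  separate and give the square of \<open>- (dist_const * kern)\<close>.\<close>

theorem nn_integral_covariance: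
  "(\<integral>\<^sup>+ t. \<integral>\<^sup>+ s. ennreal ((cmod (phi (t + s) - phi t * phi s))\<^sup>2 /
       (norm t ^ (DIM('v) + 1) * norm s ^ (DIM('v) + 1))) \<partial>lborel \<partial>lborel)
   = ennreal ((dist_const DIM('v))\<^sup>2 * kern_var)"
proof -
  let ?L = "lborel \<Otimes>\<^sub>M lborel :: ('v \<times> 'v) measure" and ?Q = "\<mu> \<Otimes>\<^sub>M \<mu>"
  let ?w = "riesz_weight :: 'v \<Rightarrow> real" and ?c = "dist_const DIM('v)"
  interpret Q: pair_sigma_finite ?L ?Q
    by (intro pair_sigma_finite.intro sigma_finite_pair_measure sigma_finite_lborel sigma_finite_measure_axioms)
  define G where "G w = (cmod (phi (fst w + snd w) - phi (fst w) * phi (snd w)))\<^sup>2 * (?w (fst w) * ?w (snd w))" for w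
  have [measurable]: "G \<in> borel_measurable ?L" unfolding G_def by measurable
  have G_nonneg: "G w \<ge> 0" for w by (auto simp: G_def intro!: mult_nonneg_nonneg riesz_weight_nonneg)
  define h where "h z t = cross_iexp z t * of_real (?w t)" for z t
  define b where "b t = min 1 ((norm t)\<^sup>2) * ?w t" for t
  have b: "integrable lborel b" unfolding b_def by (rule integrable_min_riesz_weight)
  have hb: "cmod (h z t) \<le> cross_bound z * b t" for z t
  proof -
    have "cmod (h z t) = cmod (cross_iexp z t) * ?w t"
      using riesz_weight_nonneg[of t] by (simp add: h_def norm_mult)
    also have "\<dots> \<le> cross_bound z * min 1 ((norm t)\<^sup>2) * ?w t"
      by (intro mult_right_mono cmod_cross_iexp_le riesz_weight_nonneg)
    finally show ?thesis by (simp add: b_def mult.assoc)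
  qed
  \<comment> \<open>\<open>H\<close> is dominated by one factor \<open>b\<close> for each frequency
    times the squared \<open>cross_bound\<close>, a product of integrable functions of separate
    variables.\<close>
  define H where "H p = h (snd p) (fst (fst p)) * h (snd p) (snd (fst p))" for p
  have int: "integrable (?L \<Otimes>\<^sub>M ?Q) H"
  proof (rule Bochner_Integration.integrable_bound)
    show "integrable (?L \<Otimes>\<^sub>M ?Q) (\<lambda>p. (b (fst (fst p)) * b (snd (fst p))) * (cross_bound (snd p))\<^sup>2)"
      by (intro Q.integrable_pair_mult lborel_pair.integrable_pair_mult b integrable_cross_bound_sq)
    show "H \<in> borel_measurable (?L \<Otimes>\<^sub>M ?Q)"
      unfolding H_def h_def cross_iexp_def centered_iexp_def by measurable
    have "norm (H p) \<le> norm ((b (fst (fst p)) * b (snd (fst p))) * (cross_bound (snd p))\<^sup>2)" for p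
    proof -
      have "norm (H p) \<le> (cross_bound (snd p) * b (fst (fst p))) * (cross_bound (snd p) * b (snd (fst p)))"
        unfolding H_def norm_mult using hb order_trans[OF norm_ge_zero hb] by (intro mult_mono) auto
      also have "\<dots> = (b (fst (fst p)) * b (snd (fst p))) * (cross_bound (snd p))\<^sup>2"
        by (simp add: power2_eq_square algebra_simps)
      also have "\<dots> \<le> norm \<dots>" unfolding real_norm_def by (rule abs_ge_self)
      finally show ?thesis .
    qed
    then show "AE p in ?L \<Otimes>\<^sub>M ?Q. norm (H p) \<le> norm ((b (fst (fst p)) * b (snd (fst p))) * (cross_bound (snd p))\<^sup>2)"
      by simp
  qed
  have G_eq: "(CLINT z|?Q. H (w, z)) = of_real (G w)" for w
  proof -
    have "(CLINT z|?Q. H (w, z)) = (CLINT z|?Q. (cross_iexp z (fst w) * cross_iexp z (snd w)) * of_real (?w (fst w) * ?w (snd w)))"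
      by (intro Bochner_Integration.integral_cong) (auto simp: H_def h_def)
    also have "\<dots> = of_real (G w)"
      unfolding integral_mult_left_zero integral_cross_iexp_product by (simp add: G_def)
    finally show ?thesis .
  qed
  have kern_eq: "(CLINT w|?L. H (w, z)) = of_real (?c\<^sup>2 * (kern (fst z) (snd z))\<^sup>2)" for z
  proof -
    have hz: "integrable lborel (h z)" "integral\<^sup>L lborel (h z) = of_real (- (?c * kern (fst z) (snd z)))"
      using integrable_cross_iexp[of z] integral_cross_iexp[of "fst z" "snd z"] by (simp_all add: h_def[abs_def])
    have [measurable]: "h z \<in> borel_measurable borel" using hz(1) by auto
    have "integrable ?L (\<lambda>w. h z (fst w) * h z (snd w))"
      using hz(1) by (intro lborel_pair.Fubini_integrable) (auto simp: norm_mult)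
    then have "(CLINT w|?L. h z (fst w) * h z (snd w)) = (CLINT t|lborel. CLINT s|lborel. h z t * h z s)"
      using lborel_pair.integral_fst'[of "\<lambda>w. h z (fst w) * h z (snd w)"] by simp
    also have "\<dots> = of_real (?c\<^sup>2 * (kern (fst z) (snd z))\<^sup>2)"
      by (simp add: hz power2_eq_square)
    finally show ?thesis by (simp add: H_def)
  qed
  have "integrable ?L (\<lambda>w. complex_of_real (G w))"
    using Q.integrable_fst'[OF int] by (simp add: G_eq)
  then have G_int: "integrable ?L G" by (simp only: complex_of_real_integrable_eq)
  have "complex_of_real (LINT w|?L. G w) = (CLINT w|?L. CLINT z|?Q. H (w, z))"
    by (simp add: G_eq)
  also have "\<dots> = (CLINT z|?Q. CLINT w|?L. H (w, z))"
    using Q.Fubini_integral[of "\<lambda>w z. H (w, z)"] int by (simp add: split_beta')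
  also have "\<dots> = of_real (?c\<^sup>2 * kern_var)"
    unfolding kern_eq kern_var_def by (simp del: of_real_mult of_real_power)
  finally have G_val: "(LINT w|?L. G w) = ?c\<^sup>2 * kern_var"
    by (simp only: of_real_eq_iff)
  have "(\<integral>\<^sup>+ t. \<integral>\<^sup>+ s. ennreal ((cmod (phi (t + s) - phi t * phi s))\<^sup>2 /
       (norm t ^ (DIM('v) + 1) * norm s ^ (DIM('v) + 1))) \<partial>lborel \<partial>lborel)
     = (\<integral>\<^sup>+ t. \<integral>\<^sup>+ s. ennreal (G (t, s)) \<partial>lborel \<partial>lborel)"
    by (simp add: G_def riesz_weight_def)
  also have "\<dots> = (\<integral>\<^sup>+ w. ennreal (G w) \<partial>?L)"
    by (rule lborel.nn_integral_fst) measurable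
  also have "\<dots> = ennreal (?c\<^sup>2 * kern_var)"
    using G_int G_nonneg G_val by (subst nn_integral_eq_integral) auto
  finally show ?thesis .
qed

end

subsection \<open>Independence and characteristic functions\<close>

context prob_space
begin

text \<open>Rectangles determine the joint law, so the product formula on preimages amounts to
  equality with the product measure. Fubini and the transfer between probability spaces use this
  form.\<close>

lemma indep_rv_iff_distr:
  "indep_rv M S X T Y \<longleftrightarrow> random_variable S X \<and> random_variable T Y \<and>
    distr M (S \<Otimes>\<^sub>M T) (\<lambda>\<omega>. (X \<omega>, Y \<omega>)) = distr M S X \<Otimes>\<^sub>M distr M T Y"
proof safe
  assume ind: "indep_rv M S X T Y"
  then show X [measurable]: "random_variable S X" and Y [measurable]: "random_variable T Y"
    by (auto simp: indep_rv_def)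
  have XY: "random_variable (S \<Otimes>\<^sub>M T) (\<lambda>\<omega>. (X \<omega>, Y \<omega>))" by measurable
  show "distr M (S \<Otimes>\<^sub>M T) (\<lambda>\<omega>. (X \<omega>, Y \<omega>)) = distr M S X \<Otimes>\<^sub>M distr M T Y"
  proof (rule pair_measure_eqI[symmetric])
    interpret X: prob_space "distr M S X" by (rule prob_space_distr) fact
    interpret Y: prob_space "distr M T Y" by (rule prob_space_distr) fact
    show "sigma_finite_measure (distr M S X)" "sigma_finite_measure (distr M T Y)" by unfold_locales
    fix A B assume A: "A \<in> sets (distr M S X)" and B: "B \<in> sets (distr M T Y)"
    have "emeasure (distr M (S \<Otimes>\<^sub>M T) (\<lambda>\<omega>. (X \<omega>, Y \<omega>))) (A \<times> B)
        = emeasure M ((\<lambda>\<omega>. (X \<omega>, Y \<omega>)) -` (A \<times> B) \<inter> space M)"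
      using A B by (intro emeasure_distr[OF XY]) auto
    also have "(\<lambda>\<omega>. (X \<omega>, Y \<omega>)) -` (A \<times> B) \<inter> space M = (X -` A \<inter> space M) \<inter> (Y -` B \<inter> space M)"
      by auto
    also have "emeasure M \<dots> = emeasure M (X -` A \<inter> space M) * emeasure M (Y -` B \<inter> space M)"
    proof -
      have "prob ((X -` A \<inter> space M) \<inter> (Y -` B \<inter> space M)) = prob (X -` A \<inter> space M) * prob (Y -` B \<inter> space M)"
        using A B by (intro indep_setD[OF ind[unfolded indep_rv_def, THEN conjunct2, THEN conjunct2]]) auto
      then show ?thesis by (simp add: emeasure_eq_measure ennreal_mult)
    qed
    also have "\<dots> = emeasure (distr M S X) A * emeasure (distr M T Y) B"
      using A B X Y by (simp add: emeasure_distr)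
    finally show "emeasure (distr M S X) A * emeasure (distr M T Y) B
        = emeasure (distr M (S \<Otimes>\<^sub>M T) (\<lambda>\<omega>. (X \<omega>, Y \<omega>))) (A \<times> B)" ..
  qed simp
next
  assume X [measurable]: "random_variable S X" and Y [measurable]: "random_variable T Y"
    and eq: "distr M (S \<Otimes>\<^sub>M T) (\<lambda>\<omega>. (X \<omega>, Y \<omega>)) = distr M S X \<Otimes>\<^sub>M distr M T Y"
  interpret Y: prob_space "distr M T Y" by (rule prob_space_distr) fact
  have "prob ((X -` A \<inter> space M) \<inter> (Y -` B \<inter> space M)) = prob (X -` A \<inter> space M) * prob (Y -` B \<inter> space M)"
    if A: "A \<in> sets S" and B: "B \<in> sets T" for A B
  proof -
    have "emeasure M ((X -` A \<inter> space M) \<inter> (Y -` B \<inter> space M)) = emeasure M ((\<lambda>\<omega>. (X \<omega>, Y \<omega>)) -` (A \<times> B) \<inter> space M)"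
      by (rule arg_cong[where f = "emeasure M"]) auto
    also have "\<dots> = emeasure (distr M S X \<Otimes>\<^sub>M distr M T Y) (A \<times> B)"
      unfolding eq[symmetric] using A B by (intro emeasure_distr[symmetric]) auto
    also have "\<dots> = emeasure M (X -` A \<inter> space M) * emeasure M (Y -` B \<inter> space M)"
      using A B by (simp add: Y.emeasure_pair_measure_Times emeasure_distr)
    finally show ?thesis
      by (simp add: emeasure_eq_measure flip: ennreal_mult)
  qed
  then show "indep_rv M S X T Y"
    unfolding indep_rv_def by (auto intro!: indep_setI measurable_sets)
qed

lemma indep_rv_of_indep_var:
  assumes "indep_var S X T Y"
  shows "indep_rv M S X T Y"
  using assms by (subst indep_rv_iff_distr) (simp add: indep_var_distribution_eq)

lemma indep_rv_compose:
  assumes ind: "indep_rv M S X T Y" and f: "f \<in> measurable S S'" and g: "g \<in> measurable T T'"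
  shows "indep_rv M S' (\<lambda>\<omega>. f (X \<omega>)) T' (\<lambda>\<omega>. g (Y \<omega>))"
proof -
  have X: "random_variable S X" and Y: "random_variable T Y"
    and set: "indep_set {X -` A \<inter> space M |A. A \<in> sets S} {Y -` B \<inter> space M |B. B \<in> sets T}"
    using ind by (auto simp: indep_rv_def)
  have *: "\<exists>A'. (\<lambda>\<omega>. h (Z \<omega>)) -` A \<inter> space M = Z -` A' \<inter> space M \<and> A' \<in> sets R"
    if "random_variable R Z" "h \<in> measurable R R'" "A \<in> sets R'" for h A R R' and Z :: "'a \<Rightarrow> 'z"
    using that measurable_space[OF that(1)] measurable_sets[OF that(2,3)]
    by (intro exI[of _ "h -` A \<inter> space R"]) auto
  have "indep_set {(\<lambda>\<omega>. f (X \<omega>)) -` A \<inter> space M |A. A \<in> sets S'} {(\<lambda>\<omega>. g (Y \<omega>)) -` B \<inter> space M |B. B \<in> sets T'}"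
    using *[OF X f] *[OF Y g] set unfolding indep_set_def
    by (intro indep_sets_mono_sets[OF set[unfolded indep_set_def]]) (auto split: bool.split)
  then show ?thesis
    using X Y f g by (auto simp: indep_rv_def)
qed

lemma indep_rv_restrict:
  assumes ind: "indep_vars M' X I" and AB: "A \<inter> B = {}" "A \<subseteq> I" "B \<subseteq> I"
  shows "indep_rv M (PiM A M') (\<lambda>\<omega>. restrict (\<lambda>i. X i \<omega>) A) (PiM B M') (\<lambda>\<omega>. restrict (\<lambda>i. X i \<omega>) B)"
  using indep_var_restrict[OF assms] by (rule indep_rv_of_indep_var)

text \<open>The variance of \<open>\<bar>f \<omega>\<bar>\<close> is nonnegative. Error terms whose
  second moments are known by orthogonality enter the limit argument through this bound.\<close>

lemma expectation_abs_le:
  fixes f :: "'a \<Rightarrow> real"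
  assumes [measurable]: "random_variable borel f" and sq: "integrable M (\<lambda>\<omega>. (f \<omega>)\<^sup>2)" and c: "expectation (\<lambda>\<omega>. (f \<omega>)\<^sup>2) \<le> c"
  shows "integrable M f" "expectation (\<lambda>\<omega>. \<bar>f \<omega>\<bar>) \<le> sqrt c"
proof -
  show int: "integrable M f"
    using integrable_mult_of_sq[of f M "\<lambda>_. 1"] sq by simp
  have "0 \<le> variance (\<lambda>\<omega>. \<bar>f \<omega>\<bar>)" by (rule variance_positive)
  also have "\<dots> = expectation (\<lambda>\<omega>. \<bar>f \<omega>\<bar>\<^sup>2) - (expectation (\<lambda>\<omega>. \<bar>f \<omega>\<bar>))\<^sup>2"
    using int sq by (intro variance_eq) auto
  finally have "(expectation (\<lambda>\<omega>. \<bar>f \<omega>\<bar>))\<^sup>2 \<le> c" using c by simp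
  then show "expectation (\<lambda>\<omega>. \<bar>f \<omega>\<bar>) \<le> sqrt c"
    by (rule real_le_rsqrt)
qed

lemma expectation_sum_sq_orthogonal:
  fixes Z :: "'i \<Rightarrow> 'a \<Rightarrow> real"
  assumes [measurable]: "\<And>i. i \<in> I \<Longrightarrow> random_variable borel (Z i)"
    and sq: "\<And>i. i \<in> I \<Longrightarrow> integrable M (\<lambda>\<omega>. (Z i \<omega>)\<^sup>2)"
    and orth: "\<And>i j. i \<in> I \<Longrightarrow> j \<in> I \<Longrightarrow> i \<noteq> j \<Longrightarrow> expectation (\<lambda>\<omega>. Z i \<omega> * Z j \<omega>) = 0"
  shows "integrable M (\<lambda>\<omega>. (\<Sum>i\<in>I. Z i \<omega>)\<^sup>2)"
    "expectation (\<lambda>\<omega>. (\<Sum>i\<in>I. Z i \<omega>)\<^sup>2) = (\<Sum>i\<in>I. expectation (\<lambda>\<omega>. (Z i \<omega>)\<^sup>2))"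
proof -
  have int: "integrable M (\<lambda>\<omega>. Z i \<omega> * Z j \<omega>)" if "i \<in> I" "j \<in> I" for i j
    using that sq by (intro integrable_mult_of_sq) auto
  have eq: "(\<Sum>i\<in>I. Z i \<omega>)\<^sup>2 = (\<Sum>i\<in>I. \<Sum>j\<in>I. Z i \<omega> * Z j \<omega>)" for \<omega>
    by (simp add: power2_eq_square sum_product)
  show "integrable M (\<lambda>\<omega>. (\<Sum>i\<in>I. Z i \<omega>)\<^sup>2)"
    unfolding eq by (intro Bochner_Integration.integrable_sum int)
  have "expectation (\<lambda>\<omega>. (\<Sum>i\<in>I. Z i \<omega>)\<^sup>2) = (\<Sum>i\<in>I. \<Sum>j\<in>I. expectation (\<lambda>\<omega>. Z i \<omega> * Z j \<omega>))"
    unfolding eq by (simp add: Bochner_Integration.integral_sum int Bochner_Integration.integrable_sum)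
  also have "\<dots> = (\<Sum>i\<in>I. \<Sum>j\<in>I. if j = i then expectation (\<lambda>\<omega>. (Z i \<omega>)\<^sup>2) else 0)"
    by (intro sum.cong refl) (auto simp: orth power2_eq_square)
  also have "\<dots> = (\<Sum>i\<in>I. expectation (\<lambda>\<omega>. (Z i \<omega>)\<^sup>2))"
    \<comment> \<open>For infinite \<open>I\<close> both sides are 0, the default value of a
      sum.\<close>
    by (cases "finite I") simp_all
  finally show "expectation (\<lambda>\<omega>. (\<Sum>i\<in>I. Z i \<omega>)\<^sup>2) = (\<Sum>i\<in>I. expectation (\<lambda>\<omega>. (Z i \<omega>)\<^sup>2))" .
qed

section \<open>Characteristic functions under small perturbations\<close>

lemma char_distr:
  assumes [measurable]: "random_variable borel A"
  shows "char (distr M borel A) t = (CLINT \<omega>|M. iexp (t * A \<omega>))"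
  unfolding char_def by (rule integral_distr) auto

lemma cmod_char_diff_le:
  fixes A B g :: "'a \<Rightarrow> real"
  assumes [measurable]: "random_variable borel A" "random_variable borel B" and g: "integrable M g"
    and le: "\<And>\<omega>. cmod (iexp (t * A \<omega>) - iexp (t * B \<omega>)) \<le> g \<omega>"
  shows "cmod (char (distr M borel A) t - char (distr M borel B) t) \<le> expectation g"
proof -
  have int: "integrable M (\<lambda>\<omega>. iexp (t * A \<omega>))" "integrable M (\<lambda>\<omega>. iexp (t * B \<omega>))"
    by (auto intro!: integrable_iexp)
  have "cmod (char (distr M borel A) t - char (distr M borel B) t)
      = cmod (CLINT \<omega>|M. iexp (t * A \<omega>) - iexp (t * B \<omega>))"
    using int by (simp add: char_distr)
  also have "\<dots> \<le> expectation (\<lambda>\<omega>. cmod (iexp (t * A \<omega>) - iexp (t * B \<omega>)))"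
    by (rule integral_norm_bound)
  also have "\<dots> \<le> expectation g"
    using int g le by (intro integral_mono) auto
  finally show ?thesis .
qed

end

lemma cmod_iexp_diff_le: "cmod (iexp x - iexp y) \<le> \<bar>x - y\<bar>"
proof -
  have "iexp x - iexp y = iexp y * (iexp (x - y) - 1)"
    by (simp add: exp_add[symmetric] algebra_simps)
  then have "cmod (iexp x - iexp y) = cmod (iexp (x - y) - 1)"
    by (simp add: norm_mult)
  then show ?thesis using cmod_iexp_minus_1_le[of "x - y"] by simp
qed

text \<open>Since \<open>iexp\<close> is 1-Lipschitz, closeness in mean gives closeness of
  characteristic functions at each fixed \<open>t\<close>.\<close>

lemma (in prob_space) cmod_char_diff_le_L1:
  assumes [measurable]: "random_variable borel A" "random_variable borel B"
    and int: "integrable M (\<lambda>\<omega>. A \<omega> - B \<omega>)"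
  shows "cmod (char (distr M borel A) t - char (distr M borel B) t) \<le> \<bar>t\<bar> * expectation (\<lambda>\<omega>. \<bar>A \<omega> - B \<omega>\<bar>)"
proof -
  have "cmod (char (distr M borel A) t - char (distr M borel B) t) \<le> expectation (\<lambda>\<omega>. \<bar>t\<bar> * \<bar>A \<omega> - B \<omega>\<bar>)"
  proof (rule cmod_char_diff_le)
    show "cmod (iexp (t * A \<omega>) - iexp (t * B \<omega>)) \<le> \<bar>t\<bar> * \<bar>A \<omega> - B \<omega>\<bar>" for \<omega>
      using cmod_iexp_diff_le[of "t * A \<omega>" "t * B \<omega>"] by (simp add: abs_mult[symmetric] right_diff_distrib)
  qed (use int in auto)
  then show ?thesis by simp
qed

text \<open>For limits taken in turn, first in \<open>n\<close> at fixed \<open>m\<close>, then in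
  \<open>m\<close>. The parameter \<open>m\<close> governs the tolerance in the quotient argument
  and the block length in the central limit theorem.\<close>

lemma tendsto_0_approximation:
  fixes d :: "nat \<Rightarrow> real"
  assumes le: "\<And>m. eventually (\<lambda>n. d n \<le> U m n) sequentially" and U: "\<And>m. U m \<longlonglongrightarrow> u m"
    and u: "u \<longlonglongrightarrow> 0" and d: "\<And>n. d n \<ge> 0"
  shows "d \<longlonglongrightarrow> 0"
proof (rule LIMSEQ_I)
  fix e :: real assume e: "e > 0"
  have "eventually (\<lambda>m. u m < e / 2) sequentially"
    using u e by (intro order_tendstoD(2)[of _ 0]) auto
  then obtain m where m: "u m < e / 2"
    by (auto simp: eventually_sequentially)
  have "eventually (\<lambda>n. U m n < u m + e / 2) sequentially"
    using U[of m] e by (intro order_tendstoD(2)[of _ "u m"]) auto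
  with le[of m] have "eventually (\<lambda>n. norm (d n - 0) < e) sequentially"
    by eventually_elim (use m d in auto)
  then show "\<exists>no. \<forall>n\<ge>no. norm (d n - 0) < e"
    by (simp add: eventually_sequentially)
qed

text \<open>Where \<open>V n\<close> is not close to \<open>c\<close>, the exponentials differ by at most
  \<open>2 \<le> 2 * \<bar>V n - c\<bar> / e\<close>, which has small expectation; this replaces convergence in probability.\<close>
lemma (in prob_space) slutsky_char:
  fixes A V :: "nat \<Rightarrow> 'a \<Rightarrow> real"
  assumes [measurable]: "\<And>n. random_variable borel (A n)" "\<And>n. random_variable borel (V n)"
    and A: "\<And>n. integrable M (A n)" "\<And>n. n \<ge> 1 \<Longrightarrow> expectation (\<lambda>\<omega>. \<bar>A n \<omega>\<bar>) \<le> C"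
    and V: "\<And>n. integrable M (V n)" "(\<lambda>n. expectation (\<lambda>\<omega>. \<bar>V n \<omega> - c\<bar>)) \<longlonglongrightarrow> 0"
    and c: "c > 0" and lim: "(\<lambda>n. char (distr M borel (\<lambda>\<omega>. A n \<omega> / c)) t) \<longlonglongrightarrow> l"
  shows "(\<lambda>n. char (distr M borel (\<lambda>\<omega>. A n \<omega> / V n \<omega>)) t) \<longlonglongrightarrow> l"
proof -
  define d where "d n = cmod (char (distr M borel (\<lambda>\<omega>. A n \<omega> / V n \<omega>)) t - char (distr M borel (\<lambda>\<omega>. A n \<omega> / c)) t)" for n
  \<comment> \<open>Tolerances of at most \<open>c / 2\<close> keep
    \<open>V n \<omega> \<ge> c / 2\<close> wherever \<open>V n\<close> is within tolerance; the
    later factor \<open>2 / c\<^sup>2\<close> is the reciprocal of \<open>c / 2 * c\<close>.\<close>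
  define e where "e m = c / 2 / real (Suc m)" for m
  have e: "e m > 0" "e m \<le> c / 2" for m
    using c by (auto simp: e_def divide_le_eq mult_le_cancel_left1)
  define U where "U m n = 2 / e m * expectation (\<lambda>\<omega>. \<bar>V n \<omega> - c\<bar>) + \<bar>t\<bar> * (2 * e m / c\<^sup>2) * C" for m n
  have "d \<longlonglongrightarrow> 0"
  proof (rule tendsto_0_approximation)
    fix m
    show "U m \<longlonglongrightarrow> 2 / e m * 0 + \<bar>t\<bar> * (2 * e m / c\<^sup>2) * C"
      unfolding U_def by (intro tendsto_intros V)
    have "d n \<le> U m n" if n: "n \<ge> 1" for n
    proof -
      let ?g = "\<lambda>\<omega>. 2 / e m * \<bar>V n \<omega> - c\<bar> + \<bar>t\<bar> * (2 * e m / c\<^sup>2) * \<bar>A n \<omega>\<bar>"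
      have int: "integrable M (\<lambda>\<omega>. \<bar>V n \<omega> - c\<bar>)" "integrable M (\<lambda>\<omega>. \<bar>A n \<omega>\<bar>)"
        using A V by auto
      have "d n \<le> expectation ?g"
        unfolding d_def
      proof (rule cmod_char_diff_le)
        fix \<omega>
        let ?L = "cmod (iexp (t * (A n \<omega> / V n \<omega>)) - iexp (t * (A n \<omega> / c)))"
        show "?L \<le> ?g \<omega>"
        proof (cases "\<bar>V n \<omega> - c\<bar> \<ge> e m")
          case True
          have "?L \<le> cmod (iexp (t * (A n \<omega> / V n \<omega>))) + cmod (iexp (t * (A n \<omega> / c)))"
            by (rule norm_triangle_ineq4)
          also have "\<dots> = 2" by simp
          also have "2 \<le> 2 / e m * \<bar>V n \<omega> - c\<bar>"
            using True e(1)[of m] by (simp add: field_simps)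
          finally show ?thesis using e(1)[of m] by (simp add: add_increasing2)
        next
          case False
          then have V': "V n \<omega> \<ge> c / 2" using e(2)[of m] by linarith
          then have V0: "V n \<omega> > 0" using c by linarith
          have "A n \<omega> / V n \<omega> - A n \<omega> / c = A n \<omega> * (c - V n \<omega>) / (V n \<omega> * c)"
            using V0 c by (simp add: field_simps)
          then have "\<bar>A n \<omega> / V n \<omega> - A n \<omega> / c\<bar> = \<bar>A n \<omega>\<bar> * \<bar>V n \<omega> - c\<bar> / (V n \<omega> * c)"
            using V0 c by (simp add: abs_mult abs_minus_commute)
          also have "\<dots> \<le> \<bar>A n \<omega>\<bar> * e m / (c / 2 * c)"
            using V' V0 c False e(1)[of m] by (intro frac_le mult_left_mono mult_right_mono) auto
          finally have *: "\<bar>A n \<omega> / V n \<omega> - A n \<omega> / c\<bar> \<le> (2 * e m / c\<^sup>2) * \<bar>A n \<omega>\<bar>"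
            by (simp add: power2_eq_square field_simps)
          have "?L \<le> \<bar>t * (A n \<omega> / V n \<omega>) - t * (A n \<omega> / c)\<bar>"
            by (rule cmod_iexp_diff_le)
          also have "\<dots> = \<bar>t\<bar> * \<bar>A n \<omega> / V n \<omega> - A n \<omega> / c\<bar>"
            by (simp only: abs_mult[symmetric] right_diff_distrib)
          also have "\<dots> \<le> \<bar>t\<bar> * ((2 * e m / c\<^sup>2) * \<bar>A n \<omega>\<bar>)"
            by (intro mult_left_mono *) auto
          also have "\<dots> \<le> ?g \<omega>" using e(1)[of m] by (simp add: mult.assoc)
          finally show ?thesis .
        qed
      qed (use int in auto)
      also have "\<dots> = 2 / e m * expectation (\<lambda>\<omega>. \<bar>V n \<omega> - c\<bar>) + \<bar>t\<bar> * (2 * e m / c\<^sup>2) * expectation (\<lambda>\<omega>. \<bar>A n \<omega>\<bar>)"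
        using int by simp
      also have "\<dots> \<le> U m n"
        unfolding U_def using A(2)[OF n] e(1)[of m] by (intro add_left_mono mult_left_mono) auto
      finally show ?thesis .
    qed
    then show "eventually (\<lambda>n. d n \<le> U m n) sequentially"
      by (auto simp: eventually_sequentially)
  next
    have "e \<longlonglongrightarrow> 0"
      unfolding e_def using LIMSEQ_Suc[OF lim_const_over_n[of "c / 2"]] by simp
    then have "(\<lambda>m. 2 / e m * 0 + \<bar>t\<bar> * (2 * e m / c\<^sup>2) * C) \<longlonglongrightarrow> 0 + \<bar>t\<bar> * (2 * 0 / c\<^sup>2) * C"
      unfolding mult_zero_right using c by (intro tendsto_intros) auto
    then show "(\<lambda>m. 2 / e m * 0 + \<bar>t\<bar> * (2 * e m / c\<^sup>2) * C) \<longlonglongrightarrow> 0" by simp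
  qed (simp add: d_def)
  then have "(\<lambda>n. char (distr M borel (\<lambda>\<omega>. A n \<omega> / V n \<omega>)) t - char (distr M borel (\<lambda>\<omega>. A n \<omega> / c)) t) \<longlonglongrightarrow> 0"
    unfolding d_def by (rule tendsto_norm_zero_cancel)
  from tendsto_add[OF this lim] show ?thesis by simp
qed

subsection \<open>A central limit theorem for the kernel along an i.i.d. sequence\<close>

locale iid_sequence = prob_space M for M :: "'a measure" +
  fixes X :: "nat \<Rightarrow> 'a \<Rightarrow> 'v::euclidean_space" and \<mu> :: "'v measure"
  assumes indep: "indep_vars (\<lambda>_. borel) X UNIV"
    and distr_X: "\<And>i. distr M borel (X i) = \<mu>"
    and second_moment: "integrable \<mu> (\<lambda>x. (norm x)\<^sup>2)"
begin

lemma measurable_X [measurable]: "random_variable borel (X i)"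
  using indep by (auto simp: indep_vars_def)

sublocale law: square_integrable_law \<mu>
proof -
  have "prob_space \<mu>" "sets \<mu> = sets borel"
    unfolding distr_X[of 0, symmetric] by (auto intro: prob_space_distr)
  then show "square_integrable_law \<mu>"
    using second_moment by (simp add: square_integrable_law_def square_integrable_law_axioms_def)
qed

lemma distr_sequence:
  "distr M (PiM UNIV (\<lambda>_. borel)) (\<lambda>\<omega> i. X i \<omega>) = PiM UNIV (\<lambda>_. \<mu>)"
  using indep_vars_iff_distr_eq_PiM[where I = UNIV and M' = "\<lambda>_. borel" and X = X] indep
  by (simp add: distr_X restrict_UNIV)

lemma distr_reindex:
  assumes f: "inj_on f I"
  shows "distr M (PiM I (\<lambda>_. borel)) (\<lambda>\<omega>. \<lambda>i\<in>I. X (f i) \<omega>) = PiM I (\<lambda>_. \<mu>)"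
proof -
  have [measurable]: "(\<lambda>z. \<lambda>i\<in>I. z (f i)) \<in> measurable (PiM UNIV (\<lambda>_. borel)) (PiM I (\<lambda>_. borel :: 'v measure))"
    by measurable
  have [measurable]: "(\<lambda>\<omega> i. X i \<omega>) \<in> measurable M (PiM UNIV (\<lambda>_. borel))"
    using measurable_restrict[of UNIV X M "\<lambda>_. borel"] by (simp add: restrict_UNIV)
  have "PiM I (\<lambda>_. \<mu>) = distr (PiM UNIV (\<lambda>_. \<mu>)) (PiM I (\<lambda>_. \<mu>)) (\<lambda>z. \<lambda>i\<in>I. z (f i))"
    using f by (intro distr_PiM_reindex[symmetric] law.prob_space_axioms) auto
  also have "\<dots> = distr (PiM UNIV (\<lambda>_. \<mu>)) (PiM I (\<lambda>_. borel)) (\<lambda>z. \<lambda>i\<in>I. z (f i))"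
    by (intro distr_cong sets_PiM_cong) auto
  also have "\<dots> = distr M (PiM I (\<lambda>_. borel)) ((\<lambda>z. \<lambda>i\<in>I. z (f i)) \<circ> (\<lambda>\<omega> i. X i \<omega>))"
    unfolding distr_sequence[symmetric] by (rule distr_distr) measurable
  finally show ?thesis by (simp add: comp_def)
qed

lemma indep_rv_one_rest:
  assumes "i \<notin> J"
  shows "indep_rv M borel (X i) (PiM J (\<lambda>_. borel)) (\<lambda>\<omega>. restrict (\<lambda>j. X j \<omega>) J)"
proof -
  have "indep_rv M (PiM {i} (\<lambda>_. borel)) (\<lambda>\<omega>. restrict (\<lambda>j. X j \<omega>) {i}) (PiM J (\<lambda>_. borel)) (\<lambda>\<omega>. restrict (\<lambda>j. X j \<omega>) J)"
    using assms by (intro indep_rv_restrict[OF indep]) auto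
  then have "indep_rv M borel (\<lambda>\<omega>. (restrict (\<lambda>j. X j \<omega>) {i}) i) (PiM J (\<lambda>_. borel)) (\<lambda>\<omega>. restrict (\<lambda>j. X j \<omega>) J)"
    by (rule indep_rv_compose[where f = "\<lambda>z. z i"]) auto
  then show ?thesis by simp
qed

lemma distr_pair:
  assumes "i \<noteq> j"
  shows "distr M (borel \<Otimes>\<^sub>M borel) (\<lambda>\<omega>. (X i \<omega>, X j \<omega>)) = \<mu> \<Otimes>\<^sub>M \<mu>"
proof -
  have "indep_rv M borel (X i) borel (\<lambda>\<omega>. (restrict (\<lambda>j. X j \<omega>) {j}) j)"
    using assms
    by (intro indep_rv_compose[OF indep_rv_one_rest[of i "{j}"], where f = "\<lambda>x. x" and g = "\<lambda>z. z j"]) auto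
  then show ?thesis by (simp add: indep_rv_iff_distr distr_X)
qed

lemma expectation_X:
  fixes f :: "'v \<Rightarrow> real"
  assumes [measurable]: "f \<in> borel_measurable borel"
  shows "integrable M (\<lambda>\<omega>. f (X i \<omega>)) \<longleftrightarrow> integrable \<mu> f"
    "expectation (\<lambda>\<omega>. f (X i \<omega>)) = integral\<^sup>L \<mu> f"
  unfolding distr_X[of i, symmetric] by (simp_all add: integrable_distr_eq integral_distr)

lemma expectation_pair:
  fixes f :: "'v \<times> 'v \<Rightarrow> real"
  assumes "i \<noteq> j" and [measurable]: "f \<in> borel_measurable (borel \<Otimes>\<^sub>M borel)"
  shows "integrable M (\<lambda>\<omega>. f (X i \<omega>, X j \<omega>)) \<longleftrightarrow> integrable (\<mu> \<Otimes>\<^sub>M \<mu>) f"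
    "expectation (\<lambda>\<omega>. f (X i \<omega>, X j \<omega>)) = integral\<^sup>L (\<mu> \<Otimes>\<^sub>M \<mu>) f"
  unfolding distr_pair[OF assms(1), symmetric] by (simp_all add: integrable_distr_eq integral_distr)

text \<open>Independence of \<open>X i\<close> from the coordinates in \<open>J\<close> allows
  \<open>X i\<close> to be integrated out first, with the others frozen.\<close>

lemma expectation_fresh_eq_0:
  assumes i: "i \<notin> J" and [measurable]: "f \<in> borel_measurable (borel \<Otimes>\<^sub>M PiM J (\<lambda>_. borel))"
    and int: "integrable M (\<lambda>\<omega>. f (X i \<omega>, restrict (\<lambda>j. X j \<omega>) J))"
    and zero: "\<And>z. (LINT x|\<mu>. f (x, z)) = (0 :: real)"
  shows "expectation (\<lambda>\<omega>. f (X i \<omega>, restrict (\<lambda>j. X j \<omega>) J)) = 0"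
proof -
  let ?R = "\<lambda>\<omega>. restrict (\<lambda>j. X j \<omega>) J" and ?P = "PiM J (\<lambda>_. borel :: 'v measure)"
  have [measurable]: "?R \<in> measurable M ?P" by measurable
  interpret R: prob_space "distr M ?P ?R" by (rule prob_space_distr) measurable
  interpret Q: pair_sigma_finite \<mu> "distr M ?P ?R" by unfold_locales
  have eq: "distr M (borel \<Otimes>\<^sub>M ?P) (\<lambda>\<omega>. (X i \<omega>, ?R \<omega>)) = \<mu> \<Otimes>\<^sub>M distr M ?P ?R"
    using indep_rv_one_rest[OF i] by (simp add: indep_rv_iff_distr distr_X)
  have int': "integrable (\<mu> \<Otimes>\<^sub>M distr M ?P ?R) f"
    unfolding eq[symmetric] using int by (subst integrable_distr_eq) auto
  have "expectation (\<lambda>\<omega>. f (X i \<omega>, ?R \<omega>)) = (LINT p|(\<mu> \<Otimes>\<^sub>M distr M ?P ?R). f p)"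
    unfolding eq[symmetric] by (rule integral_distr[symmetric]) measurable
  also have "\<dots> = (LINT z|distr M ?P ?R. LINT x|\<mu>. f (x, z))"
    using Q.integral_snd[of "\<lambda>x z. f (x, z)"] int' by simp
  finally show ?thesis by (simp add: zero)
qed

section \<open>Orthogonality of the kernel variables\<close>

definition K :: "nat \<Rightarrow> nat \<Rightarrow> 'a \<Rightarrow> real" where "K i j \<omega> = law.kern (X i \<omega>) (X j \<omega>)"

lemma measurable_K [measurable]: "random_variable borel (K i j)"
  using measurable_compose[OF measurable_Pair[OF measurable_X[of i] measurable_X[of j]] law.measurable_kern]
  by (simp add: K_def[abs_def])

lemma K_commute: "K i j \<omega> = K j i \<omega>"
  by (simp add: K_def law.kern_commute)

lemma K_sq:
  assumes "i \<noteq> j"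
  shows "integrable M (\<lambda>\<omega>. (K i j \<omega>)\<^sup>2)" "expectation (\<lambda>\<omega>. (K i j \<omega>)\<^sup>2) = law.kern_var"
proof -
  have m: "(\<lambda>z. (law.kern (fst z) (snd z))\<^sup>2) \<in> borel_measurable (borel \<Otimes>\<^sub>M borel)"
    by measurable
  show "integrable M (\<lambda>\<omega>. (K i j \<omega>)\<^sup>2)" "expectation (\<lambda>\<omega>. (K i j \<omega>)\<^sup>2) = law.kern_var"
    using expectation_pair[OF assms m] law.integrable_kern_sq by (simp_all add: K_def law.kern_var_def)
qed

text \<open>With all other coordinates frozen, the second factor does not vary with
  \<open>X i\<close> and the first has mean zero by degeneracy. The index \<open>j\<close> may
  coincide with \<open>k\<close> or \<open>l\<close>, so even summands sharing a variable are
  uncorrelated.\<close>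

lemma K_orthogonal_fresh:
  assumes ij: "i \<noteq> j" and kl: "k \<noteq> l" and i: "i \<notin> {k, l}"
  shows "expectation (\<lambda>\<omega>. K i j \<omega> * K k l \<omega>) = 0"
proof -
  let ?J = "{j, k, l}" and ?f = "\<lambda>p. law.kern (fst p) (snd p j) * law.kern (snd p k) (snd p l)"
  have comp: "(\<lambda>p. law.kern (g p) (h p)) \<in> borel_measurable N"
    if "g \<in> borel_measurable N" "h \<in> borel_measurable N" for g h N
    using measurable_compose[OF measurable_Pair[OF that] law.measurable_kern] by simp
  have m: "?f \<in> borel_measurable (borel \<Otimes>\<^sub>M PiM ?J (\<lambda>_. borel))"
    by (intro borel_measurable_times comp) measurable
  have "integrable M (\<lambda>\<omega>. K i j \<omega> * K k l \<omega>)"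
    using ij kl by (intro integrable_mult_of_sq K_sq) measurable
  then have int: "integrable M (\<lambda>\<omega>. ?f (X i \<omega>, restrict (\<lambda>j. X j \<omega>) ?J))"
    by (simp add: K_def)
  have "expectation (\<lambda>\<omega>. ?f (X i \<omega>, restrict (\<lambda>j. X j \<omega>) ?J)) = 0"
    using ij i by (intro expectation_fresh_eq_0[OF _ m int]) auto
  then show ?thesis by (simp add: K_def)
qed

text \<open>Different increasing pairs are different two-element sets, so the first has an index
  outside the second; symmetry of the kernel moves that index to the front.\<close>

lemma K_orthogonal:
  assumes "i < j" "k < l" "(i, j) \<noteq> (k, l)"
  shows "expectation (\<lambda>\<omega>. K i j \<omega> * K k l \<omega>) = 0"
proof (cases "i \<in> {k, l}")
  case False
  then show ?thesis using assms by (intro K_orthogonal_fresh) auto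
next
  case True
  then have "j \<notin> {k, l}" using assms by auto
  then have "expectation (\<lambda>\<omega>. K j i \<omega> * K k l \<omega>) = 0"
    using assms by (intro K_orthogonal_fresh) auto
  then show ?thesis by (simp add: K_commute[of j i])
qed

lemma K_mean: "i \<noteq> j \<Longrightarrow> expectation (K i j) = 0"
proof -
  assume ij: "i \<noteq> j"
  have int: "integrable M (K i j)"
    using expectation_abs_le(1)[OF measurable_K K_sq(1)[OF ij] order_refl] .
  then have int': "integrable (\<mu> \<Otimes>\<^sub>M \<mu>) (\<lambda>z. law.kern (fst z) (snd z))"
    using expectation_pair(1)[OF ij law.measurable_kern] by (simp add: K_def[abs_def])
  have "expectation (K i j) = (LINT z|(\<mu> \<Otimes>\<^sub>M \<mu>). law.kern (fst z) (snd z))"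
    using expectation_pair(2)[OF ij law.measurable_kern] by (simp add: K_def[abs_def])
  also have "\<dots> = 0"
    using law.pair.integral_fst'[OF int'] by simp
  finally show ?thesis .
qed

lemma sum_K_sq:
  assumes "\<And>p. p \<in> I \<Longrightarrow> fst p < snd p"
  shows "integrable M (\<lambda>\<omega>. (\<Sum>p\<in>I. K (fst p) (snd p) \<omega>)\<^sup>2)"
    "expectation (\<lambda>\<omega>. (\<Sum>p\<in>I. K (fst p) (snd p) \<omega>)\<^sup>2) = real (card I) * law.kern_var"
proof -
  have neq: "p \<in> I \<Longrightarrow> fst p \<noteq> snd p" for p using assms[of p] by auto
  have orth: "expectation (\<lambda>\<omega>. K (fst p) (snd p) \<omega> * K (fst q) (snd q) \<omega>) = 0" if "p \<in> I" "q \<in> I" "p \<noteq> q" for p q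
    using that assms by (intro K_orthogonal) (auto simp: prod_eq_iff)
  show "integrable M (\<lambda>\<omega>. (\<Sum>p\<in>I. K (fst p) (snd p) \<omega>)\<^sup>2)"
    using neq orth by (intro expectation_sum_sq_orthogonal(1) K_sq) auto
  have "expectation (\<lambda>\<omega>. (\<Sum>p\<in>I. K (fst p) (snd p) \<omega>)\<^sup>2) = (\<Sum>p\<in>I. expectation (\<lambda>\<omega>. (K (fst p) (snd p) \<omega>)\<^sup>2))"
    using neq orth by (intro expectation_sum_sq_orthogonal(2) K_sq) auto
  also have "\<dots> = (\<Sum>p\<in>I. law.kern_var)"
    using neq by (intro sum.cong K_sq) auto
  finally show "expectation (\<lambda>\<omega>. (\<Sum>p\<in>I. K (fst p) (snd p) \<omega>)\<^sup>2) = real (card I) * law.kern_var"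
    by simp
qed

lemma sum_K_Suc_sq:
  "integrable M (\<lambda>\<omega>. (\<Sum>i\<in>J. K i (Suc i) \<omega>)\<^sup>2)"
  "expectation (\<lambda>\<omega>. (\<Sum>i\<in>J. K i (Suc i) \<omega>)\<^sup>2) = real (card J) * law.kern_var"
proof -
  have inj: "inj_on (\<lambda>i. (i, Suc i)) J" by (auto intro: inj_onI)
  have lt: "fst p < snd p" if "p \<in> (\<lambda>i. (i, Suc i)) ` J" for p
    using that by auto
  show "integrable M (\<lambda>\<omega>. (\<Sum>i\<in>J. K i (Suc i) \<omega>)\<^sup>2)"
  "expectation (\<lambda>\<omega>. (\<Sum>i\<in>J. K i (Suc i) \<omega>)\<^sup>2) = real (card J) * law.kern_var"
    using sum_K_sq[of "(\<lambda>i. (i, Suc i)) ` J", OF lt] inj by (simp_all add: sum.reindex card_image)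
qed

section \<open>Independent blocks and the central limit theorem\<close>

text \<open>Block \<open>k\<close> has \<open>m\<close> consecutive summands and uses the
  \<open>m + 1\<close> variables with indices from \<open>k * Suc m\<close> to
  \<open>k * Suc m + m\<close>. The summand linking the last of these to the next block is left
  out.\<close>

definition block :: "nat \<Rightarrow> nat \<Rightarrow> 'a \<Rightarrow> real" where
  "block m k \<omega> = (\<Sum>j<m. K (k * Suc m + j) (Suc (k * Suc m + j)) \<omega>)"

lemma measurable_block [measurable]: "random_variable borel (block m k)"
  unfolding block_def[abs_def] by (intro borel_measurable_sum measurable_K)

lemma block_sq:
  "integrable M (\<lambda>\<omega>. (block m k \<omega>)\<^sup>2)" "expectation (\<lambda>\<omega>. (block m k \<omega>)\<^sup>2) = real m * law.kern_var"
proof -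
  have inj: "inj_on (\<lambda>j. k * Suc m + j) {..<m}" by (auto intro: inj_onI)
  have eq: "block m k \<omega> = (\<Sum>i\<in>(\<lambda>j. k * Suc m + j) ` {..<m}. K i (Suc i) \<omega>)" for \<omega>
    unfolding block_def using inj by (simp add: sum.reindex)
  show "integrable M (\<lambda>\<omega>. (block m k \<omega>)\<^sup>2)" "expectation (\<lambda>\<omega>. (block m k \<omega>)\<^sup>2) = real m * law.kern_var"
    unfolding eq using sum_K_Suc_sq[of "(\<lambda>j. k * Suc m + j) ` {..<m}"] inj by (simp_all add: card_image)
qed

lemma block_mean: "expectation (block m k) = 0"
proof -
  have "integrable M (K i (Suc i))" for i
    using expectation_abs_le(1)[OF measurable_K K_sq(1)[of i "Suc i"] order_refl] by simp
  then show ?thesis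
    by (simp add: block_def[abs_def] Bochner_Integration.integral_sum K_mean)
qed

lemma measurable_kern_sum:
  assumes "\<And>j. j < m \<Longrightarrow> f j \<in> I \<and> g j \<in> I"
  shows "(\<lambda>z. \<Sum>j<m. law.kern (z (f j)) (z (g j))) \<in> borel_measurable (PiM I (\<lambda>_. borel))"
proof (intro borel_measurable_sum)
  fix j assume "j \<in> {..<m}"
  then have [measurable]: "(\<lambda>z. z (f j)) \<in> borel_measurable (PiM I (\<lambda>_. borel :: 'v measure))"
     "(\<lambda>z. z (g j)) \<in> borel_measurable (PiM I (\<lambda>_. borel :: 'v measure))"
    using assms by auto
  show "(\<lambda>z. law.kern (z (f j)) (z (g j))) \<in> borel_measurable (PiM I (\<lambda>_. borel))"
    using measurable_compose[OF measurable_Pair law.measurable_kern, of "\<lambda>z. z (f j)" _ "\<lambda>z. z (g j)"] by simp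
qed

text \<open>The right side is free of \<open>k\<close>, which gives the identical distribution
  required by the central limit theorem.\<close>

lemma distr_block: "distr M borel (block m k) = distr (PiM {..m} (\<lambda>_. \<mu>)) borel (\<lambda>z. \<Sum>j<m. law.kern (z j) (z (Suc j)))"
proof -
  let ?h = "\<lambda>z. \<Sum>j<m. law.kern (z j) (z (Suc j))" and ?f = "\<lambda>j. k * Suc m + j"
  have h [measurable]: "?h \<in> borel_measurable (PiM {..m} (\<lambda>_. borel))"
    by (intro measurable_kern_sum) auto
  have inj: "inj_on ?f {..m}" by (auto intro: inj_onI)
  have "distr (PiM {..m} (\<lambda>_. \<mu>)) borel ?h = distr M borel (?h \<circ> (\<lambda>\<omega>. \<lambda>i\<in>{..m}. X (?f i) \<omega>))"
    unfolding distr_reindex[OF inj, symmetric] by (rule distr_distr) measurable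
  also have "?h \<circ> (\<lambda>\<omega>. \<lambda>i\<in>{..m}. X (?f i) \<omega>) = block m k"
    by (auto simp: fun_eq_iff block_def K_def)
  finally show ?thesis ..
qed

text \<open>Distinct blocks use disjoint sets of variables: division by \<open>Suc m\<close>
  recovers the block number from an index.\<close>

lemma indep_blocks: "indep_vars (\<lambda>_. borel) (block m) UNIV"
proof -
  let ?I = "\<lambda>k. {k * Suc m..k * Suc m + m}"
  let ?h = "\<lambda>k z. \<Sum>j<m. law.kern (z (k * Suc m + j)) (z (Suc (k * Suc m + j)))"
  have disj: "disjoint_family ?I"
  proof -
    have "i = j" if "x \<in> ?I i" "x \<in> ?I j" for x i j
    proof -
      have "x div Suc m = i" if "x \<in> ?I i" for i
        using that by (intro div_nat_eqI) (auto simp: algebra_simps)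
      then show ?thesis using that by metis
    qed
    then show ?thesis unfolding disjoint_family_on_def by blast
  qed
  have "indep_vars (\<lambda>k. PiM (?I k) (\<lambda>_. borel)) (\<lambda>k \<omega>. restrict (\<lambda>i. X i \<omega>) (?I k)) UNIV"
    using disj by (intro indep_vars_restrict[OF indep]) auto
  then have "indep_vars (\<lambda>_. borel) (\<lambda>k \<omega>. ?h k (restrict (\<lambda>i. X i \<omega>) (?I k))) UNIV"
    by (rule indep_vars_compose2) (intro measurable_kern_sum, auto)
  also have "(\<lambda>k \<omega>. ?h k (restrict (\<lambda>i. X i \<omega>) (?I k))) = block m"
    by (auto simp: fun_eq_iff block_def K_def)
  finally show ?thesis .
qed

lemma char_block_sum:
  assumes pos: "law.kern_var > 0" and m: "m > 0"
  shows "(\<lambda>N. char (distr M borel (\<lambda>\<omega>. (\<Sum>k<N. block m k \<omega>) / sqrt (real N * (real m * law.kern_var)))) t)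
    \<longlonglongrightarrow> of_real (exp (- (t\<^sup>2) / 2))"
proof -
  let ?s = "sqrt (real m * law.kern_var)"
  have s: "?s > 0" "?s\<^sup>2 = real m * law.kern_var" using pos m by auto
  have "weak_conv_m (\<lambda>N. distr M borel (\<lambda>\<omega>. (\<Sum>k<N. block m k \<omega>) / sqrt (real N * ?s\<^sup>2))) std_normal_distribution"
  proof (rule central_limit_theorem_zero_mean)
    show "variance (block m k) = ?s\<^sup>2" for k
      unfolding s(2) by (simp add: block_mean block_sq)
  qed (use s in \<open>auto simp: indep_blocks block_mean block_sq distr_block\<close>)
  then have "(\<lambda>N. char (distr M borel (\<lambda>\<omega>. (\<Sum>k<N. block m k \<omega>) / sqrt (real N * ?s\<^sup>2))) t) \<longlonglongrightarrow> char std_normal_distribution t"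
    by (intro levy_continuity1 real_dist_normal_dist real_distribution_distr) auto
  then show ?thesis
    unfolding s(2) by (simp add: char_std_normal_distribution)
qed

lemma sum_blocks:
  fixes n m :: nat
  assumes "n \<ge> 1"
  shows "\<exists>J. J \<subseteq> {..<n - 1} \<and> card J = n div Suc m * m \<and>
    (\<forall>\<omega>. (\<Sum>k<n div Suc m. block m k \<omega>) = (\<Sum>i\<in>J. K i (Suc i) \<omega>))"
proof -
  define N where N: "N = n div Suc m"
  let ?f = "\<lambda>(k, j). k * Suc m + j"
  let ?J = "?f ` ({..<N} \<times> {..<m})"
  have inj: "inj_on ?f ({..<N} \<times> {..<m})"
  proof (rule inj_onI)
    fix p q assume *: "p \<in> {..<N} \<times> {..<m}" "q \<in> {..<N} \<times> {..<m}" "?f p = ?f q"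
    have "?f p div Suc m = fst p" "?f q div Suc m = fst q"
      using *(1,2) by (auto intro!: div_nat_eqI simp: algebra_simps)
    then have "fst p = fst q" using *(3) by metis
    then show "p = q" using *(3) by (simp add: split_def prod_eq_iff)
  qed
  have "?J \<subseteq> {..<n - 1}"
  proof (rule image_subsetI)
    fix p assume p: "p \<in> {..<N} \<times> {..<m}"
    \<comment> \<open>The last kept summand of a complete block lies two places before the next
      multiple of \<open>Suc m\<close>, so its index is at most \<open>n - 2\<close>, as membership
      in \<open>{..<n - 1}\<close> demands.\<close>
    have "Suc (fst p) * Suc m \<le> N * Suc m" using p by (intro mult_right_mono) auto
    also have "\<dots> \<le> n" unfolding N by (rule div_times_less_eq_dividend)
    finally show "?f p \<in> {..<n - 1}" using p by auto
  qed
  moreover have "card ?J = N * m" using inj by (simp add: card_image)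
  moreover have "(\<Sum>k<N. block m k \<omega>) = (\<Sum>i\<in>?J. K i (Suc i) \<omega>)" for \<omega>
    using inj by (simp add: sum.reindex block_def sum.cartesian_product split_def)
  ultimately show ?thesis unfolding N by blast
qed

lemma n_div_over_n_tendsto: "(\<lambda>n. real (n div Suc m) / real n) \<longlonglongrightarrow> 1 / real (Suc m)"
proof (rule real_tendsto_sandwich)
  show "eventually (\<lambda>n. 1 / real (Suc m) - 1 / real n \<le> real (n div Suc m) / real n) sequentially"
    using eventually_gt_at_top[of 0]
  proof eventually_elim
    case (elim n)
    have "n < (n div Suc m + 1) * Suc m"
      using dividend_less_div_times[of "Suc m" n] by (simp add: algebra_simps)
    then have "real n < real ((n div Suc m + 1) * Suc m)" by (simp only: of_nat_less_iff)
    then have "real n \<le> (real (n div Suc m) + 1) * real (Suc m)" by (simp add: algebra_simps)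
    then have "real n / real (Suc m) - 1 \<le> real (n div Suc m)"
      by (simp add: diff_le_eq pos_divide_le_eq)
    then have "(real n / real (Suc m) - 1) / real n \<le> real (n div Suc m) / real n"
      by (rule divide_right_mono) simp
    then show ?case using elim by (simp add: diff_divide_distrib)
  qed
  show "eventually (\<lambda>n. real (n div Suc m) / real n \<le> 1 / real (Suc m)) sequentially"
    using eventually_gt_at_top[of 0]
  proof eventually_elim
    case (elim n)
    have "n div Suc m * Suc m \<le> n" by (rule div_times_less_eq_dividend)
    then have "real (n div Suc m * Suc m) \<le> real n" by (simp only: of_nat_le_iff)
    then have "real (n div Suc m) * real (Suc m) \<le> real n" by (simp only: of_nat_mult)
    then show ?case using elim by (simp add: field_simps)
  qed
  show "(\<lambda>n. 1 / real (Suc m) - 1 / real n) \<longlonglongrightarrow> 1 / real (Suc m)"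
    using tendsto_diff[OF tendsto_const lim_const_over_n[of 1], of "1 / real (Suc m)"] by simp
qed simp

text \<open>Dropping every \<open>(m + 1)\<close>-st summand leaves independent blocks; the dropped part has
  variance about \<open>n / (m + 1)\<close> by orthogonality.\<close>
lemma char_sum_K:
  assumes pos: "law.kern_var > 0"
  shows "(\<lambda>n. char (distr M borel (\<lambda>\<omega>. (\<Sum>i<n - 1. K i (Suc i) \<omega>) / sqrt (real n))) t)
    \<longlonglongrightarrow> of_real (exp (- (t\<^sup>2 * law.kern_var) / 2))"
proof -
  let ?v = "law.kern_var"
  define W where "W n \<omega> = (\<Sum>i<n - 1. K i (Suc i) \<omega>) / sqrt (real n)" for n \<omega>
  define Z where "Z m N \<omega> = (\<Sum>k<N. block m k \<omega>) / sqrt (real N * (real m * ?v))" for m N \<omega>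
  \<comment> \<open>The limiting standard deviation of the kept part: out of every
    \<open>m + 1\<close> summands, \<open>m\<close> remain.\<close>
  define c where "c m = sqrt (?v * (real m / real (Suc m)))" for m
  have [measurable]: "random_variable borel (W n)" "random_variable borel (Z m N)" for n m N
    unfolding W_def[abs_def] Z_def[abs_def] by measurable
  have approx: "expectation (\<lambda>\<omega>. \<bar>W n \<omega> - c m * Z m (n div Suc m) \<omega>\<bar>)
        \<le> sqrt (?v * (1 - real m * (real (n div Suc m) / real n))) + \<bar>sqrt (?v * (real m * (real (n div Suc m) / real n))) - c m\<bar>" (is ?approx)
      and int: "integrable M (\<lambda>\<omega>. W n \<omega> - c m * Z m (n div Suc m) \<omega>)" (is ?int)
    if n: "n \<ge> 1" and m: "m \<ge> 1" for n m
  proof -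
    let ?N = "n div Suc m"
    obtain J where J: "J \<subseteq> {..<n - 1}" "card J = ?N * m" "\<And>\<omega>. (\<Sum>k<?N. block m k \<omega>) = (\<Sum>i\<in>J. K i (Suc i) \<omega>)"
      using sum_blocks[OF n] by metis
    define R where "R \<omega> = (\<Sum>i\<in>{..<n - 1} - J. K i (Suc i) \<omega>)" for \<omega>
    have cardR: "card ({..<n - 1} - J) = n - 1 - ?N * m" "?N * m \<le> n - 1"
      using J card_mono[OF finite_lessThan J(1)] by (auto simp: card_Diff_subset finite_subset)
    have [measurable]: "random_variable borel R" unfolding R_def by measurable
    have R_sq: "integrable M (\<lambda>\<omega>. (R \<omega>)\<^sup>2)" "expectation (\<lambda>\<omega>. (R \<omega>)\<^sup>2) \<le> (real n - real ?N * real m) * ?v"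
    proof -
      show "integrable M (\<lambda>\<omega>. (R \<omega>)\<^sup>2)" unfolding R_def by (rule sum_K_Suc_sq)
      have "expectation (\<lambda>\<omega>. (R \<omega>)\<^sup>2) = real (n - 1 - ?N * m) * ?v"
        unfolding R_def sum_K_Suc_sq cardR ..
      also have "\<dots> \<le> real (n - ?N * m) * ?v" using pos by (intro mult_right_mono) auto
      also have "real (n - ?N * m) = real n - real ?N * real m" using cardR(2) by (simp add: of_nat_diff)
      finally show "expectation (\<lambda>\<omega>. (R \<omega>)\<^sup>2) \<le> (real n - real ?N * real m) * ?v" .
    qed
    have Z_sq: "integrable M (\<lambda>\<omega>. (Z m ?N \<omega>)\<^sup>2)" "expectation (\<lambda>\<omega>. (Z m ?N \<omega>)\<^sup>2) \<le> 1"
      using sum_K_Suc_sq[of J] J(2) pos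
      by (auto simp: Z_def J(3) power_divide divide_le_eq mult.assoc)
    note R1 = expectation_abs_le[OF _ R_sq, simplified]
    note Z1 = expectation_abs_le[OF _ Z_sq, simplified]
    \<comment> \<open>The kept part is standardised as \<open>Z\<close>. Its exact scale for
      \<open>n div Suc m\<close> blocks differs from the limit \<open>c m\<close>, and this
      difference is the \<open>e\<close> below.\<close>
    have W_eq: "W n \<omega> = R \<omega> / sqrt (real n) + sqrt (?v * (real m * (real ?N / real n))) * Z m ?N \<omega>" for \<omega>
    proof -
      have "(\<Sum>i<n - 1. K i (Suc i) \<omega>) = R \<omega> + (\<Sum>i\<in>J. K i (Suc i) \<omega>)"
        unfolding R_def using J(1) by (intro sum.subset_diff) auto
      \<comment> \<open>Without a complete block both sides are 0, since \<open>Z\<close> is then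
        \<open>0 / 0 = 0\<close>.\<close>
      also have "(\<Sum>i\<in>J. K i (Suc i) \<omega>) = sqrt (real ?N * (real m * ?v)) * Z m ?N \<omega>"
        using pos m by (cases "?N = 0") (auto simp: Z_def J(3)[symmetric])
      also have "sqrt (real ?N * (real m * ?v)) = sqrt (real n) * sqrt (?v * (real m * (real ?N / real n)))"
        using n by (simp add: real_sqrt_mult[symmetric])
      finally show ?thesis
        using n by (simp add: W_def add_divide_distrib)
    qed
    define e where "e = sqrt (?v * (real m * (real ?N / real n))) - c m"
    have diff: "W n \<omega> - c m * Z m ?N \<omega> = R \<omega> / sqrt (real n) + e * Z m ?N \<omega>" for \<omega>
      unfolding W_eq e_def by (simp add: algebra_simps)
    show ?int unfolding diff using R1 Z1 by auto
    have "expectation (\<lambda>\<omega>. \<bar>W n \<omega> - c m * Z m ?N \<omega>\<bar>) \<le> expectation (\<lambda>\<omega>. \<bar>R \<omega>\<bar> / sqrt (real n) + \<bar>e\<bar> * \<bar>Z m ?N \<omega>\<bar>)"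
      unfolding diff using R1 Z1
      by (intro integral_mono) (auto intro!: order_trans[OF abs_triangle_ineq] simp: abs_mult)
    also have "\<dots> = expectation (\<lambda>\<omega>. \<bar>R \<omega>\<bar>) / sqrt (real n) + \<bar>e\<bar> * expectation (\<lambda>\<omega>. \<bar>Z m ?N \<omega>\<bar>)"
      using R1 Z1 by simp
    also have "\<dots> \<le> sqrt ((real n - real ?N * real m) * ?v) / sqrt (real n) + \<bar>e\<bar> * 1"
      using R1 Z1 by (intro add_mono divide_right_mono mult_left_mono) auto
    also have "sqrt ((real n - real ?N * real m) * ?v) / sqrt (real n) = sqrt (?v * (1 - real m * (real ?N / real n)))"
      using n by (simp add: real_sqrt_divide[symmetric] field_simps)
    finally show ?approx by (simp add: e_def)
  qed
  define d where "d n = cmod (char (distr M borel (W n)) t - of_real (exp (- (t\<^sup>2 * ?v) / 2)))" for n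
  \<comment> \<open>Three errors: dropping summands and rescaling, the central limit theorem at
    fixed block length, and the gap between the two Gaussian limits. As \<open>n\<close> grows the
    second vanishes, and what remains of the others depends on \<open>m\<close> alone.\<close>
  define U where "U m n = \<bar>t\<bar> * (sqrt (?v * (1 - real m * (real (n div Suc m) / real n)))
        + \<bar>sqrt (?v * (real m * (real (n div Suc m) / real n))) - c m\<bar>)
      + cmod (char (distr M borel (Z m (n div Suc m))) (c m * t) - of_real (exp (- ((c m * t)\<^sup>2) / 2)))
      + \<bar>exp (- ((c m * t)\<^sup>2) / 2) - exp (- (t\<^sup>2 * ?v) / 2)\<bar>" for m n
  have "d \<longlonglongrightarrow> 0"
  proof (rule tendsto_0_approximation)
    fix m0 :: nat
    \<comment> \<open>The shift excludes empty blocks, whose variance is 0.\<close>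
    define m where "m = Suc m0"
    then have m: "m \<ge> 1" by simp
    have "d n \<le> U m n" if n: "n \<ge> 1" for n
    proof -
      let ?N = "n div Suc m"
      have scale: "char (distr M borel (\<lambda>\<omega>. c m * Z m ?N \<omega>)) t = char (distr M borel (Z m ?N)) (c m * t)"
        by (simp add: char_distr ac_simps)
      have "d n \<le> cmod (char (distr M borel (W n)) t - char (distr M borel (\<lambda>\<omega>. c m * Z m ?N \<omega>)) t)
          + cmod (char (distr M borel (\<lambda>\<omega>. c m * Z m ?N \<omega>)) t - of_real (exp (- ((c m * t)\<^sup>2) / 2)))
          + cmod (complex_of_real (exp (- ((c m * t)\<^sup>2) / 2)) - of_real (exp (- (t\<^sup>2 * ?v) / 2)))"
        unfolding d_def by norm
      moreover have "cmod (char (distr M borel (W n)) t - char (distr M borel (\<lambda>\<omega>. c m * Z m ?N \<omega>)) t)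
          \<le> \<bar>t\<bar> * expectation (\<lambda>\<omega>. \<bar>W n \<omega> - c m * Z m ?N \<omega>\<bar>)"
        by (intro cmod_char_diff_le_L1 int n m) measurable
      moreover have "\<bar>t\<bar> * expectation (\<lambda>\<omega>. \<bar>W n \<omega> - c m * Z m ?N \<omega>\<bar>)
          \<le> \<bar>t\<bar> * (sqrt (?v * (1 - real m * (real ?N / real n))) + \<bar>sqrt (?v * (real m * (real ?N / real n))) - c m\<bar>)"
        by (intro mult_left_mono approx n m) auto
      moreover have "cmod (complex_of_real (exp (- ((c m * t)\<^sup>2) / 2)) - of_real (exp (- (t\<^sup>2 * ?v) / 2)))
          = \<bar>exp (- ((c m * t)\<^sup>2) / 2) - exp (- (t\<^sup>2 * ?v) / 2)\<bar>"
        unfolding of_real_diff[symmetric] norm_of_real ..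
      ultimately show ?thesis
        unfolding U_def scale by linarith
    qed
    then show "eventually (\<lambda>n. d n \<le> U (Suc m0) n) sequentially"
      unfolding m_def by (auto simp: eventually_sequentially)
    have N: "filterlim (\<lambda>n. n div Suc m) at_top sequentially"
      unfolding filterlim_at_top
    proof
      fix k
      have "\<forall>n\<ge>k * Suc m. k \<le> n div Suc m"
        by (auto simp: less_eq_div_iff_mult_less_eq)
      then show "eventually (\<lambda>n. k \<le> n div Suc m) sequentially"
        unfolding eventually_sequentially by blast
    qed
    have Z: "(\<lambda>n. cmod (char (distr M borel (Z m (n div Suc m))) (c m * t) - of_real (exp (- ((c m * t)\<^sup>2) / 2)))) \<longlonglongrightarrow> 0"
    proof -
      have "(\<lambda>N. char (distr M borel (Z m N)) (c m * t)) \<longlonglongrightarrow> of_real (exp (- ((c m * t)\<^sup>2) / 2))"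
        using char_block_sum[OF pos, of m "c m * t"] m by (simp add: Z_def[abs_def])
      from filterlim_compose[OF this N] show ?thesis
        by (intro tendsto_norm_zero LIM_zero)
    qed
    have "U m \<longlonglongrightarrow> \<bar>t\<bar> * (sqrt (?v * (1 - real m * (1 / real (Suc m)))) + \<bar>sqrt (?v * (real m * (1 / real (Suc m)))) - c m\<bar>)
       + 0 + \<bar>exp (- ((c m * t)\<^sup>2) / 2) - exp (- (t\<^sup>2 * ?v) / 2)\<bar>"
      unfolding U_def by (intro tendsto_intros Z n_div_over_n_tendsto)
    then show "U (Suc m0) \<longlonglongrightarrow> \<bar>t\<bar> * (sqrt (?v * (1 - real (Suc m0) * (1 / real (Suc (Suc m0)))))) +
         \<bar>exp (- ((c (Suc m0) * t)\<^sup>2) / 2) - exp (- (t\<^sup>2 * ?v) / 2)\<bar>"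
      by (simp add: c_def m_def)
  next
    have r: "(\<lambda>m. real (Suc m) * (1 / real (Suc (Suc m)))) \<longlonglongrightarrow> 1"
      by real_asymp
    have c: "(\<lambda>m. c (Suc m)) \<longlonglongrightarrow> sqrt (?v * 1)"
      unfolding c_def using r by (intro tendsto_intros) simp
    have "(\<lambda>m. \<bar>t\<bar> * (sqrt (?v * (1 - real (Suc m) * (1 / real (Suc (Suc m)))))) +
         \<bar>exp (- ((c (Suc m) * t)\<^sup>2) / 2) - exp (- (t\<^sup>2 * ?v) / 2)\<bar>)
      \<longlonglongrightarrow> \<bar>t\<bar> * sqrt (?v * (1 - 1)) + \<bar>exp (- ((sqrt (?v * 1) * t)\<^sup>2) / 2) - exp (- (t\<^sup>2 * ?v) / 2)\<bar>"
      by (intro tendsto_intros r c) auto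
    moreover have "(sqrt (?v * 1) * t)\<^sup>2 = t\<^sup>2 * ?v"
      using pos by (simp add: power_mult_distrib)
    ultimately show "(\<lambda>m. \<bar>t\<bar> * (sqrt (?v * (1 - real (Suc m) * (1 / real (Suc (Suc m)))))) +
         \<bar>exp (- ((c (Suc m) * t)\<^sup>2) / 2) - exp (- (t\<^sup>2 * ?v) / 2)\<bar>) \<longlonglongrightarrow> 0"
      by simp
  qed (simp add: d_def)
  then have "(\<lambda>n. char (distr M borel (W n)) t - of_real (exp (- (t\<^sup>2 * ?v) / 2))) \<longlonglongrightarrow> 0"
    unfolding d_def by (rule tendsto_norm_zero_cancel)
  then show ?thesis
    unfolding W_def[abs_def] by (rule LIM_zero_cancel)
qed

end

subsection \<open>The sorting permutation\<close>

text \<open>On measurable boxes the joint probability factors first over \<open>i\<close>, by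
  independence of the pairs, and then inside each pair; regrouping gives the product of the two box
  probabilities. Boxes form an intersection-stable generator, which extends this to the product
  sigma-algebras.\<close>

lemma (in prob_space) indep_rv_PiM:
  fixes X :: "'i \<Rightarrow> 'a \<Rightarrow> 'b" and Y :: "'i \<Rightarrow> 'a \<Rightarrow> 'c"
  assumes I: "finite I" "I \<noteq> {}"
    and ind: "indep_vars (\<lambda>_. S \<Otimes>\<^sub>M T) (\<lambda>i \<omega>. (X i \<omega>, Y i \<omega>)) I"
    and XY: "\<And>i. i \<in> I \<Longrightarrow> indep_rv M S (X i) T (Y i)"
  shows "indep_rv M (PiM I (\<lambda>_. S)) (\<lambda>\<omega>. \<lambda>i\<in>I. X i \<omega>) (PiM I (\<lambda>_. T)) (\<lambda>\<omega>. \<lambda>i\<in>I. Y i \<omega>)"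
proof -
  let ?X = "\<lambda>\<omega>. \<lambda>i\<in>I. X i \<omega>" and ?Y = "\<lambda>\<omega>. \<lambda>i\<in>I. Y i \<omega>"
  have X [measurable]: "i \<in> I \<Longrightarrow> random_variable S (X i)" and Y [measurable]: "i \<in> I \<Longrightarrow> random_variable T (Y i)" for i
    using XY by (auto simp: indep_rv_def)
  have Xm: "random_variable (PiM I (\<lambda>_. S)) ?X" and Ym: "random_variable (PiM I (\<lambda>_. T)) ?Y"
    by (intro measurable_restrict X Y; assumption)+
  have indX: "indep_vars (\<lambda>_. S) X I" and indY: "indep_vars (\<lambda>_. T) Y I"
    using indep_vars_compose2[OF ind, of "\<lambda>_. fst" "\<lambda>_. S"] indep_vars_compose2[OF ind, of "\<lambda>_. snd" "\<lambda>_. T"] by simp_all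
  have stable: "Int_stable {h -` A \<inter> space M |A. A \<in> G}" if "Int_stable G" for h :: "'a \<Rightarrow> 'z" and G
  proof (rule Int_stableI)
    fix a b assume "a \<in> {h -` A \<inter> space M |A. A \<in> G}" "b \<in> {h -` A \<inter> space M |A. A \<in> G}"
    then obtain A B where "A \<in> G" "B \<in> G" "a = h -` A \<inter> space M" "b = h -` B \<inter> space M" by auto
    then show "a \<inter> b \<in> {h -` A \<inter> space M |A. A \<in> G}"
      using Int_stableD[OF that] by (auto intro!: exI[of _ "A \<inter> B"])
  qed
  let ?GX = "{?X -` A \<inter> space M |A. A \<in> prod_algebra I (\<lambda>_. S)}"
  let ?GY = "{?Y -` A \<inter> space M |A. A \<in> prod_algebra I (\<lambda>_. T)}"
  have box: "\<exists>F\<in>I \<rightarrow> sets R. (\<lambda>\<omega>. \<lambda>i\<in>I. Z i \<omega>) -` A \<inter> space M = (\<Inter>i\<in>I. Z i -` F i \<inter> space M)"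
    if "A \<in> prod_algebra I (\<lambda>_. R)" for A R and Z :: "'i \<Rightarrow> 'a \<Rightarrow> 'z"
  proof -
    have "A \<in> {Pi\<^sub>E I F |F. F \<in> (\<Pi> j\<in>I. sets R)}"
      using that by (simp only: prod_algebra_eq_finite[OF I(1)])
    then obtain F where "A = Pi\<^sub>E I F" "F \<in> I \<rightarrow> sets R"
      by (elim CollectE exE conjE)
    then show ?thesis using I(2) by (intro bexI[of _ F]) (auto simp: PiE_iff)
  qed
  have "indep_set ?GX ?GY"
  proof (rule indep_setI)
    show "?GX \<subseteq> events" "?GY \<subseteq> events"
      using measurable_sets[OF Xm, unfolded sets_PiM, OF sigma_sets.Basic]
        measurable_sets[OF Ym, unfolded sets_PiM, OF sigma_sets.Basic] by blast+
    fix a b assume a: "a \<in> ?GX" and b: "b \<in> ?GY"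
    obtain A where A: "A \<in> prod_algebra I (\<lambda>_. S)" "a = ?X -` A \<inter> space M" using a by blast
    obtain F where F: "F \<in> I \<rightarrow> sets S" "a = (\<Inter>i\<in>I. X i -` F i \<inter> space M)"
      using box[OF A(1), of X] unfolding A(2) by (elim bexE)
    obtain B where B: "B \<in> prod_algebra I (\<lambda>_. T)" "b = ?Y -` B \<inter> space M" using b by blast
    obtain G where G: "G \<in> I \<rightarrow> sets T" "b = (\<Inter>i\<in>I. Y i -` G i \<inter> space M)"
      using box[OF B(1), of Y] unfolding B(2) by (elim bexE)
    have "a \<inter> b = (\<Inter>i\<in>I. (\<lambda>\<omega>. (X i \<omega>, Y i \<omega>)) -` (F i \<times> G i) \<inter> space M)"
      unfolding F G using I(2) by auto
    also have "prob \<dots> = (\<Prod>i\<in>I. prob ((\<lambda>\<omega>. (X i \<omega>, Y i \<omega>)) -` (F i \<times> G i) \<inter> space M))"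
      using I F G by (intro indep_varsD_finite[OF ind]) auto
    also have "\<dots> = (\<Prod>i\<in>I. prob (X i -` F i \<inter> space M) * prob (Y i -` G i \<inter> space M))"
    proof (intro prod.cong refl)
      fix i assume i: "i \<in> I"
      have "prob ((X i -` F i \<inter> space M) \<inter> (Y i -` G i \<inter> space M)) = prob (X i -` F i \<inter> space M) * prob (Y i -` G i \<inter> space M)"
        using i F G by (intro indep_setD[OF XY[OF i, unfolded indep_rv_def, THEN conjunct2, THEN conjunct2]]) auto
      also have "(X i -` F i \<inter> space M) \<inter> (Y i -` G i \<inter> space M) = (\<lambda>\<omega>. (X i \<omega>, Y i \<omega>)) -` (F i \<times> G i) \<inter> space M"
        by auto
      finally show "prob ((\<lambda>\<omega>. (X i \<omega>, Y i \<omega>)) -` (F i \<times> G i) \<inter> space M) = prob (X i -` F i \<inter> space M) * prob (Y i -` G i \<inter> space M)" .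
    qed
    also have "\<dots> = (\<Prod>i\<in>I. prob (X i -` F i \<inter> space M)) * (\<Prod>i\<in>I. prob (Y i -` G i \<inter> space M))"
      by (rule prod.distrib)
    also have "(\<Prod>i\<in>I. prob (X i -` F i \<inter> space M)) = prob a"
      unfolding F(2) using I F by (intro indep_varsD_finite[OF indX, symmetric]) auto
    also have "(\<Prod>i\<in>I. prob (Y i -` G i \<inter> space M)) = prob b"
      unfolding G(2) using I G by (intro indep_varsD_finite[OF indY, symmetric]) auto
    finally show "prob (a \<inter> b) = prob a * prob b" .
  qed
  then have "indep_set (sigma_sets (space M) ?GX) (sigma_sets (space M) ?GY)"
    by (intro indep_set_sigma_sets stable Int_stable_prod_algebra)
  also have "sigma_sets (space M) ?GX = {?X -` A \<inter> space M |A. A \<in> sets (PiM I (\<lambda>_. S))}"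
    unfolding sets_PiM using measurable_space[OF Xm] by (intro sigma_sets_vimage_commute[symmetric]) (auto simp: space_PiM)
  also have "sigma_sets (space M) ?GY = {?Y -` A \<inter> space M |A. A \<in> sets (PiM I (\<lambda>_. T))}"
    unfolding sets_PiM using measurable_space[OF Ym] by (intro sigma_sets_vimage_commute[symmetric]) (auto simp: space_PiM)
  finally show ?thesis
    unfolding indep_rv_def using Xm Ym by (intro conjI)
qed

section \<open>The coefficient as a quotient of distance sums\<close>

definition dist_sum :: "nat \<Rightarrow> (nat \<Rightarrow> 'v::real_normed_vector) \<Rightarrow> real" where
  "dist_sum n x = (\<Sum>i<n. \<Sum>j<n. norm (x i - x j))"

definition consecutive_dist :: "nat \<Rightarrow> (nat \<Rightarrow> 'v::real_normed_vector) \<Rightarrow> real" where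
  "consecutive_dist n x = (\<Sum>i<n - 1. norm (x i - x (Suc i)))"

lemma dist_sum_eq_0_iff: "dist_sum n x = 0 \<longleftrightarrow> (\<exists>c. \<forall>i<n. x i = c)"
proof
  assume "dist_sum n x = 0"
  then have row: "(\<Sum>j<n. norm (x i - x j)) = 0" if "i < n" for i
    unfolding dist_sum_def using that by (subst (asm) sum_nonneg_eq_0_iff) (auto intro!: sum_nonneg)
  have "x i = x 0" if i: "i < n" for i
  proof -
    have "(\<Sum>j<n. norm (x i - x j)) = 0 \<longleftrightarrow> (\<forall>j\<in>{..<n}. norm (x i - x j) = 0)"
      by (rule sum_nonneg_eq_0_iff) auto
    then have "norm (x i - x 0) = 0" using row[OF i] i by (metis lessThan_iff not_less_zero gr_zeroI)
    then show ?thesis by simp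
  qed
  then show "\<exists>c. \<forall>i<n. x i = c" by blast
next
  assume "\<exists>c. \<forall>i<n. x i = c"
  then obtain c where "\<And>i. i < n \<Longrightarrow> x i = c" by blast
  then show "dist_sum n x = 0" by (simp add: dist_sum_def)
qed

text \<open>If all \<open>x i\<close> agree, the right-hand side is \<open>0 / 0 = 0\<close>, the value prescribed for \<open>DDC\<close>.\<close>
lemma DDC_eq:
  assumes s: "s permutes {..<n}"
  shows "DDC n x s = (dist_sum n (x \<circ> s) - real n * consecutive_dist n (x \<circ> s)) / dist_sum n (x \<circ> s)"
proof -
  have perm: "dist_sum n (x \<circ> s) = dist_sum n x"
  proof -
    have "dist_sum n x = (\<Sum>i<n. \<Sum>j<n. norm (x i - x (s j)))"
      unfolding dist_sum_def using s by (intro sum.cong refl sum.permute[unfolded comp_def]) 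
    also have "\<dots> = (\<Sum>i<n. \<Sum>j<n. norm (x (s i) - x (s j)))"
      using s by (rule sum.permute[unfolded comp_def])
    finally show ?thesis by (simp add: dist_sum_def)
  qed
  show ?thesis
  proof (cases "dist_sum n x = 0")
    case True
    then show ?thesis unfolding perm by (simp add: DDC_def dist_sum_eq_0_iff)
  next
    case False
    then have ne: "\<not> (\<exists>c. \<forall>i<n. x i = c)" unfolding dist_sum_eq_0_iff .
    have "DDC n x s = 1 - real n * consecutive_dist n (x \<circ> s) / dist_sum n x"
      by (simp only: DDC_def if_not_P[OF ne] consecutive_dist_def dist_sum_def comp_def Suc_eq_plus1)
    then show ?thesis using False unfolding perm by (simp add: diff_divide_distrib)
  qed
qed

lemma DDC_restrict:
  assumes "s permutes {..<n}"
  shows "DDC n (restrict x {..<n}) s = DDC n x s"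
proof -
  have "s i < n" if "i < n" for i
    using permutes_in_image[OF assms, of i] that by simp
  then show ?thesis
    unfolding DDC_eq[OF assms] dist_sum_def consecutive_dist_def by simp
qed

text \<open>Moves the permutation from the coefficient to the sample, where exchangeability can
  absorb it.\<close>

lemma DDC_compose:
  assumes s: "s permutes {..<n}"
  shows "DDC n (\<lambda>i\<in>{..<n}. x (s i)) id = DDC n x s"
proof -
  have "DDC n (\<lambda>i\<in>{..<n}. x (s i)) id = DDC n (\<lambda>i. x (s i)) id"
    by (rule DDC_restrict[OF permutes_id])
  also have "\<dots> = DDC n x s"
    by (simp add: DDC_eq[OF s] DDC_eq[OF permutes_id] comp_def)
  finally show ?thesis .
qed

lemma measurable_DDC:
  assumes s: "s permutes {..<n}"
  shows "(\<lambda>x :: nat \<Rightarrow> 'v::euclidean_space. DDC n x s) \<in> borel_measurable (PiM {..<n} (\<lambda>_. borel))"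
proof -
  have [measurable]: "(\<lambda>x. x (s i)) \<in> borel_measurable (PiM {..<n} (\<lambda>_. borel :: 'v measure))" if "i < n" for i
    using permutes_in_image[OF s, of i] that by auto
  show ?thesis
    unfolding DDC_eq[OF s] dist_sum_def consecutive_dist_def comp_def by measurable
qed

text \<open>Given the \<open>Y\<close>-sample and the external randomisation, the sorting permutation is fixed, and the
  \<open>X\<close>-sample is exchangeable.\<close>
lemma (in prob_space) distr_DDC_sorted:
  fixes Xs :: "nat \<Rightarrow> 'a \<Rightarrow> 'v::euclidean_space" and Ys :: "nat \<Rightarrow> 'a \<Rightarrow> real" and U :: "'a \<Rightarrow> 'u"
  assumes ind: "indep_vars (\<lambda>_. borel \<Otimes>\<^sub>M borel) (\<lambda>i \<omega>. (Xs i \<omega>, Ys i \<omega>)) UNIV"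
    and XY: "\<And>i. indep_rv M borel (Xs i) borel (Ys i)"
    and X: "\<And>i. distr M borel (Xs i) = \<mu>"
    and \<tau>: "sorting_rule N \<tau>"
    and U: "indep_rv M N U (\<Pi>\<^sub>M i\<in>UNIV. borel \<Otimes>\<^sub>M borel) (\<lambda>\<omega> i. (Xs i \<omega>, Ys i \<omega>))"
  shows "distr M borel (\<lambda>\<omega>. c * DDC n (\<lambda>i. Xs i \<omega>) (\<tau> n (restrict (\<lambda>i. Ys i \<omega>) {..<n}) (U \<omega>)))
    = distr M borel (\<lambda>\<omega>. c * DDC n (\<lambda>i. Xs i \<omega>) id)"
proof (cases "n = 0")
  case True
  then show ?thesis by (simp add: DDC_def)
next
  case False
  let ?I = "{..<n}"
  let ?PX = "PiM ?I (\<lambda>_. borel :: 'v measure)" and ?PY = "PiM ?I (\<lambda>_. borel :: real measure)"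
  let ?X = "\<lambda>\<omega>. \<lambda>i\<in>?I. Xs i \<omega>" and ?Y = "\<lambda>\<omega>. \<lambda>i\<in>?I. Ys i \<omega>"
  have Xm [measurable]: "random_variable borel (Xs i)" and Ym [measurable]: "random_variable borel (Ys i)" for i
    using XY[of i] by (auto simp: indep_rv_def)
  have Um [measurable]: "random_variable N U" using U by (simp add: indep_rv_def)
  have [measurable]: "random_variable ?PX ?X" "random_variable ?PY ?Y" by measurable
  interpret \<mu>: prob_space \<mu> unfolding X[of 0, symmetric] by (rule prob_space_distr) measurable
  let ?LX = "distr M ?PX ?X" and ?LY = "distr M ?PY ?Y" and ?LU = "distr M N U"
  interpret LX: prob_space ?LX by (rule prob_space_distr) measurable
  interpret LY: prob_space ?LY by (rule prob_space_distr) measurable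
  interpret LU: prob_space ?LU by (rule prob_space_distr) measurable
  interpret XY: pair_prob_space ?LX ?LY by unfold_locales
  have "indep_rv M ?PX ?X ?PY ?Y"
    using False XY by (intro indep_rv_PiM indep_vars_subset[OF ind]) auto
  then have joint_XY: "distr M (?PX \<Otimes>\<^sub>M ?PY) (\<lambda>\<omega>. (?X \<omega>, ?Y \<omega>)) = ?LX \<Otimes>\<^sub>M ?LY"
    by (simp add: indep_rv_iff_distr)
  have "indep_rv M N U (?PX \<Otimes>\<^sub>M ?PY) (\<lambda>\<omega>. (\<lambda>z. (\<lambda>i\<in>?I. fst (z i), \<lambda>i\<in>?I. snd (z i))) (\<lambda>i. (Xs i \<omega>, Ys i \<omega>)))"
    by (rule indep_rv_compose[OF U, of "\<lambda>u. u"]) measurable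
  then have joint: "distr M (N \<Otimes>\<^sub>M (?PX \<Otimes>\<^sub>M ?PY)) (\<lambda>\<omega>. (U \<omega>, (?X \<omega>, ?Y \<omega>))) = ?LU \<Otimes>\<^sub>M (?LX \<Otimes>\<^sub>M ?LY)"
    by (simp add: indep_rv_iff_distr joint_XY)
  have LX: "?LX = PiM ?I (\<lambda>_. \<mu>)"
    using indep_vars_iff_distr_eq_PiM[of ?I Xs "\<lambda>_. borel"] False
      indep_vars_compose2[OF indep_vars_subset[OF ind subset_UNIV[of ?I]], of "\<lambda>_. fst" "\<lambda>_. borel"]
    by (simp add: X lessThan_empty_iff)
  have perm: "\<tau> n y u permutes ?I" if "y \<in> space ?PY" "u \<in> space N" for y u
    using \<tau> that by (simp add: sorting_rule_def sorting_perm_def)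
  let ?F = "\<lambda>p. c * DDC n (fst (snd p)) (\<tau> n (snd (snd p)) (fst p))"
  have [measurable]: "?F \<in> borel_measurable (N \<Otimes>\<^sub>M (?PX \<Otimes>\<^sub>M ?PY))"
  proof -
    \<comment> \<open>The type \<open>nat \<Rightarrow> nat\<close> is uncountable, but on the
      relevant space the rule takes values in the finite set \<open>?S\<close>, so measurability
      follows by distinguishing these values.\<close>
    let ?S = "{s. s permutes ?I}"
    have fin: "finite ?S" by (rule finite_permutations) simp
    have tau: "(\<lambda>(y, u). \<tau> n y u) \<in> measurable (?PY \<Otimes>\<^sub>M N) (count_space UNIV)"
      using \<tau> by (simp add: sorting_rule_def)
    have "(\<lambda>(y, u). \<tau> n y u) \<in> measurable (?PY \<Otimes>\<^sub>M N) (count_space ?S)"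
      using measurable_sets[OF tau] perm unfolding measurable_count_space_eq2[OF fin]
      by (auto simp: space_pair_measure)
    from measurable_compose[OF _ this, of "\<lambda>p. (snd (snd p), fst p)" "N \<Otimes>\<^sub>M (?PX \<Otimes>\<^sub>M ?PY)"]
    have g: "(\<lambda>p. \<tau> n (snd (snd p)) (fst p)) \<in> measurable (N \<Otimes>\<^sub>M (?PX \<Otimes>\<^sub>M ?PY)) (count_space ?S)"
      by simp
    have "(\<lambda>p. (\<lambda>s p. c * DDC n (fst (snd p)) s) (\<tau> n (snd (snd p)) (fst p)) p) \<in> borel_measurable (N \<Otimes>\<^sub>M (?PX \<Otimes>\<^sub>M ?PY))"
    proof (rule measurable_compose_countable'[OF _ g])
      fix s assume "s \<in> ?S"
      then have [measurable]: "(\<lambda>x. DDC n x s) \<in> borel_measurable ?PX"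
        by (intro measurable_DDC) simp
      show "(\<lambda>p. c * DDC n (fst (snd p)) s) \<in> borel_measurable (N \<Otimes>\<^sub>M (?PX \<Otimes>\<^sub>M ?PY))"
        by measurable
    qed (use fin in \<open>rule countable_finite\<close>)
    then show ?thesis .
  qed
  have [measurable]: "(\<lambda>x. DDC n x id) \<in> borel_measurable ?PX"
    by (rule measurable_DDC[OF permutes_id])
  have sorted: "(\<lambda>\<omega>. c * DDC n (\<lambda>i. Xs i \<omega>) (\<tau> n (?Y \<omega>) (U \<omega>))) \<omega> = ?F (U \<omega>, (?X \<omega>, ?Y \<omega>))" if "\<omega> \<in> space M" for \<omega>
    using that measurable_space[OF Um] by (simp add: DDC_restrict perm space_PiM)
  have ident: "c * DDC n (\<lambda>i. Xs i \<omega>) id = c * DDC n (?X \<omega>) id" for \<omega>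
    by (simp add: DDC_restrict permutes_id)
  have exch: "(\<integral>\<^sup>+x. indicator B (c * DDC n x s) \<partial>?LX) = (\<integral>\<^sup>+x. indicator B (c * DDC n x id) \<partial>?LX)"
    if s: "s permutes ?I" and B [measurable]: "B \<in> sets borel" for s and B :: "real set"
  proof -
    \<comment> \<open>Exchangeability: a product of equal factors is invariant under permuting the
      coordinates.\<close>
    have "?LX = distr ?LX ?PX (\<lambda>x. \<lambda>i\<in>?I. x (s i))"
    proof -
      have "PiM ?I (\<lambda>_. \<mu>) = distr (PiM ?I (\<lambda>_. \<mu>)) (PiM ?I (\<lambda>_. \<mu>)) (\<lambda>x. \<lambda>i\<in>?I. x (s i))"
        using permutes_inj_on[OF s] permutes_in_image[OF s] by (intro distr_PiM_reindex[symmetric] \<mu>.prob_space_axioms) auto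
      then have "?LX = distr ?LX ?LX (\<lambda>x. \<lambda>i\<in>?I. x (s i))"
        unfolding LX[symmetric] .
      also have "\<dots> = distr ?LX ?PX (\<lambda>x. \<lambda>i\<in>?I. x (s i))"
        by (intro distr_cong) auto
      finally show ?thesis .
    qed
    then have "(\<integral>\<^sup>+x. indicator B (c * DDC n x id) \<partial>?LX) = (\<integral>\<^sup>+x. indicator B (c * DDC n x id) \<partial>distr ?LX ?PX (\<lambda>x. \<lambda>i\<in>?I. x (s i)))"
      by simp
    also have "\<dots> = (\<integral>\<^sup>+x. indicator B (c * DDC n (\<lambda>i\<in>?I. x (s i)) id) \<partial>?LX)"
    proof (rule nn_integral_distr)
      have "(\<lambda>x. \<lambda>i\<in>?I. x (s i)) \<in> measurable ?PX ?PX"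
        using permutes_in_image[OF s] by (intro measurable_restrict measurable_component_singleton) auto
      then show "(\<lambda>x. \<lambda>i\<in>?I. x (s i)) \<in> measurable ?LX ?PX" by simp
    qed measurable
    finally show ?thesis by (simp add: DDC_compose[OF s])
  qed
  show ?thesis
  proof (rule measure_eqI)
    fix B :: "real set"
    assume "B \<in> sets (distr M borel (\<lambda>\<omega>. c * DDC n (\<lambda>i. Xs i \<omega>) (\<tau> n (restrict (\<lambda>i. Ys i \<omega>) {..<n}) (U \<omega>))))"
    then have B [measurable]: "B \<in> sets borel" by simp
    have "distr M borel (\<lambda>\<omega>. c * DDC n (\<lambda>i. Xs i \<omega>) (\<tau> n (?Y \<omega>) (U \<omega>)))
        = distr (distr M (N \<Otimes>\<^sub>M (?PX \<Otimes>\<^sub>M ?PY)) (\<lambda>\<omega>. (U \<omega>, (?X \<omega>, ?Y \<omega>)))) borel ?F"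
      using sorted by (subst distr_distr) (auto intro!: distr_cong)
    then have "emeasure (distr M borel (\<lambda>\<omega>. c * DDC n (\<lambda>i. Xs i \<omega>) (\<tau> n (?Y \<omega>) (U \<omega>)))) B
        = (\<integral>\<^sup>+b. indicator B b \<partial>distr (?LU \<Otimes>\<^sub>M (?LX \<Otimes>\<^sub>M ?LY)) borel ?F)"
      unfolding joint by simp
    also have "\<dots> = (\<integral>\<^sup>+p. indicator B (?F p) \<partial>(?LU \<Otimes>\<^sub>M (?LX \<Otimes>\<^sub>M ?LY)))"
      by (rule nn_integral_distr) measurable
    also have "\<dots> = (\<integral>\<^sup>+u. \<integral>\<^sup>+q. indicator B (?F (u, q)) \<partial>(?LX \<Otimes>\<^sub>M ?LY) \<partial>?LU)"
      by (rule XY.P.nn_integral_fst[symmetric]) measurable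
    \<comment> \<open>With \<open>x\<close> innermost the permutation is constant in the inner
      integral, so exchangeability applies for each \<open>u\<close> and \<open>y\<close>.\<close>
    also have "\<dots> = (\<integral>\<^sup>+u. \<integral>\<^sup>+y. \<integral>\<^sup>+x. indicator B (?F (u, (x, y))) \<partial>?LX \<partial>?LY \<partial>?LU)"
      by (intro nn_integral_cong XY.nn_integral_snd[symmetric]) measurable
    also have "\<dots> = (\<integral>\<^sup>+u. \<integral>\<^sup>+y. \<integral>\<^sup>+x. indicator B (c * DDC n x id) \<partial>?LX \<partial>?LY \<partial>?LU)"
    proof (rule nn_integral_cong, rule nn_integral_cong)
      fix u y assume "u \<in> space ?LU" "y \<in> space ?LY"
      then show "(\<integral>\<^sup>+x. indicator B (?F (u, (x, y))) \<partial>?LX) = (\<integral>\<^sup>+x. indicator B (c * DDC n x id) \<partial>?LX)"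
        using exch[OF perm B, of y u] by simp
    qed
    also have "\<dots> = (\<integral>\<^sup>+x. indicator B (c * DDC n x id) \<partial>?LX)"
      using LY.emeasure_space_1 LU.emeasure_space_1 by simp
    also have "\<dots> = (\<integral>\<^sup>+\<omega>. indicator B (c * DDC n (?X \<omega>) id) \<partial>M)"
      by (rule nn_integral_distr) measurable
    also have "\<dots> = (\<integral>\<^sup>+b. indicator B b \<partial>distr M borel (\<lambda>\<omega>. c * DDC n (?X \<omega>) id))"
      by (rule nn_integral_distr[symmetric]) measurable
    also have "\<dots> = emeasure (distr M borel (\<lambda>\<omega>. c * DDC n (\<lambda>i. Xs i \<omega>) id)) B"
      unfolding ident by simp
    finally show "emeasure (distr M borel (\<lambda>\<omega>. c * DDC n (\<lambda>i. Xs i \<omega>) (\<tau> n (?Y \<omega>) (U \<omega>)))) B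
        = emeasure (distr M borel (\<lambda>\<omega>. c * DDC n (\<lambda>i. Xs i \<omega>) id)) B" .
  qed simp
qed

subsection \<open>Asymptotic normality\<close>

lemma double_sum_symmetric:
  fixes f :: "nat \<Rightarrow> nat \<Rightarrow> real"
  assumes sym: "\<And>i j. f i j = f j i"
  shows "(\<Sum>i<n. \<Sum>j<n. f i j) = 2 * (\<Sum>j<n. \<Sum>i<j. f i j) + (\<Sum>i<n. f i i)"
proof (induction n)
  case (Suc n)
  have "(\<Sum>i<Suc n. \<Sum>j<Suc n. f i j) = (\<Sum>i<n. \<Sum>j<n. f i j) + (\<Sum>i<n. f i n) + (\<Sum>j<n. f n j) + f n n"
    by (simp add: sum.distrib)
  also have "(\<Sum>j<n. f n j) = (\<Sum>i<n. f i n)" by (intro sum.cong refl sym)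
  finally show ?case using Suc by simp
qed simp

context iid_sequence
begin

section \<open>Hoeffding decomposition of the two distance sums\<close>

definition A :: "nat \<Rightarrow> 'a \<Rightarrow> real" where "A i \<omega> = law.mean_dist (X i \<omega>) - law.gini"

definition A_var :: real where "A_var = (LINT x|\<mu>. (law.mean_dist x - law.gini)\<^sup>2)"

definition K_sum :: "nat \<Rightarrow> 'a \<Rightarrow> real" where "K_sum n \<omega> = (\<Sum>j<n. \<Sum>i<j. K i j \<omega>)"

lemma measurable_A [measurable]: "random_variable borel (A i)"
  unfolding A_def[abs_def] by measurable

lemma measurable_K_sum [measurable]: "random_variable borel (K_sum n)"
  unfolding K_sum_def[abs_def] by (intro borel_measurable_sum measurable_K)

lemma integrable_A_sq_law: "integrable \<mu> (\<lambda>x. (law.mean_dist x - law.gini)\<^sup>2)"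
  using law.integrable_mean_dist_sq law.integrable_mean_dist by (simp add: power2_diff)

lemma A_sq: "integrable M (\<lambda>\<omega>. (A i \<omega>)\<^sup>2)" "expectation (\<lambda>\<omega>. (A i \<omega>)\<^sup>2) = A_var"
  unfolding A_def A_var_def using expectation_X[of "\<lambda>x. (law.mean_dist x - law.gini)\<^sup>2" i] integrable_A_sq_law by simp_all

lemma A_var_nonneg: "A_var \<ge> 0"
  unfolding A_var_def by (rule Bochner_Integration.integral_nonneg) simp

lemma A_orthogonal:
  assumes "i \<noteq> j"
  shows "expectation (\<lambda>\<omega>. A i \<omega> * A j \<omega>) = 0"
proof -
  let ?a = "\<lambda>x. law.mean_dist x - law.gini"
  have int: "integrable \<mu> ?a" using law.integrable_mean_dist by simp
  have "expectation (\<lambda>\<omega>. A i \<omega> * A j \<omega>) = (LINT z|(\<mu> \<Otimes>\<^sub>M \<mu>). ?a (fst z) * ?a (snd z))"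
    using expectation_pair(2)[OF assms, of "\<lambda>z. ?a (fst z) * ?a (snd z)"] by (simp add: A_def)
  also have "\<dots> = (LINT x|\<mu>. LINT y|\<mu>. ?a x * ?a y)"
    using law.pair.integral_fst'[OF law.pair.integrable_pair_mult[OF int int]] by simp
  also have "\<dots> = 0"
    using law.integrable_mean_dist by (simp add: law.gini_def[symmetric])
  finally show ?thesis .
qed

lemma sum_A_sq:
  "integrable M (\<lambda>\<omega>. (\<Sum>i<n. A i \<omega>)\<^sup>2)" "expectation (\<lambda>\<omega>. (\<Sum>i<n. A i \<omega>)\<^sup>2) = real n * A_var"
  using expectation_sum_sq_orthogonal[of "{..<n}" A] by (auto simp: A_sq A_orthogonal)

text \<open>By orthogonality the second moment is proportional to the number of pairs, here bounded
  by \<open>n\<^sup>2\<close>. So \<open>K_sum\<close> is of order \<open>n\<close> only, although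
  it has of the order of \<open>n\<^sup>2\<close> terms.\<close>

lemma K_sum_sq:
  "integrable M (\<lambda>\<omega>. (K_sum n \<omega>)\<^sup>2)" "expectation (\<lambda>\<omega>. (K_sum n \<omega>)\<^sup>2) \<le> (real n)\<^sup>2 * law.kern_var"
proof -
  let ?I = "{p. fst p < snd p \<and> snd p < n}"
  have eq: "K_sum n \<omega> = (\<Sum>p\<in>?I. K (fst p) (snd p) \<omega>)" for \<omega>
    unfolding K_sum_def by (subst sum.Sigma)
      (auto intro!: sum.reindex_bij_witness[where i = "\<lambda>p. (snd p, fst p)" and j = "\<lambda>p. (snd p, fst p)"])
  have "?I \<subseteq> {..<n} \<times> {..<n}" by auto
  from card_mono[OF _ this] have card: "card ?I \<le> n * n" by simp
  show "integrable M (\<lambda>\<omega>. (K_sum n \<omega>)\<^sup>2)"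
    unfolding eq by (rule sum_K_sq) simp
  have "expectation (\<lambda>\<omega>. (K_sum n \<omega>)\<^sup>2) = real (card ?I) * law.kern_var"
    unfolding eq by (rule sum_K_sq) simp
  also have "\<dots> \<le> (real n)\<^sup>2 * law.kern_var"
    using card of_nat_mono[OF card, where 'a = real] law.kern_var_nonneg
    by (intro mult_right_mono) (auto simp: power2_eq_square)
  finally show "expectation (\<lambda>\<omega>. (K_sum n \<omega>)\<^sup>2) \<le> (real n)\<^sup>2 * law.kern_var" .
qed

lemma norm_diff_eq: "norm (X i \<omega> - X j \<omega>) = K i j \<omega> + A i \<omega> + A j \<omega> + law.gini"
  by (simp add: K_def A_def law.kern_def)

text \<open>Over all ordered pairs each \<open>A i\<close> occurs \<open>2 * n\<close> times. The
  diagonal distances are 0, so \<open>K i i\<close> takes away \<open>2 * A i + gini\<close>, which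
  lowers \<open>n\<close> to \<open>n - 1\<close> in the linear term and \<open>n\<^sup>2\<close> to
  \<open>n\<^sup>2 - n\<close> in the constant.\<close>

lemma dist_sum_decomp:
  "dist_sum n (\<lambda>i. X i \<omega>) =
     2 * K_sum n \<omega> + 2 * (real n - 1) * (\<Sum>i<n. A i \<omega>) + ((real n)\<^sup>2 - real n) * law.gini"
proof -
  have diag: "K i i \<omega> = - law.gini - 2 * A i \<omega>" for i
    by (simp add: K_def A_def law.kern_def)
  have "dist_sum n (\<lambda>i. X i \<omega>) = (\<Sum>i<n. \<Sum>j<n. K i j \<omega>) + 2 * real n * (\<Sum>i<n. A i \<omega>) + (real n)\<^sup>2 * law.gini"
    unfolding dist_sum_def norm_diff_eq
    by (simp add: sum.distrib sum_distrib_left power2_eq_square algebra_simps)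
  also have "(\<Sum>i<n. \<Sum>j<n. K i j \<omega>) = 2 * K_sum n \<omega> + (\<Sum>i<n. K i i \<omega>)"
    unfolding K_sum_def by (rule double_sum_symmetric) (rule K_commute)
  also have "(\<Sum>i<n. K i i \<omega>) = - real n * law.gini - 2 * (\<Sum>i<n. A i \<omega>)"
    unfolding diag by (simp add: sum_subtractf sum_distrib_left sum_negf)
  finally show ?thesis by (simp add: algebra_simps)
qed

text \<open>Every inner index belongs to two neighbouring pairs, each end point to one, whence the
  boundary corrections; for \<open>n = 1\<close> they cancel the linear part completely.\<close>

lemma consecutive_dist_decomp:
  assumes "n \<ge> 1"
  shows "consecutive_dist n (\<lambda>i. X i \<omega>) =
     (\<Sum>i<n - 1. K i (Suc i) \<omega>) + 2 * (\<Sum>i<n. A i \<omega>) - A 0 \<omega> - A (n - 1) \<omega> + (real n - 1) * law.gini"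
proof -
  obtain k where k: "n = Suc k" using assms by (cases n) auto
  have "(\<Sum>i<k. A (Suc i) \<omega>) = (\<Sum>i<Suc k. A i \<omega>) - A 0 \<omega>"
    by (subst sum.lessThan_Suc_shift) simp
  then show ?thesis
    unfolding consecutive_dist_def norm_diff_eq k by (simp add: sum.distrib)
qed

section \<open>Limits of the normalised numerator and denominator\<close>

text \<open>The factor \<open>sqrt n\<close> is distributed so that both parts stay of constant
  order: the double sum has order \<open>n\<^sup>2\<close>, while the difference in the numerator,
  free of its leading terms, has order \<open>n powr (3 / 2)\<close>.\<close>

definition numer :: "nat \<Rightarrow> 'a \<Rightarrow> real" where
  "numer n \<omega> = (dist_sum n (\<lambda>i. X i \<omega>) - real n * consecutive_dist n (\<lambda>i. X i \<omega>)) / (real n * sqrt (real n))"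

definition denom :: "nat \<Rightarrow> 'a \<Rightarrow> real" where
  "denom n \<omega> = dist_sum n (\<lambda>i. X i \<omega>) / (real n)\<^sup>2"

lemma sqrt_DDC_eq: "sqrt (real n) * DDC n (\<lambda>i. X i \<omega>) id = numer n \<omega> / denom n \<omega>"
proof (cases "n = 0")
  case False
  \<comment> \<open>With \<open>r = sqrt n\<close> the rescaling becomes a rational identity; for
    \<open>d = 0\<close> both sides are 0.\<close>
  have scale: "r * (x / d) = (x / (r\<^sup>2 * r)) / (d / (r\<^sup>2)\<^sup>2)" if "r > 0" for r x d :: real
    using that by (simp add: power2_eq_square)
  have "real n = (sqrt (real n))\<^sup>2" "sqrt (real n) > 0" using False by simp_all
  with scale show ?thesis
    unfolding DDC_eq[OF permutes_id] numer_def denom_def comp_def id_apply by metis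
qed (simp add: numer_def)

lemma measurable_dist_sum [measurable]: "random_variable borel (\<lambda>\<omega>. dist_sum n (\<lambda>i. X i \<omega>))"
  unfolding dist_sum_def by measurable

lemma measurable_numer [measurable]: "random_variable borel (numer n)"
  unfolding numer_def[abs_def] consecutive_dist_def by measurable

lemma measurable_denom [measurable]: "random_variable borel (denom n)"
  unfolding denom_def[abs_def] by measurable

definition remainder :: "nat \<Rightarrow> 'a \<Rightarrow> real" where
  "remainder n \<omega> = (2 * K_sum n \<omega> - 2 * (\<Sum>i<n. A i \<omega>) + real n * (A 0 \<omega> + A (n - 1) \<omega>)) / (real n * sqrt (real n))"

text \<open>The linear parts of both sums cancel, so that the kernel sum over consecutive pairs dominates.\<close>
lemma numer_decomp:
  assumes "n \<ge> 1"
  shows "numer n \<omega> = remainder n \<omega> - (\<Sum>i<n - 1. K i (Suc i) \<omega>) / sqrt (real n)"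
proof -
  let ?q = "real n * sqrt (real n)" and ?S = "\<Sum>i<n - 1. K i (Suc i) \<omega>"
  have "?S / sqrt (real n) = real n * ?S / ?q" using assms by simp
  then have "remainder n \<omega> - ?S / sqrt (real n) =
      (2 * K_sum n \<omega> - 2 * (\<Sum>i<n. A i \<omega>) + real n * (A 0 \<omega> + A (n - 1) \<omega>) - real n * ?S) / ?q"
    by (simp only: remainder_def diff_divide_distrib)
  also have "2 * K_sum n \<omega> - 2 * (\<Sum>i<n. A i \<omega>) + real n * (A 0 \<omega> + A (n - 1) \<omega>) - real n * ?S
      = dist_sum n (\<lambda>i. X i \<omega>) - real n * consecutive_dist n (\<lambda>i. X i \<omega>)"
    unfolding dist_sum_decomp consecutive_dist_decomp[OF assms] by (simp add: power2_eq_square algebra_simps)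
  finally show ?thesis by (simp add: numer_def)
qed

lemma K_sum_L1: "integrable M (K_sum n)" "expectation (\<lambda>\<omega>. \<bar>K_sum n \<omega>\<bar>) \<le> real n * sqrt law.kern_var"
  using expectation_abs_le[OF measurable_K_sum K_sum_sq] by (simp_all add: real_sqrt_mult)

lemma sum_A_L1:
  "integrable M (\<lambda>\<omega>. \<Sum>i<n. A i \<omega>)" "expectation (\<lambda>\<omega>. \<bar>\<Sum>i<n. A i \<omega>\<bar>) \<le> sqrt (real n) * sqrt A_var"
proof -
  have m: "random_variable borel (\<lambda>\<omega>. \<Sum>i<n. A i \<omega>)" by measurable
  show "integrable M (\<lambda>\<omega>. \<Sum>i<n. A i \<omega>)" "expectation (\<lambda>\<omega>. \<bar>\<Sum>i<n. A i \<omega>\<bar>) \<le> sqrt (real n) * sqrt A_var"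
    using expectation_abs_le[OF m sum_A_sq(1) order_refl] by (simp_all add: sum_A_sq real_sqrt_mult)
qed

lemma A_L1: "integrable M (A i)" "expectation (\<lambda>\<omega>. \<bar>A i \<omega>\<bar>) \<le> sqrt A_var"
  using expectation_abs_le[OF measurable_A A_sq(1) order_refl] by (simp_all add: A_sq)

text \<open>Each of the three parts has mean absolute value of order at most \<open>n\<close>,
  against the divisor \<open>n * sqrt n\<close>. The 4 collects a 2 from the sum of the
  \<open>A i\<close> and a 1 from each boundary term.\<close>

lemma remainder_L1:
  assumes n: "n \<ge> 1"
  shows "integrable M (remainder n)"
    "expectation (\<lambda>\<omega>. \<bar>remainder n \<omega>\<bar>) \<le> (2 * sqrt law.kern_var + 4 * sqrt A_var) / sqrt (real n)"
proof -
  let ?q = "real n * sqrt (real n)"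
  let ?g = "\<lambda>\<omega>. (2 * \<bar>K_sum n \<omega>\<bar> + 2 * \<bar>\<Sum>i<n. A i \<omega>\<bar> + real n * (\<bar>A 0 \<omega>\<bar> + \<bar>A (n - 1) \<omega>\<bar>)) / ?q"
  have int: "integrable M (\<lambda>\<omega>. \<bar>K_sum n \<omega>\<bar>)" "integrable M (\<lambda>\<omega>. \<bar>\<Sum>i<n. A i \<omega>\<bar>)" "integrable M (\<lambda>\<omega>. \<bar>A i \<omega>\<bar>)" for i
    by (intro integrable_abs K_sum_L1 sum_A_L1 A_L1)+
  show *: "integrable M (remainder n)"
    unfolding remainder_def[abs_def] using K_sum_L1(1)[of n] sum_A_L1(1)[of n] A_L1(1) by auto
  have "expectation (\<lambda>\<omega>. \<bar>remainder n \<omega>\<bar>) \<le> expectation ?g"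
  proof (rule integral_mono)
    show "integrable M ?g" using int by auto
    have bound: "\<bar>(2 * k - 2 * s + r * (u + v)) / q\<bar> \<le> (2 * \<bar>k\<bar> + 2 * \<bar>s\<bar> + r * (\<bar>u\<bar> + \<bar>v\<bar>)) / q"
      if "r \<ge> 0" "q \<ge> 0" for k s r u v q :: real
    proof -
      have "\<bar>2 * k - 2 * s + r * (u + v)\<bar> \<le> \<bar>2 * k\<bar> + \<bar>2 * s\<bar> + \<bar>r * (u + v)\<bar>" by linarith
      also have "\<dots> \<le> 2 * \<bar>k\<bar> + 2 * \<bar>s\<bar> + r * (\<bar>u\<bar> + \<bar>v\<bar>)"
        using that by (auto simp: abs_mult intro!: mult_left_mono)
      finally show ?thesis using that by (simp add: divide_right_mono)
    qed
    show "\<bar>remainder n \<omega>\<bar> \<le> ?g \<omega>" for \<omega>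
      unfolding remainder_def by (rule bound) auto
  qed (use * in auto)
  also have "\<dots> = (2 * expectation (\<lambda>\<omega>. \<bar>K_sum n \<omega>\<bar>) + 2 * expectation (\<lambda>\<omega>. \<bar>\<Sum>i<n. A i \<omega>\<bar>)
      + real n * (expectation (\<lambda>\<omega>. \<bar>A 0 \<omega>\<bar>) + expectation (\<lambda>\<omega>. \<bar>A (n - 1) \<omega>\<bar>))) / ?q"
    using int by simp
  also have "\<dots> \<le> (2 * (real n * sqrt law.kern_var) + 2 * (real n * sqrt A_var) + real n * (sqrt A_var + sqrt A_var)) / ?q"
  proof (intro divide_right_mono add_mono mult_left_mono K_sum_L1 A_L1)
    \<comment> \<open>The sum of the \<open>A i\<close> is only of order \<open>sqrt n\<close>;
      enlarging its bound to order \<open>n\<close> brings all parts to one common rate.\<close>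
    have "sqrt (real n) \<le> sqrt ((real n)\<^sup>2)"
      using n by (intro real_sqrt_le_mono) (simp add: power2_eq_square)
    then have "sqrt (real n) * sqrt A_var \<le> real n * sqrt A_var"
      using A_var_nonneg by (intro mult_right_mono) auto
    then show "expectation (\<lambda>\<omega>. \<bar>\<Sum>i<n. A i \<omega>\<bar>) \<le> real n * sqrt A_var"
      using sum_A_L1(2) by (rule order_trans[rotated])
  qed auto
  also have "\<dots> = (2 * sqrt law.kern_var + 4 * sqrt A_var) / sqrt (real n)"
    using n by (simp add: field_simps)
  finally show "expectation (\<lambda>\<omega>. \<bar>remainder n \<omega>\<bar>) \<le> (2 * sqrt law.kern_var + 4 * sqrt A_var) / sqrt (real n)" .
qed

lemma integrable_denom: "integrable M (denom n)"
  unfolding denom_def[abs_def] dist_sum_decomp using K_sum_L1(1)[of n] sum_A_L1(1)[of n] by auto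

text \<open>A law of large numbers with a rate: the linear part, \<open>2 * (n - 1)\<close> times a
  sum of order \<open>sqrt n\<close>, contributes \<open>1 / sqrt n\<close> after division by
  \<open>n\<^sup>2\<close>; the kernel part and the zero diagonal contribute
  \<open>1 / n\<close>.\<close>

lemma denom_L1: "(\<lambda>n. expectation (\<lambda>\<omega>. \<bar>denom n \<omega> - law.gini\<bar>)) \<longlonglongrightarrow> 0"
proof (rule tendsto_sandwich[OF _ _ tendsto_const])
  let ?u = "\<lambda>n. (2 * sqrt law.kern_var + law.gini) / real n + 2 * sqrt A_var / sqrt (real n)"
  show "eventually (\<lambda>n. expectation (\<lambda>\<omega>. \<bar>denom n \<omega> - law.gini\<bar>) \<le> ?u n) sequentially"
    using eventually_ge_at_top[of 1]
  proof eventually_elim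
    case n: (elim n)
    let ?g = "\<lambda>\<omega>. (2 * \<bar>K_sum n \<omega>\<bar> + 2 * real n * \<bar>\<Sum>i<n. A i \<omega>\<bar> + real n * law.gini) / (real n)\<^sup>2"
    have int: "integrable M (\<lambda>\<omega>. \<bar>K_sum n \<omega>\<bar>)" "integrable M (\<lambda>\<omega>. \<bar>\<Sum>i<n. A i \<omega>\<bar>)"
      by (intro integrable_abs K_sum_L1 sum_A_L1)+
    have "expectation (\<lambda>\<omega>. \<bar>denom n \<omega> - law.gini\<bar>) \<le> expectation ?g"
    proof (rule integral_mono)
      show "integrable M ?g" using int by auto
      show "integrable M (\<lambda>\<omega>. \<bar>denom n \<omega> - law.gini\<bar>)" using integrable_denom[of n] by auto
      show "\<bar>denom n \<omega> - law.gini\<bar> \<le> ?g \<omega>" for \<omega>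
      proof -
        let ?s = "\<Sum>i<n. A i \<omega>"
        have "denom n \<omega> - law.gini = (2 * K_sum n \<omega> + 2 * (real n - 1) * ?s - real n * law.gini) / (real n)\<^sup>2"
          using n unfolding denom_def dist_sum_decomp by (simp add: field_simps)
        moreover have "\<bar>2 * K_sum n \<omega> + 2 * (real n - 1) * ?s - real n * law.gini\<bar>
            \<le> 2 * \<bar>K_sum n \<omega>\<bar> + 2 * real n * \<bar>?s\<bar> + real n * law.gini"
        proof -
          have "\<bar>2 * (real n - 1) * ?s\<bar> = 2 * (real n - 1) * \<bar>?s\<bar>"
            using n by (simp add: abs_mult)
          also have "\<dots> \<le> 2 * real n * \<bar>?s\<bar>" by (intro mult_right_mono) auto
          finally have "\<bar>2 * (real n - 1) * ?s\<bar> \<le> 2 * real n * \<bar>?s\<bar>" .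
          moreover have "real n * law.gini \<ge> 0" using law.gini_nonneg by simp
          ultimately show ?thesis by linarith
        qed
        ultimately show ?thesis by (simp add: divide_right_mono)
      qed
    qed
    also have "\<dots> = (2 * expectation (\<lambda>\<omega>. \<bar>K_sum n \<omega>\<bar>) + 2 * real n * expectation (\<lambda>\<omega>. \<bar>\<Sum>i<n. A i \<omega>\<bar>) + real n * law.gini) / (real n)\<^sup>2"
      using int by (simp add: prob_space)
    also have "\<dots> \<le> (2 * (real n * sqrt law.kern_var) + 2 * real n * (sqrt (real n) * sqrt A_var) + real n * law.gini) / (real n)\<^sup>2"
      by (intro divide_right_mono add_mono mult_left_mono K_sum_L1 sum_A_L1) auto
    also have "\<dots> = ?u n"
    proof -
      have "2 * real n * (sqrt (real n) * sqrt A_var) / (real n)\<^sup>2 = 2 * sqrt A_var / sqrt (real n)"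
      proof -
        have scale: "2 * r\<^sup>2 * (r * v) / (r\<^sup>2)\<^sup>2 = 2 * v / r" if "r > 0" for r v :: real
          using that by (simp add: power2_eq_square)
        have "real n = (sqrt (real n))\<^sup>2" "sqrt (real n) > 0" using n by simp_all
        with scale show ?thesis by metis
      qed
      then show ?thesis using n by (simp add: add_divide_distrib power2_eq_square)
    qed
    finally show ?case .
  qed
  show "?u \<longlonglongrightarrow> 0" by real_asymp
qed auto

lemma integrable_sum_K_Suc: "integrable M (\<lambda>\<omega>. \<Sum>i\<in>J. K i (Suc i) \<omega>)"
proof (rule expectation_abs_le(1)[OF _ _ order_refl])
  show "random_variable borel (\<lambda>\<omega>. \<Sum>i\<in>J. K i (Suc i) \<omega>)" by (intro borel_measurable_sum measurable_K)
qed (rule sum_K_Suc_sq)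

lemma char_DDC:
  assumes pos: "law.kern_var > 0" "law.gini > 0"
  shows "(\<lambda>n. char (distr M borel (\<lambda>\<omega>. sqrt (real n) * DDC n (\<lambda>i. X i \<omega>) id)) t)
    \<longlonglongrightarrow> of_real (exp (- ((sqrt law.kern_var / law.gini * t)\<^sup>2) / 2))"
proof -
  define S where "S n \<omega> = (\<Sum>i<n - 1. K i (Suc i) \<omega>) / sqrt (real n)" for n \<omega>
  have [measurable]: "random_variable borel (S n)" for n
    unfolding S_def[abs_def] by (intro borel_measurable_divide borel_measurable_sum measurable_K) auto
  have S_int: "integrable M (S n)" for n
    unfolding S_def[abs_def] using integrable_sum_K_Suc by auto
  have S_L1: "expectation (\<lambda>\<omega>. \<bar>S n \<omega>\<bar>) \<le> sqrt law.kern_var" if n: "n \<ge> 1" for n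
  proof (rule expectation_abs_le(2))
    show "integrable M (\<lambda>\<omega>. (S n \<omega>)\<^sup>2)"
      unfolding S_def power_divide using sum_K_Suc_sq(1) by auto
    have "expectation (\<lambda>\<omega>. (S n \<omega>)\<^sup>2) = real (n - 1) * law.kern_var / real n"
      unfolding S_def power_divide using n by (simp add: sum_K_Suc_sq)
    also have "\<dots> \<le> law.kern_var"
      using n pos by (simp add: divide_le_eq mult.commute)
    finally show "expectation (\<lambda>\<omega>. (S n \<omega>)\<^sup>2) \<le> law.kern_var" .
  qed measurable
  have numer: "numer n = (\<lambda>\<omega>. remainder n \<omega> - S n \<omega>)" if "n \<ge> 1" for n
    using numer_decomp[OF that] by (simp add: S_def fun_eq_iff)
  have numer_int: "integrable M (numer n)" for n
  proof (cases "n \<ge> 1")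
    case True
    then show ?thesis using numer[OF True] remainder_L1(1)[OF True] S_int by simp
  next
    case False
    then have "n = 0" by simp
    then show ?thesis by (simp add: numer_def[abs_def])
  qed
  let ?C = "2 * sqrt law.kern_var + 4 * sqrt A_var"
  have numer_L1: "expectation (\<lambda>\<omega>. \<bar>numer n \<omega>\<bar>) \<le> ?C + sqrt law.kern_var" if n: "n \<ge> 1" for n
  proof -
    have "expectation (\<lambda>\<omega>. \<bar>numer n \<omega>\<bar>) \<le> expectation (\<lambda>\<omega>. \<bar>remainder n \<omega>\<bar> + \<bar>S n \<omega>\<bar>)"
      using numer_int[of n] remainder_L1(1)[OF n] S_int[of n] by (intro integral_mono) (auto simp: numer[OF n])
    also have "\<dots> = expectation (\<lambda>\<omega>. \<bar>remainder n \<omega>\<bar>) + expectation (\<lambda>\<omega>. \<bar>S n \<omega>\<bar>)"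
      using remainder_L1(1)[OF n] S_int[of n] by simp
    also have "\<dots> \<le> ?C / sqrt (real n) + sqrt law.kern_var"
      by (intro add_mono remainder_L1 S_L1 n)
    also have "?C / sqrt (real n) \<le> ?C / 1"
      using n pos A_var_nonneg by (intro divide_left_mono) auto
    finally show ?thesis by simp
  qed
  have "(\<lambda>n. char (distr M borel (\<lambda>\<omega>. numer n \<omega> / denom n \<omega>)) t)
      \<longlonglongrightarrow> of_real (exp (- ((sqrt law.kern_var / law.gini * t)\<^sup>2) / 2))"
  proof (rule slutsky_char[OF _ _ numer_int numer_L1 integrable_denom denom_L1 pos(2)])
    let ?l = "complex_of_real (exp (- ((sqrt law.kern_var / law.gini * t)\<^sup>2) / 2))"
    \<comment> \<open>The division by \<open>gini\<close> and the minus sign are absorbed into the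
      argument of the characteristic function; the sign disappears on squaring.\<close>
    have "(\<lambda>n. char (distr M borel (S n)) (- (t / law.gini))) \<longlonglongrightarrow> of_real (exp (- ((- (t / law.gini))\<^sup>2 * law.kern_var) / 2))"
      using char_sum_K[OF pos(1)] by (simp only: S_def[abs_def])
    also have "(- (t / law.gini))\<^sup>2 * law.kern_var = (sqrt law.kern_var / law.gini * t)\<^sup>2"
      using pos by (simp add: power_mult_distrib power_divide)
    also have "(\<lambda>n. char (distr M borel (S n)) (- (t / law.gini))) = (\<lambda>n. char (distr M borel (\<lambda>\<omega>. - S n \<omega> / law.gini)) t)"
      by (simp add: char_distr fun_eq_iff)
    finally have lim: "(\<lambda>n. char (distr M borel (\<lambda>\<omega>. - S n \<omega> / law.gini)) t) \<longlonglongrightarrow> ?l" .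
    have "(\<lambda>n. char (distr M borel (\<lambda>\<omega>. numer n \<omega> / law.gini)) t - char (distr M borel (\<lambda>\<omega>. - S n \<omega> / law.gini)) t) \<longlonglongrightarrow> 0"
    proof (rule Lim_null_comparison)
      show "eventually (\<lambda>n. norm (char (distr M borel (\<lambda>\<omega>. numer n \<omega> / law.gini)) t - char (distr M borel (\<lambda>\<omega>. - S n \<omega> / law.gini)) t)
          \<le> \<bar>t\<bar> * (?C / sqrt (real n) / law.gini)) sequentially"
        using eventually_ge_at_top[of 1]
      proof eventually_elim
        case n: (elim n)
        have diff: "numer n \<omega> / law.gini - - S n \<omega> / law.gini = remainder n \<omega> / law.gini" for \<omega>
          by (simp add: numer[OF n] diff_divide_distrib)
        have "norm (char (distr M borel (\<lambda>\<omega>. numer n \<omega> / law.gini)) t - char (distr M borel (\<lambda>\<omega>. - S n \<omega> / law.gini)) t)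
            \<le> \<bar>t\<bar> * expectation (\<lambda>\<omega>. \<bar>numer n \<omega> / law.gini - - S n \<omega> / law.gini\<bar>)"
        proof (rule cmod_char_diff_le_L1)
          show "integrable M (\<lambda>\<omega>. numer n \<omega> / law.gini - - S n \<omega> / law.gini)"
            unfolding diff using remainder_L1(1)[OF n] by auto
        qed measurable
        also have "\<dots> = \<bar>t\<bar> * (expectation (\<lambda>\<omega>. \<bar>remainder n \<omega>\<bar>) / law.gini)"
          unfolding diff using pos by simp
        also have "\<dots> \<le> \<bar>t\<bar> * (?C / sqrt (real n) / law.gini)"
          using pos by (intro mult_left_mono divide_right_mono remainder_L1 n) auto
        finally show ?case .
      qed
      show "(\<lambda>n. \<bar>t\<bar> * (?C / sqrt (real n) / law.gini)) \<longlonglongrightarrow> 0"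
        using pos by real_asymp
    qed
    from tendsto_add[OF this lim] show "(\<lambda>n. char (distr M borel (\<lambda>\<omega>. numer n \<omega> / law.gini)) t) \<longlonglongrightarrow> ?l"
      by simp
  qed measurable
  then show ?thesis by (simp only: sqrt_DDC_eq)
qed

section \<open>Moment formula and identification of the limit\<close>

lemma expectation_dist:
  assumes "i \<noteq> j"
  shows "expectation (\<lambda>\<omega>. norm (X i \<omega> - X j \<omega>)) = law.gini"
    "expectation (\<lambda>\<omega>. (norm (X i \<omega> - X j \<omega>))\<^sup>2) = (LINT z|(\<mu> \<Otimes>\<^sub>M \<mu>). (norm (fst z - snd z))\<^sup>2)"
proof -
  have "integrable (\<mu> \<Otimes>\<^sub>M \<mu>) (\<lambda>z. norm (fst z - snd z) * 1)"
    using law.integrable_pair_dist_sq by (intro integrable_mult_of_sq) auto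
  then have int: "integrable (\<mu> \<Otimes>\<^sub>M \<mu>) (\<lambda>z. norm (fst z - snd z))" by simp
  have "expectation (\<lambda>\<omega>. norm (X i \<omega> - X j \<omega>)) = (LINT z|(\<mu> \<Otimes>\<^sub>M \<mu>). norm (fst z - snd z))"
    using expectation_pair(2)[OF assms, of "\<lambda>z. norm (fst z - snd z)"] by simp
  also have "\<dots> = law.gini"
    using law.pair.integral_fst'[OF int] by (simp add: law.mean_dist_def[symmetric] law.gini_def)
  finally show "expectation (\<lambda>\<omega>. norm (X i \<omega> - X j \<omega>)) = law.gini" .
  show "expectation (\<lambda>\<omega>. (norm (X i \<omega> - X j \<omega>))\<^sup>2) = (LINT z|(\<mu> \<Otimes>\<^sub>M \<mu>). (norm (fst z - snd z))\<^sup>2)"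
    using expectation_pair(2)[OF assms, of "\<lambda>z. (norm (fst z - snd z))\<^sup>2"] by simp
qed

text \<open>Given \<open>X i\<close>, the two distances are independent with the same mean
  \<open>mean_dist (X i)\<close>, so their product averages to its square.\<close>

lemma expectation_dist_mult_dist:
  assumes i: "i \<noteq> j" "i \<noteq> k" and jk: "j \<noteq> k"
  shows "expectation (\<lambda>\<omega>. norm (X i \<omega> - X j \<omega>) * norm (X i \<omega> - X k \<omega>)) = (LINT x|\<mu>. (law.mean_dist x)\<^sup>2)"
proof -
  let ?J = "{j, k}"
  let ?R = "\<lambda>\<omega>. restrict (\<lambda>j. X j \<omega>) ?J" and ?P = "PiM ?J (\<lambda>_. borel :: 'v measure)"
  let ?f = "\<lambda>p. norm (fst p - snd p j) * norm (fst p - snd p k)"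
  have [measurable]: "?R \<in> measurable M ?P" by measurable
  interpret R: prob_space "distr M ?P ?R" by (rule prob_space_distr) measurable
  interpret Q: pair_sigma_finite \<mu> "distr M ?P ?R" by unfold_locales
  have eq: "distr M (borel \<Otimes>\<^sub>M ?P) (\<lambda>\<omega>. (X i \<omega>, ?R \<omega>)) = \<mu> \<Otimes>\<^sub>M distr M ?P ?R"
    using indep_rv_one_rest[of i ?J] i by (simp add: indep_rv_iff_distr distr_X)
  have [measurable]: "?f \<in> borel_measurable (borel \<Otimes>\<^sub>M ?P)" by measurable
  have sq: "integrable M (\<lambda>\<omega>. (norm (X i \<omega> - X l \<omega>))\<^sup>2)" if "i \<noteq> l" for l
    using expectation_pair(1)[OF that, of "\<lambda>z. (norm (fst z - snd z))\<^sup>2"] law.integrable_pair_dist_sq by simp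
  have "integrable M (\<lambda>\<omega>. norm (X i \<omega> - X j \<omega>) * norm (X i \<omega> - X k \<omega>))"
    using i by (intro integrable_mult_of_sq sq) measurable
  then have int: "integrable (\<mu> \<Otimes>\<^sub>M distr M ?P ?R) ?f"
    unfolding eq[symmetric] by (subst integrable_distr_eq) auto
  have inner: "(LINT z|distr M ?P ?R. ?f (x, z)) = (law.mean_dist x)\<^sup>2" for x
  proof -
    have "(LINT z|distr M ?P ?R. ?f (x, z)) = expectation (\<lambda>\<omega>. norm (x - X j \<omega>) * norm (x - X k \<omega>))"
      by (subst integral_distr) auto
    also have "\<dots> = (LINT z|(\<mu> \<Otimes>\<^sub>M \<mu>). norm (x - fst z) * norm (x - snd z))"
      using expectation_pair(2)[OF jk, of "\<lambda>z. norm (x - fst z) * norm (x - snd z)"] by simp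
    also have "\<dots> = (LINT y|\<mu>. LINT z|\<mu>. norm (x - y) * norm (x - z))"
      using law.pair.integral_fst'[OF law.pair.integrable_pair_mult[OF law.integrable_dist law.integrable_dist]] by simp
    also have "\<dots> = (law.mean_dist x)\<^sup>2"
      by (simp add: law.mean_dist_def[symmetric] power2_eq_square)
    finally show ?thesis .
  qed
  have "expectation (\<lambda>\<omega>. norm (X i \<omega> - X j \<omega>) * norm (X i \<omega> - X k \<omega>)) = (LINT p|distr M (borel \<Otimes>\<^sub>M ?P) (\<lambda>\<omega>. (X i \<omega>, ?R \<omega>)). ?f p)"
    by (subst integral_distr) auto
  also have "\<dots> = (LINT x|\<mu>. LINT z|distr M ?P ?R. ?f (x, z))"
    unfolding eq by (rule Q.integral_fst'[OF int, symmetric])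
  finally show ?thesis unfolding inner .
qed

end

lemma char_normal_density:
  assumes s: "s > 0"
  shows "real_distribution (density lborel (normal_density 0 s))"
    "char (density lborel (normal_density 0 s)) t = of_real (exp (- ((s * t)\<^sup>2) / 2))"
proof -
  show "real_distribution (density lborel (normal_density 0 s))"
    using prob_space_normal_density[OF s] by (simp add: real_distribution_def real_distribution_axioms_def)
  \<comment> \<open>For this \<open>u\<close> the normal density is
    \<open>exp (- (u * x\<^sup>2))\<close> up to the factor
    \<open>1 / sqrt (2 * pi * s\<^sup>2)\<close>, which cancels the \<open>sqrt (pi / u)\<close> of
    the Fourier integral.\<close>
  let ?u = "1 / (2 * s\<^sup>2)"
  have u: "?u > 0" using s by simp
  have "char (density lborel (normal_density 0 s)) t = (CLINT x|lborel. normal_density 0 s x *\<^sub>R iexp (t * x))"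
    unfolding char_def by (rule integral_density) auto
  also have "\<dots> = (CLINT x|lborel. of_real (1 / sqrt (2 * pi * s\<^sup>2)) * (iexp (t * x) * of_real (exp (- (?u * x\<^sup>2)))))"
    by (intro Bochner_Integration.integral_cong) (auto simp: normal_density_def scaleR_conv_of_real)
  also have "\<dots> = of_real (1 / sqrt (2 * pi * s\<^sup>2)) * of_real (sqrt (pi / ?u) * exp (- (t\<^sup>2 / (4 * ?u))))"
    unfolding integral_mult_right_zero using has_bochner_integral_gaussian_iexp[OF u, of t]
    by (simp only: has_bochner_integral_iff)
  also have "\<dots> = of_real (1 / sqrt (2 * pi * s\<^sup>2) * sqrt (pi / ?u) * exp (- (t\<^sup>2 / (4 * ?u))))"
    by (simp only: of_real_mult mult.assoc)
  also have "1 / sqrt (2 * pi * s\<^sup>2) * sqrt (pi / ?u) = 1"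
    using s by (simp add: ac_simps)
  also have "t\<^sup>2 / (4 * ?u) = (s * t)\<^sup>2 / 2"
    using s by (simp add: power_mult_distrib field_simps)
  finally show "char (density lborel (normal_density 0 s)) t = of_real (exp (- ((s * t)\<^sup>2) / 2))"
    by simp
qed

lemma dVar_eq:
  assumes P: "prob_space P" and X: "X \<in> borel_measurable P"
    and law: "square_integrable_law (distr P borel X)"
  shows "dVar P X = sqrt (square_integrable_law.kern_var (distr P borel X))"
proof -
  interpret law: square_integrable_law "distr P borel X" by (rule law)
  have phi: "char_fun P X = law.phi"
    unfolding char_fun_def law.phi_def fun_eq_iff using X by (auto simp: integral_distr)
  have "(dist_const DIM('b))\<^sup>2 * law.kern_var \<ge> 0"
    using law.kern_var_nonneg by simp
  then show ?thesis
    unfolding dVar_def phi law.nn_integral_covariance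
    using dist_const_pos[of "DIM('b)"] by simp
qed

theorem theorem3:
  fixes P :: "'w measure" and X :: "'w \<Rightarrow> 'v::euclidean_space" and Y :: "'w \<Rightarrow> real"
    and M :: "'a measure" and Xs :: "nat \<Rightarrow> 'a \<Rightarrow> 'v" and Ys :: "nat \<Rightarrow> 'a \<Rightarrow> real"
    and N :: "'u measure" and U :: "'a \<Rightarrow> 'u"
    and \<tau> :: "nat \<Rightarrow> (nat \<Rightarrow> real) \<Rightarrow> 'u \<Rightarrow> nat \<Rightarrow> nat"
  assumes "prob_space P" and "prob_space M"
    and "nondegenerate P X"
    and "integrable P (\<lambda>\<omega>. norm (X \<omega>) ^ 4)"
    and "indep_rv P borel X borel Y"
    and "prob_space.indep_vars M (\<lambda>_. borel \<Otimes>\<^sub>M borel) (\<lambda>i \<omega>. (Xs i \<omega>, Ys i \<omega>)) UNIV"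
    and "\<And>i. distr M (borel \<Otimes>\<^sub>M borel) (\<lambda>\<omega>. (Xs i \<omega>, Ys i \<omega>)) =
             distr P (borel \<Otimes>\<^sub>M borel) (\<lambda>\<omega>. (X \<omega>, Y \<omega>))"
    and "sorting_rule N \<tau>"
    and "indep_rv M N U (\<Pi>\<^sub>M i\<in>UNIV. borel \<Otimes>\<^sub>M borel) (\<lambda>\<omega> i. (Xs i \<omega>, Ys i \<omega>))"
  shows "weak_conv_m
      (\<lambda>n. distr M borel (\<lambda>\<omega>. sqrt (real n) *
         DDC n (\<lambda>i. Xs i \<omega>) (\<tau> n (restrict (\<lambda>i. Ys i \<omega>) {..<n}) (U \<omega>))))
      (density lborel (\<lambda>x. ennreal
         (normal_density 0 (dVar P X / (LINT \<omega>|M. norm (Xs 0 \<omega> - Xs 1 \<omega>))) x)))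
    \<and> (dVar P X)\<^sup>2 =
        (LINT \<omega>|M. (norm (Xs 0 \<omega> - Xs 1 \<omega>))\<^sup>2)
        - 2 * (LINT \<omega>|M. norm (Xs 0 \<omega> - Xs 1 \<omega>) * norm (Xs 0 \<omega> - Xs 2 \<omega>))
        + (LINT \<omega>|M. norm (Xs 0 \<omega> - Xs 1 \<omega>))\<^sup>2"
proof -
  interpret P: prob_space P by fact
  interpret M: prob_space M by fact
  let ?\<mu> = "distr P borel X" and ?\<nu> = "distr P borel Y"
  have [measurable]: "X \<in> borel_measurable P" "Y \<in> borel_measurable P"
    using assms(5) by (auto simp: indep_rv_def)
  have pair [measurable]: "(\<lambda>\<omega>. (Xs i \<omega>, Ys i \<omega>)) \<in> measurable M (borel \<Otimes>\<^sub>M borel)" for i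
    using assms(6) by (auto simp: M.indep_vars_def)
  have Xs [measurable]: "Xs i \<in> borel_measurable M" and Ys [measurable]: "Ys i \<in> borel_measurable M" for i
    using measurable_compose[OF pair[of i] measurable_fst] measurable_compose[OF pair[of i] measurable_snd] by simp_all
  have marginal: "distr M borel (\<lambda>\<omega>. f (Xs i \<omega>, Ys i \<omega>)) = distr P borel (\<lambda>\<omega>. f (X \<omega>, Y \<omega>))"
    if [measurable]: "f \<in> borel_measurable (borel \<Otimes>\<^sub>M borel)" for i and f :: "'v \<times> real \<Rightarrow> 'c::topological_space"
  proof -
    have "distr M borel (\<lambda>\<omega>. f (Xs i \<omega>, Ys i \<omega>)) = distr (distr M (borel \<Otimes>\<^sub>M borel) (\<lambda>\<omega>. (Xs i \<omega>, Ys i \<omega>))) borel f"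
      by (subst distr_distr) (auto simp: comp_def)
    also have "\<dots> = distr P borel (\<lambda>\<omega>. f (X \<omega>, Y \<omega>))"
      unfolding assms(7) by (subst distr_distr) (auto simp: comp_def)
    finally show ?thesis .
  qed
  have distr_Xs: "distr M borel (Xs i) = ?\<mu>" and distr_Ys: "distr M borel (Ys i) = ?\<nu>" for i
    using marginal[of fst i] marginal[of snd i] by simp_all
  \<comment> \<open>Independence is a property of the joint law, so it passes from
    \<open>(X, Y)\<close> to every sample pair.\<close>
  have indep_XY: "indep_rv M borel (Xs i) borel (Ys i)" for i
    using assms(5) by (simp add: M.indep_rv_iff_distr P.indep_rv_iff_distr assms(7) distr_Xs distr_Ys)
  have "integrable P (\<lambda>\<omega>. (norm (X \<omega>))\<^sup>2)"
  proof (rule Bochner_Integration.integrable_bound)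
    show "integrable P (\<lambda>\<omega>. 1 + norm (X \<omega>) ^ 4)" using assms(4) by auto
    have "r\<^sup>2 \<le> 1 + r ^ 4" for r :: real
      using zero_le_power2[of "r\<^sup>2 - 1 / 2"] by (simp add: power2_eq_square power4_eq_xxxx algebra_simps)
    then show "AE \<omega> in P. norm ((norm (X \<omega>))\<^sup>2) \<le> norm (1 + norm (X \<omega>) ^ 4)" by simp
  qed measurable
  then have moment: "integrable ?\<mu> (\<lambda>x. (norm x)\<^sup>2)" by (subst integrable_distr_eq) auto
  have "M.indep_vars (\<lambda>_. borel) Xs UNIV"
    using M.indep_vars_compose2[OF assms(6), of "\<lambda>_. fst" "\<lambda>_. borel"] by simp
  then interpret iid: iid_sequence M Xs ?\<mu>
    using distr_Xs moment by unfold_locales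
  have nondeg: "\<not> (\<exists>c. AE x in ?\<mu>. x = c)"
    using assms(3) by (simp add: nondegenerate_def AE_distr_iff)
  \<comment> \<open>Besides allowing division, positivity makes the limit meaningful:
    \<open>normal_density\<close> with standard deviation 0 is identically 0 and no probability
    density.\<close>
  have pos: "iid.law.kern_var > 0" "iid.law.gini > 0"
    using iid.law.kern_var_pos iid.law.gini_pos nondeg by auto
  have dVar: "dVar P X = sqrt iid.law.kern_var"
    by (rule dVar_eq) (fact P.prob_space_axioms, measurable, unfold_locales)
  have gini: "(LINT \<omega>|M. norm (Xs 0 \<omega> - Xs 1 \<omega>)) = iid.law.gini"
    by (rule iid.expectation_dist) simp
  \<comment> \<open>\<open>normal_density\<close> is parametrised by the standard deviation, so the
    quotient appears unsquared.\<close>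
  let ?s = "sqrt iid.law.kern_var / iid.law.gini"
  have s: "?s > 0" using pos by simp
  have "weak_conv_m (\<lambda>n. distr M borel (\<lambda>\<omega>. sqrt (real n) * DDC n (\<lambda>i. Xs i \<omega>) id)) (density lborel (normal_density 0 ?s))"
  proof (rule levy_continuity)
    show "real_distribution (distr M borel (\<lambda>\<omega>. sqrt (real n) * DDC n (\<lambda>i. Xs i \<omega>) id))" for n
      unfolding iid.sqrt_DDC_eq by (intro M.real_distribution_distr) measurable
  qed (use iid.char_DDC[OF pos] char_normal_density[OF s] in simp_all)
  moreover have "(dVar P X)\<^sup>2 = (LINT \<omega>|M. (norm (Xs 0 \<omega> - Xs 1 \<omega>))\<^sup>2)
        - 2 * (LINT \<omega>|M. norm (Xs 0 \<omega> - Xs 1 \<omega>) * norm (Xs 0 \<omega> - Xs 2 \<omega>))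
        + (LINT \<omega>|M. norm (Xs 0 \<omega> - Xs 1 \<omega>))\<^sup>2"
    using pos by (simp add: dVar iid.law.kern_var_eq iid.expectation_dist iid.expectation_dist_mult_dist)
  \<comment> \<open>Weak convergence concerns the laws alone, so equality in law with the unsorted
    arrangement for every \<open>n\<close> is enough.\<close>
  ultimately show ?thesis
    unfolding dVar gini M.distr_DDC_sorted[OF assms(6) indep_XY distr_Xs assms(8,9)] by blast
qed

end
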